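(* Let $G$ be a $4$-regular polyhedron that is not one of the three $4$-regular polyhedra on at most $9$ vertices. Let $f(G)$ be the number of faces of $G$ and $f_3(G)$ the number of triangular faces of $G$. Then $G$ is a Deza graph with maximal number of triangular faces with respect to the total, i.e. $G$ is a Deza graph with $f_3(G)=\frac{2f(G)}{3}-\frac{4}{3}$, if and only if $G$ is (isomorphic to) the line graph of a cubic polyhedron of girth $5$.
   Context: Graphs are simple, undirected and finite. A polyhedron is a planar, $3$-connected graph; it has an essentially unique embedding in the sphere, and its faces are the regions of this embedding, each bounded by a cycle. Cubic means $3$-regular. The girth of a graph is the length of its shortest cycle. The line graph of $\Gamma$ has vertex set $E(\Gamma)$, two distinct edges of $\Gamma$ being adjacent if and only if they share an endpoint. A regular graph is a Deza graph if there exist integers $0\le\lambda\le\mu$ such that every two distinct vertices have either exactly $\lambda$ or exactly $\mu$ common neighbours. "Maximal number of triangular faces with respect to the total" means that equality holds in the upper bound $f_3(G)\le\frac{2f(G)}{3}-\frac43$, which is valid for all $4$-regular polyhedral Deza graphs on more than $9$ vertices. The three $4$-regular polyhedra on at most $9$ vertices are the octahedron ($6$ vertices), the square antiprism ($8$ vertices), and one on $9$ vertices (the line graph of the triangular prism). *)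

theory Defs
  imports "HOL-Analysis.Analysis" "HOL-Library.Extended_Nat"
begin

section \<open>Finite simple graphs\<close>

record 'a graph =
  verts :: "'a set"
  edges :: "'a set set"

definition simple_graph :: "'a graph \<Rightarrow> bool" where
  "simple_graph G \<longleftrightarrow>
     finite (verts G) \<and> (\<forall>e\<in>edges G. e \<subseteq> verts G \<and> card e = 2)"

definition neighbours :: "'a graph \<Rightarrow> 'a \<Rightarrow> 'a set" where
  "neighbours G u = {v \<in> verts G. {u, v} \<in> edges G}"

definition regular :: "nat \<Rightarrow> 'a graph \<Rightarrow> bool" where
  "regular k G \<longleftrightarrow> (\<forall>v\<in>verts G. card (neighbours G v) = k)"

definition graph_iso :: "'a graph \<Rightarrow> 'b graph \<Rightarrow> bool" where
  "graph_iso G H \<longleftrightarrow>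
     (\<exists>f. bij_betw f (verts G) (verts H) \<and>
          (\<forall>u\<in>verts G. \<forall>v\<in>verts G. {u, v} \<in> edges G \<longleftrightarrow> {f u, f v} \<in> edges H))"

definition line_graph :: "'a graph \<Rightarrow> 'a set graph" where
  "line_graph G = \<lparr>verts = edges G,
     edges = {{e, f} | e f. e \<in> edges G \<and> f \<in> edges G \<and> e \<noteq> f \<and> e \<inter> f \<noteq> {}}\<rparr>"

definition deza_graph :: "'a graph \<Rightarrow> bool" where
  "deza_graph G \<longleftrightarrow> (\<exists>k. regular k G) \<and>
     (\<exists>l m :: nat. l \<le> m \<and>
        (\<forall>u\<in>verts G. \<forall>v\<in>verts G. u \<noteq> v \<longrightarrow>
           card (neighbours G u \<inter> neighbours G v) = l \<or>
           card (neighbours G u \<inter> neighbours G v) = m))"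

subsection \<open>Cycles and girth\<close>

text \<open>A cycle is given by the list of its vertices, in cyclic order and without repetition.\<close>

definition cycle_edges :: "'a list \<Rightarrow> 'a set set" where
  "cycle_edges p = {{p ! i, p ! (Suc i mod length p)} | i. i < length p}"

definition is_cycle :: "'a graph \<Rightarrow> 'a list \<Rightarrow> bool" where
  "is_cycle G p \<longleftrightarrow>
     length p \<ge> 3 \<and> distinct p \<and> set p \<subseteq> verts G \<and> cycle_edges p \<subseteq> edges G"

text \<open>The girth of an acyclic graph is \<open>\<infinity>\<close>.\<close>

definition girth :: "'a graph \<Rightarrow> enat" where
  "girth G = (INF p \<in> {p. is_cycle G p}. enat (length p))"

subsection \<open>Connectivity\<close>

definition connected_graph :: "'a graph \<Rightarrow> bool" where
  "connected_graph G \<longleftrightarrow> verts G \<noteq> {} \<and>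
     (\<forall>u\<in>verts G. \<forall>v\<in>verts G. (u, v) \<in> {(x, y). {x, y} \<in> edges G}\<^sup>*)"

definition delete_verts :: "'a graph \<Rightarrow> 'a set \<Rightarrow> 'a graph" where
  "delete_verts G X = \<lparr>verts = verts G - X, edges = {e \<in> edges G. e \<inter> X = {}}\<rparr>"

definition vertex_connected :: "nat \<Rightarrow> 'a graph \<Rightarrow> bool" where
  "vertex_connected k G \<longleftrightarrow> card (verts G) > k \<and>
     (\<forall>X \<subseteq> verts G. card X < k \<longrightarrow> connected_graph (delete_verts G X))"

section \<open>Embeddings, planarity and faces\<close>

text \<open>
  An embedding of \<open>G\<close> in a subset \<open>S\<close> of a topological space places the vertices at distinct points
  (given by \<open>pos\<close>) and draws every edge as a simple arc (given by \<open>crv\<close>) between its two endpoints,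
  such that an arc passes through no other vertex and distinct arcs meet only in common endpoints.
\<close>

definition embedding ::
    "'a graph \<Rightarrow> 'b::topological_space set \<Rightarrow> ('a \<Rightarrow> 'b) \<Rightarrow> ('a set \<Rightarrow> real \<Rightarrow> 'b) \<Rightarrow> bool" where
  "embedding G S pos crv \<longleftrightarrow>
     inj_on pos (verts G) \<and> pos ` verts G \<subseteq> S \<and>
     (\<forall>e\<in>edges G. arc (crv e) \<and> path_image (crv e) \<subseteq> S \<and>
        {pathstart (crv e), pathfinish (crv e)} = pos ` e \<and>
        path_image (crv e) \<inter> pos ` verts G = pos ` e) \<and>
     (\<forall>e\<in>edges G. \<forall>f\<in>edges G. e \<noteq> f \<longrightarrow>
        path_image (crv e) \<inter> path_image (crv f) = pos ` (e \<inter> f))"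

definition planar :: "'a graph \<Rightarrow> bool" where
  "planar G \<longleftrightarrow> (\<exists>pos crv. embedding G (UNIV :: complex set) pos crv)"

definition polyhedral_graph :: "'a graph \<Rightarrow> bool" where
  "polyhedral_graph G \<longleftrightarrow> simple_graph G \<and> planar G \<and> vertex_connected 3 G"

abbreviation unit_sphere :: "(real^3) set" where
  "unit_sphere \<equiv> sphere 0 1"

text \<open>The faces of a graph embedded in the sphere are the regions into which it divides the sphere.\<close>

definition faces ::
    "'a graph \<Rightarrow> ('a \<Rightarrow> real^3) \<Rightarrow> ('a set \<Rightarrow> real \<Rightarrow> real^3) \<Rightarrow> (real^3) set set" where
  "faces G pos crv =
     components (unit_sphere - (pos ` verts G \<union> (\<Union>e\<in>edges G. path_image (crv e))))"

text \<open>
  The boundary of a face is its frontier relative to the sphere; its frontier in the surrounding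
  space would be the whole closed face.
\<close>

definition triangular_faces ::
    "'a graph \<Rightarrow> ('a \<Rightarrow> real^3) \<Rightarrow> ('a set \<Rightarrow> real \<Rightarrow> real^3) \<Rightarrow> (real^3) set set" where
  "triangular_faces G pos crv = {F \<in> faces G pos crv.
     \<exists>p. is_cycle G p \<and> length p = 3 \<and>
       top_of_set unit_sphere frontier_of F = (\<Union>e\<in>cycle_edges p. path_image (crv e))}"

section \<open>The 4-regular polyhedra on at most nine vertices\<close>

text \<open>The octahedron is the complete tripartite graph with three parts of size two.\<close>

definition octahedron :: "nat graph" where
  "octahedron = \<lparr>verts = {..<6},
     edges = {{i, j} | i j. i < 6 \<and> j < 6 \<and> i mod 3 \<noteq> j mod 3}\<rparr>"

text \<open>
  The two squares of the antiprism are the even and the odd vertices; the differences 2 give the sides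
  of the squares and the differences 1 the zigzag between them.
\<close>

definition square_antiprism :: "nat graph" where
  "square_antiprism = \<lparr>verts = {..<8},
     edges = {{i, (i + d) mod 8} | i d. i < 8 \<and> d \<in> {1, 2}}\<rparr>"

definition triangular_prism :: "nat graph" where
  "triangular_prism = \<lparr>verts = {..<6},
     edges = {{0, 1}, {1, 2}, {2, 0}, {3, 4}, {4, 5}, {5, 3}, {0, 3}, {1, 4}, {2, 5}}\<rparr>"

end

theory Submission
  imports Defs
begin

text \<open>
  Moving the drawing into the plane, Euler's formula gives \<open>f = |V| + 2\<close>, so the equality says
  \<open>3 f\<^sub>3 = 2 |V|\<close>. The edges whose open arc meets the frontier of a face contain a cycle, every edge
  is counted by at most two faces, and hence \<open>f\<^sub>3 \<ge> 8\<close> and \<open>|V| \<ge> 12\<close>; a local analysis of common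
  neighbours then leaves only the Deza parameters \<open>\<lambda> = 0\<close>, \<open>\<mu> = 1\<close>. In this case there are at most
  \<open>2 |V| / 3\<close> triangles, so equality forces every edge into exactly one triangle and every triangle
  to bound a face. The triangles, joined whenever they share a vertex of \<open>G\<close>, form the cubic root
  graph: it is drawn by placing a tripod into each triangular face, it inherits 3-connectedness
  from \<open>G\<close>, a cycle of length 3 or 4 in it would give two common neighbours, and Euler's formula
  gives it a cycle of length at most 5. Conversely, the triangles of the line graph of a cubic
  polyhedron of girth 5 are the stars of its vertices; none of them separates, so by the Jordan
  curve theorem all of them bound faces.
\<close>

section \<open>Arcs and complementary regions in the plane\<close>

text \<open>A face is only a component of a complement, with no boundary walk attached. Faces are
  therefore counted through inequalities on borders, and a frontier is determined exactly only for a
  triangle, where the Jordan curve theorem describes both sides. The effect of adding arcs to a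
  drawing is controlled by Janiszewski's theorem: a compact and a closed set that meet in a
  connected set and do not separate two points individually do not separate them jointly. The local
  analysis starts from a row sum: at every vertex the common-neighbour counts add up to 4 * 3 = 12,
  so few vertices are possible when all counts are positive. The equality
  \<open>3 f3 = 2 |V|\<close> also makes \<open>|V|\<close> a multiple of 3, which removes the
  borderline value 13. Once every edge lies in exactly one triangle, the four edges at a vertex are
  paired off by two triangles. This is why a vertex of \<open>G\<close> can be read as an edge
  between two triangles. Connectivity transfers because an edge cut of the root is a vertex cut of
  \<open>G\<close>, and in a cubic graph a small vertex cut yields a small edge cut.\<close>

lemma interior_arc_image_empty:
  fixes g :: "real \<Rightarrow> complex"
  assumes "arc g"
  shows "interior (path_image g) = {}"
proof (rule ccontr)
  assume ne: "interior (path_image g) \<noteq> {}"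
  obtain h where "homeomorphism {0..1} (path_image g) g h"
    using assms homeomorphism_arc by blast
  then have h: "continuous_on (path_image g) h" "inj_on h (path_image g)"
    by (auto simp: homeomorphism_def inj_on_def) (metis image_eqI)
  have "DIM(complex) \<le> DIM(real)"
  proof (rule invariance_of_dimension [OF _ open_interior _ ne])
    show "continuous_on (interior (path_image g)) h" "inj_on h (interior (path_image g))"
      using h interior_subset by (blast intro: continuous_on_subset inj_on_subset)+
  qed
  then show False by simp
qed

text \<open>A component of \<open>X - A\<close> lies in one component of \<open>X\<close>; those
  other than \<open>F\<close> are untouched because \<open>A\<close> does not reach them. Adding an
  arc to a drawing is thereby reduced to its effect inside a single face.\<close>

lemma components_Diff_subset:
  fixes X :: "'a::topological_space set"
  assumes F: "F \<in> components X" and A: "X \<inter> A \<subseteq> F"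
  shows "components (X - A) = (components X - {F}) \<union> components (F - A)"
proof (intro equalityI subsetI)
  fix C assume C: "C \<in> components (X - A)"
  then have C': "connected C" "C \<noteq> {}" "C \<subseteq> X - A"
    and mx: "\<And>D. D \<noteq> {} \<Longrightarrow> C \<subseteq> D \<Longrightarrow> D \<subseteq> X - A \<Longrightarrow> connected D \<Longrightarrow> D = C"
    by (auto simp: in_components_maximal)
  then obtain E where E: "E \<in> components X" "C \<subseteq> E"
    by (metis Diff_subset exists_component_superset subset_empty subset_trans)
  show "C \<in> (components X - {F}) \<union> components (F - A)"
  proof (cases "E = F")
    case True
    have "D = C" if "D \<noteq> {}" "C \<subseteq> D" "D \<subseteq> F - A" "connected D" for D
      using mx[of D] that in_components_subset[OF F] by blast
    moreover have "C \<subseteq> F - A" using C' E True by blast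
    ultimately have "C \<in> components (F - A)"
      using C'(1,2) unfolding in_components_maximal by simp
    then show ?thesis by blast
  next
    case False
    then have "E \<inter> F = {}" using E F components_nonoverlap by blast
    then have "E \<subseteq> X - A" using A in_components_subset[OF E(1)] by blast
    then have "E = C" using mx[of E] E in_components_connected[OF E(1)] in_components_nonempty[OF E(1)] by simp
    then show ?thesis using E(1) False by simp
  qed
next
  fix C assume "C \<in> (components X - {F}) \<union> components (F - A)"
  then show "C \<in> components (X - A)"
  proof
    assume C: "C \<in> components X - {F}"
    then have "C \<inter> F = {}" using F components_nonoverlap by blast
    then have "C \<subseteq> X - A" using A C in_components_subset by blast
    moreover have "D = C" if "D \<noteq> {}" "C \<subseteq> D" "D \<subseteq> X - A" "connected D" for D
    proof -
      have "D \<subseteq> C"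
        using components_maximal[of C X D] C that in_components_nonempty[of C X] by blast
      then show ?thesis using that by blast
    qed
    moreover have "connected C" "C \<noteq> {}"
      using C in_components_connected in_components_nonempty by blast+
    ultimately show ?thesis unfolding in_components_maximal by simp
  next
    assume C: "C \<in> components (F - A)"
    have "D = C" if D: "D \<noteq> {}" "C \<subseteq> D" "D \<subseteq> X - A" "connected D" for D
    proof -
      have "D \<inter> F \<noteq> {}"
        using C D in_components_nonempty in_components_subset by blast
      then have "D \<subseteq> F"
        using D F components_maximal[of F X D] by blast
      then have "D \<subseteq> F - A" using D by blast
      moreover have "C \<inter> D \<noteq> {}" using D C in_components_nonempty by blast
      ultimately have "D \<subseteq> C" using components_maximal[OF C \<open>connected D\<close>] by blast
      then show ?thesis using D by blast
    qed
    moreover have "connected C" "C \<noteq> {}" "C \<subseteq> X - A"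
      using C in_components_connected in_components_nonempty in_components_subset[OF C]
        in_components_subset[OF F] by blast+
    ultimately show ?thesis unfolding in_components_maximal by simp
  qed
qed

lemma components_connected: "connected X \<Longrightarrow> X \<noteq> {} \<Longrightarrow> components X = {X}"
  by (simp add: components_eq_sing_iff)

lemma components_Un_separation:
  fixes I Q :: "complex set"
  assumes "connected I" "connected Q" "I \<noteq> {}" "Q \<noteq> {}" "I \<inter> Q = {}" "open I" "open Q"
  shows "components (I \<union> Q) = {I, Q}"
proof -
  have *: "C \<in> components (P \<union> R)" if "connected C" "C \<noteq> {}" "C = P" "open P" "open R" "P \<inter> R = {}" for C P R :: "complex set"
  proof -
    have "D = P" if "P \<subseteq> D" "D \<subseteq> P \<union> R" "connected D" for D
    proof -
      have "R \<inter> D = {}" using connectedD[OF \<open>connected D\<close> \<open>open P\<close> \<open>open R\<close>] that \<open>P \<inter> R = {}\<close>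
        \<open>C \<noteq> {}\<close> \<open>C = P\<close> by blast
      then show ?thesis using that by blast
    qed
    then show ?thesis using that by (auto simp: in_components_maximal)
  qed
  have 1: "I \<in> components (I \<union> Q)" using * assms by blast
  have 2: "Q \<in> components (I \<union> Q)" using *[of Q Q I] assms by (simp add: Un_commute Int_commute)
  have "C = I \<or> C = Q" if "C \<in> components (I \<union> Q)" for C
    using that 1 2 components_nonoverlap[OF that 1] components_nonoverlap[OF that 2]
      in_components_subset[OF that] in_components_nonempty[OF that] by blast
  then show ?thesis using 1 2 by blast
qed

text \<open>A connected set that properly extends \<open>F\<close> meets \<open>frontier F\<close>
  and hence \<open>K\<close>. Regions are recognised by this criterion later, also when part of a
  drawing has been erased.\<close>

lemma component_of_frontier_subset:
  assumes "F \<noteq> {}" "connected F" "F \<inter> K = {}" "frontier F \<subseteq> K"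
  shows "F \<in> components (- K)"
proof -
  have "D = F" if D: "F \<subseteq> D" "D \<subseteq> - K" "connected D" for D
  proof (rule ccontr)
    assume "D \<noteq> F"
    then have "D \<inter> frontier F \<noteq> {}"
      using D assms(1) by (intro connected_Int_frontier) auto
    then show False using D assms(4) by blast
  qed
  then show ?thesis using assms by (auto simp: in_components_maximal)
qed

lemma connected_arc_image_minus_endpoints:
  fixes g :: "real \<Rightarrow> 'a::t2_space"
  assumes "arc g" "E \<subseteq> {pathstart g, pathfinish g}"
  shows "connected (path_image g - E)"
proof -
  have inj: "inj_on g {0..1}" and cont: "continuous_on {0..1} g"
    using assms by (auto simp: arc_def path_def)
  define J where "J = {0..1} - {t\<in>{0..1}. g t \<in> E}"
  have J: "J \<subseteq> {0..1}" "{0<..<1} \<subseteq> J"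
    using inj assms(2) by (force simp: J_def inj_on_def pathstart_def pathfinish_def)+
  have "path_image g - E = g ` J" unfolding path_image_def J_def by auto
  moreover have "connected J"
    by (rule connected_intermediate_closure[of "{0<..<1::real}"]) (use J in auto)
  ultimately show ?thesis
    using cont J by (simp add: connected_continuous_image continuous_on_subset)
qed

lemma arc_image_minus_endpoints_nonempty:
  assumes "arc g"
  shows "path_image g - {pathstart g, pathfinish g} \<noteq> {}"
proof -
  have "g (1/2) \<noteq> g 0" "g (1/2) \<noteq> g 1"
    using assms inj_onD[of g "{0..1}" "1/2" 0] inj_onD[of g "{0..1}" "1/2" 1] by (auto simp: arc_def)
  moreover have "g (1/2) \<in> path_image g" by (simp add: path_image_def)
  ultimately show ?thesis by (auto simp: pathstart_def pathfinish_def)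
qed

text \<open>A connected set avoiding \<open>K\<close> that starts in \<open>F\<close> stays in
  \<open>F\<close> by maximality. So it is enough to connect points in the complement of
  \<open>K\<close> and \<open>A\<close>, which is the form in which Janiszewski's theorem delivers
  connections.\<close>

lemma component_minus_arc_connected:
  fixes K A :: "complex set"
  assumes "F \<in> components (- K)" "- (K \<union> A) \<noteq> {}"
    and "\<And>x y. x \<in> F - A \<Longrightarrow> y \<in> F - A \<Longrightarrow> connected_component (- (K \<union> A)) x y"
  shows "connected (F - A)"
proof -
  have "connected_component (F - A) x y" if xy: "x \<in> F - A" "y \<in> F - A" for x y
  proof -
    obtain T where T: "connected T" "T \<subseteq> - (K \<union> A)" "x \<in> T" "y \<in> T"
      using assms(3)[OF xy] by (auto simp: connected_component_def)
    then have "T \<subseteq> F" using assms(1) xy components_maximal[of F "- K" T] by blast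
    then show ?thesis using T by (auto simp: connected_component_def)
  qed
  then show ?thesis by (simp add: connected_iff_connected_component)
qed

lemma connected_Compl_Un_Janiszewski:
  fixes S T :: "complex set"
  assumes "compact S" "closed T" "connected (S \<inter> T)" "connected (- S)" "connected (- T)"
  shows "connected (- (S \<union> T))"
  unfolding connected_iff_connected_component
proof (intro ballI)
  fix x y assume "x \<in> - (S \<union> T)" "y \<in> - (S \<union> T)"
  then show "connected_component (- (S \<union> T)) x y"
    using assms by (intro Janiszewski) (auto simp: connected_iff_connected_component)
qed

lemma component_containing_arc:
  fixes K :: "complex set"
  assumes "arc g" and K: "path_image g \<inter> K \<subseteq> {pathstart g, pathfinish g}"
    "path_image g \<inter> K \<noteq> {}"
  obtains F where "F \<in> components (- K)" "path_image g - K \<subseteq> F" "path_image g - K \<noteq> {}"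
proof -
  have eq: "path_image g - K = path_image g - (path_image g \<inter> K)" by blast
  have "connected (path_image g - K)" unfolding eq
    using assms by (intro connected_arc_image_minus_endpoints) auto
  moreover have "path_image g - K \<noteq> {}"
    using arc_image_minus_endpoints_nonempty[OF assms(1)] K by blast
  ultimately show ?thesis using that exists_component_superset[of "path_image g - K" "- K"] by auto
qed

text \<open>\<open>K\<close> and the arc meet in a single point, a connected set, and an arc alone
  does not separate the plane; Janiszewski's theorem then keeps \<open>F\<close> minus the arc in
  one piece. This piece is nonempty because \<open>F\<close> is open and an arc has empty
  interior.\<close>

lemma components_Un_pendant_arc:
  fixes K :: "complex set"
  assumes K: "compact K" and g: "arc g" and gK: "path_image g \<inter> K = {pathstart g} \<or> path_image g \<inter> K = {pathfinish g}"
  obtains F where "F \<in> components (- K)" "path_image g - K \<subseteq> F" "F - path_image g \<noteq> {}"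
    "components (- (K \<union> path_image g)) = (components (- K) - {F}) \<union> {F - path_image g}"
proof -
  let ?A = "path_image g"
  obtain F where F: "F \<in> components (- K)" "?A - K \<subseteq> F"
    by (rule component_containing_arc[OF g, of K]) (use gK in auto)
  have eq: "- (K \<union> ?A) = - K - ?A" by blast
  have "open F" using F(1) K by (meson compact_imp_closed open_Compl open_components)
  have ne: "F - ?A \<noteq> {}"
  proof
    assume "F - ?A = {}"
    then have "F \<subseteq> interior ?A" using \<open>open F\<close> by (simp add: interior_maximal)
    then show False using interior_arc_image_empty[OF g] in_components_nonempty[OF F(1)] by blast
  qed
  have "connected (F - ?A)"
  proof (rule component_minus_arc_connected[OF F(1)])
    show "- (K \<union> ?A) \<noteq> {}" using ne in_components_subset[OF F(1)] by blast
    fix x y assume x: "x \<in> F - ?A" "y \<in> F - ?A"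
    show "connected_component (- (K \<union> ?A)) x y"
    proof (rule Janiszewski[OF K])
      show "closed ?A" using g by (simp add: arc_imp_path closed_path_image)
      show "connected (K \<inter> ?A)" using gK by (auto simp: Int_commute)
      show "connected_component (- K) x y" using F(1) x in_components_connected in_components_subset
        unfolding connected_component_def by blast
      have "connected (- ?A)" using g by (simp add: connected_arc_complement)
      then show "connected_component (- ?A) x y" using x unfolding connected_component_def by blast
    qed
  qed
  then have "components (F - ?A) = {F - ?A}" using ne by (rule components_connected)
  moreover have "components (- K - ?A) = (components (- K) - {F}) \<union> components (F - ?A)"
    using F by (intro components_Diff_subset) auto
  ultimately show ?thesis using that F ne eq by metis
qed

lemma Jordan_two_arcs:
  fixes p g :: "real \<Rightarrow> complex"
  assumes "arc p" "arc g" "pathstart p = pathstart g" "pathfinish p = pathfinish g"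
    "path_image p \<inter> path_image g = {pathstart g, pathfinish g}"
  obtains I Q where "open I" "open Q" "connected I" "connected Q" "I \<noteq> {}" "Q \<noteq> {}" "I \<inter> Q = {}"
    "I \<union> Q = - (path_image p \<union> path_image g)"
    "frontier I = path_image p \<union> path_image g" "frontier Q = path_image p \<union> path_image g"
proof -
  define c where "c = p +++ reversepath g"
  have "simple_path c" unfolding c_def
    using assms by (intro simple_path_join_loop) (auto simp: arc_reversepath)
  moreover have "pathfinish c = pathstart c" using assms by (simp add: c_def)
  moreover have "path_image c = path_image p \<union> path_image g"
    unfolding c_def using assms by (simp add: path_image_join)
  ultimately show ?thesis using Jordan_curve[of c] that by metis
qed

text \<open>
  Close the chord to a Jordan curve by an arc \<open>p\<close> inside \<open>K\<close>. Janiszewski's theorem applies to \<open>K\<close> and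
  this curve, since they meet exactly in \<open>p\<close>: two points of \<open>F\<close> on the same side of the curve are
  not separated.
\<close>

lemma components_Un_chord:
  fixes K :: "complex set"
  assumes K: "compact K" "path_connected K" and g: "arc g"
    and gK: "path_image g \<inter> K = {pathstart g, pathfinish g}"
  obtains F D1 D2 where "F \<in> components (- K)" "path_image g - K \<subseteq> F"
    "D1 \<noteq> D2" "D1 \<subseteq> F" "D2 \<subseteq> F" "D1 \<noteq> {}" "D2 \<noteq> {}"
    "components (- (K \<union> path_image g)) = (components (- K) - {F}) \<union> {D1, D2}"
proof -
  let ?A = "path_image g"
  have ends: "pathstart g \<in> K" "pathfinish g \<in> K" "pathstart g \<noteq> pathfinish g"
    using gK arc_distinct_ends[OF g] by auto
  then obtain p where p: "arc p" "path_image p \<subseteq> K" "pathstart p = pathstart g" "pathfinish p = pathfinish g"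
    using K(2) unfolding path_connected_arcwise by meson
  have pg: "path_image p \<inter> ?A = {pathstart g, pathfinish g}"
    using p(2-4) gK pathstart_in_path_image[of p] pathfinish_in_path_image[of p] by auto
  obtain I Q where J: "open I" "open Q" "connected I" "connected Q" "I \<inter> Q = {}"
    "I \<union> Q = - (path_image p \<union> ?A)"
    "frontier I = path_image p \<union> ?A" "frontier Q = path_image p \<union> ?A"
    using Jordan_two_arcs[OF p(1) g p(3,4) pg] by metis
  obtain F where F: "F \<in> components (- K)" "?A - K \<subseteq> F" and ne: "?A - K \<noteq> {}"
    by (rule component_containing_arc[OF g, of K]) (use gK in auto)
  have oF: "open F" using F(1) K by (meson compact_imp_closed open_Compl open_components)
  have FK: "F \<subseteq> - K" by (rule in_components_subset[OF F(1)])
  \<comment> \<open>The open chord lies in \<open>F\<close> and on the frontier of both sides of the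
    Jordan curve. As \<open>F\<close> is open, it reaches into both sides, so the chord really
    splits it.\<close>
  have meets: "F \<inter> W \<noteq> {}" if "frontier W = path_image p \<union> ?A" for W
  proof -
    obtain x where "x \<in> ?A - K" using ne by blast
    then have "x \<in> closure W" "x \<in> F" using that F by (auto simp: frontier_def)
    then show ?thesis using oF by (metis IntI empty_iff open_Int_closure_eq_empty)
  qed
  have split: "F - ?A = (F \<inter> I) \<union> (F \<inter> Q)" using J FK p by blast
  have conn: "connected (F \<inter> W)" if W: "W \<in> {I, Q}" for W
    unfolding connected_iff_connected_component
  proof (intro ballI)
    fix x y assume xy: "x \<in> F \<inter> W" "y \<in> F \<inter> W"
    have W': "W \<subseteq> - (path_image p \<union> ?A)" "connected W" using J W by auto
    have "connected_component (- (K \<union> (path_image p \<union> ?A))) x y"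
    proof (rule Janiszewski[OF K(1)])
      show "closed (path_image p \<union> ?A)" using g p by (simp add: arc_imp_path closed_path_image closed_Un)
      have "K \<inter> (path_image p \<union> ?A) = path_image p" using p gK pg by auto
      then show "connected (K \<inter> (path_image p \<union> ?A))" using p by (simp add: arc_imp_path connected_path_image)
      show "connected_component (- K) x y" using F(1) xy in_components_connected FK
        unfolding connected_component_def by blast
      show "connected_component (- (path_image p \<union> ?A)) x y" using xy W' unfolding connected_component_def by blast
    qed
    then obtain T where T: "connected T" "T \<subseteq> - (K \<union> (path_image p \<union> ?A))" "x \<in> T" "y \<in> T"
      by (auto simp: connected_component_def)
    then have "T \<subseteq> F" using F(1) xy components_maximal[of F "- K" T] by blast
    moreover have "T \<subseteq> W"
      using connectedD[OF T(1) J(1,2)] T J W xy by blast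
    ultimately show "connected_component (F \<inter> W) x y" using T by (auto simp: connected_component_def)
  qed
  have "components (F - ?A) = {F \<inter> I, F \<inter> Q}" unfolding split
    using J oF conn meets by (intro components_Un_separation) auto
  moreover have "- (K \<union> ?A) = - K - ?A" by blast
  moreover have "components (- K - ?A) = (components (- K) - {F}) \<union> components (F - ?A)"
    using F by (intro components_Diff_subset) auto
  moreover have "F \<inter> I \<noteq> F \<inter> Q" "F \<inter> I \<noteq> {}" "F \<inter> Q \<noteq> {}" using J meets by blast+
  ultimately show ?thesis using that[of F "F \<inter> I" "F \<inter> Q"] F by simp
qed

lemma subset_component_of_other:
  assumes "F \<in> components X" "D \<subseteq> F" "D \<noteq> {}"
  shows "D \<notin> components X - {F}"
  using assms components_nonoverlap[of F X D] by blast

lemma card_components_Un_pendant_arc: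
  fixes K :: "complex set"
  assumes "compact K" "arc g" "path_image g \<inter> K = {pathstart g} \<or> path_image g \<inter> K = {pathfinish g}"
    and fin: "finite (components (- K))"
  shows "finite (components (- (K \<union> path_image g)))" (is ?a)
    and "card (components (- (K \<union> path_image g))) = card (components (- K))" (is ?b)
proof -
  obtain F where F: "F \<in> components (- K)" "F - path_image g \<noteq> {}"
    "components (- (K \<union> path_image g)) = (components (- K) - {F}) \<union> {F - path_image g}"
    using components_Un_pendant_arc[OF assms(1-3)] by metis
  have "F - path_image g \<notin> components (- K) - {F}" using F by (intro subset_component_of_other) auto
  moreover have "card (components (- K) - {F}) + 1 = card (components (- K))"
    using F(1) fin by (metis One_nat_def Suc_eq_plus1 card_Suc_Diff1)
  ultimately show ?a ?b unfolding F(3) using fin by auto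
qed

lemma card_components_Un_chord:
  fixes K :: "complex set"
  assumes "compact K" "path_connected K" "arc g" "path_image g \<inter> K = {pathstart g, pathfinish g}"
    and fin: "finite (components (- K))"
  shows "finite (components (- (K \<union> path_image g)))" (is ?a)
    and "card (components (- (K \<union> path_image g))) = card (components (- K)) + 1" (is ?b)
proof -
  obtain F D1 D2 where F: "F \<in> components (- K)" "D1 \<noteq> D2" "D1 \<subseteq> F" "D2 \<subseteq> F" "D1 \<noteq> {}" "D2 \<noteq> {}"
    "components (- (K \<union> path_image g)) = (components (- K) - {F}) \<union> {D1, D2}"
    using components_Un_chord[OF assms(1-4)] by metis
  have "D1 \<notin> components (- K) - {F}" "D2 \<notin> components (- K) - {F}"
    using subset_component_of_other[OF F(1)] F(3-6) by blast+
  moreover have "card (components (- K) - {F}) + 1 = card (components (- K))"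
    using F fin by (metis One_nat_def Suc_eq_plus1 card_Suc_Diff1)
  moreover have "finite (components (- K) - {F})" using fin by simp
  moreover define B where "B = components (- K) - {F}"
  ultimately have "D1 \<notin> B" "D2 \<notin> B" "finite B" "card B + 1 = card (components (- K))" by simp_all
  then have "finite (B \<union> {D1, D2})" "card (B \<union> {D1, D2}) = card (components (- K)) + 1"
    using F(2) by simp_all
  then show ?a ?b unfolding F(7) B_def by simp_all
qed

section \<open>Combinatorial preliminaries on graphs\<close>

lemma simple_graphD:
  assumes "simple_graph G"
  shows "finite (verts G)" "finite (edges G)"
    and "e \<in> edges G \<Longrightarrow> e \<subseteq> verts G" "e \<in> edges G \<Longrightarrow> card e = 2"
proof -
  show "finite (verts G)" "e \<in> edges G \<Longrightarrow> e \<subseteq> verts G" "e \<in> edges G \<Longrightarrow> card e = 2"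
    using assms by (auto simp: simple_graph_def)
  have "edges G \<subseteq> Pow (verts G)" using assms by (auto simp: simple_graph_def)
  then show "finite (edges G)"
    using \<open>finite (verts G)\<close> by (meson finite_Pow_iff finite_subset)
qed

lemma simple_graph_edgeE:
  assumes "simple_graph G" "e \<in> edges G"
  obtains a b where "e = {a, b}" "a \<noteq> b" "a \<in> verts G" "b \<in> verts G"
proof -
  obtain a b where "e = {a, b}" "a \<noteq> b"
    using simple_graphD(4)[OF assms] by (meson card_2_iff)
  then show ?thesis using that simple_graphD(3)[OF assms] by blast
qed

text \<open>Together with its converse \<open>connected_graphI\<close>, this lets the connectivity
  arguments below run on vertex sets closed under adjacency instead of on paths.\<close>

lemma connected_graph_closed_set:
  assumes conn: "connected_graph G" and u: "u \<in> U" "u \<in> verts G"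
    and closed: "\<And>x y. x \<in> U \<Longrightarrow> {x, y} \<in> edges G \<Longrightarrow> y \<in> U"
  shows "verts G \<subseteq> U"
proof
  fix v assume "v \<in> verts G"
  then have "(u, v) \<in> {(x, y). {x, y} \<in> edges G}\<^sup>*"
    using conn u by (simp add: connected_graph_def)
  then show "v \<in> U" by (induction rule: rtrancl_induct) (use u closed in auto)
qed

lemma neighbours_sym: "simple_graph G \<Longrightarrow> u \<in> neighbours G v \<longleftrightarrow> v \<in> neighbours G u"
  by (auto simp: neighbours_def simple_graph_def insert_commute)

lemma neighbours_edge: "simple_graph G \<Longrightarrow> v \<in> neighbours G u \<longleftrightarrow> {u, v} \<in> edges G"
  by (auto simp: neighbours_def simple_graph_def)

lemma neighbours_irrefl: "simple_graph G \<Longrightarrow> u \<notin> neighbours G u"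
  by (auto simp: neighbours_def simple_graph_def)

lemma finite_neighbours: "simple_graph G \<Longrightarrow> finite (neighbours G u)"
  by (auto simp: neighbours_def simple_graph_def)

lemma card_incident_edges:
  assumes "simple_graph G"
  shows "card {e \<in> edges G. v \<in> e} = card (neighbours G v)"
proof -
  have "{e \<in> edges G. v \<in> e} = (\<lambda>w. {v, w}) ` neighbours G v"
  proof (intro equalityI subsetI)
    fix e assume e: "e \<in> {e \<in> edges G. v \<in> e}"
    then obtain a b where "e = {a, b}" "a \<in> verts G" "b \<in> verts G"
      using simple_graph_edgeE[OF assms(1)] by blast
    then show "e \<in> (\<lambda>w. {v, w}) ` neighbours G v"
      using e by (auto simp: neighbours_def insert_commute)
  qed (auto simp: neighbours_def)
  moreover have "inj_on (\<lambda>w. {v, w}) (neighbours G v)"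
    by (auto simp: inj_on_def doubleton_eq_iff)
  ultimately show ?thesis by (simp add: card_image)
qed

lemma handshake:
  assumes "simple_graph G" "regular k G"
  shows "k * card (verts G) = 2 * card (edges G)"
proof -
  note s = simple_graphD[OF assms(1)]
  have "(\<Sum>e\<in>edges G. card {v\<in>verts G. v \<in> e}) = k * card (verts G)"
  proof (rule sum_multicount[OF s(2) s(1)], rule ballI)
    fix v assume "v \<in> verts G"
    then show "card {e \<in> edges G. v \<in> e} = k"
      using assms(2) card_incident_edges[OF assms(1)] by (simp add: regular_def)
  qed
  moreover have "{v\<in>verts G. v \<in> e} = e" if "e \<in> edges G" for e using s(3)[OF that] by blast
  then have "(\<Sum>e\<in>edges G. card {v\<in>verts G. v \<in> e}) = (\<Sum>e\<in>edges G. 2)"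
    using s(4) by (intro sum.cong) auto
  ultimately show ?thesis by simp
qed

subsection \<open>Cycles\<close>

text \<open>Two positions carrying the same edge would be cyclic successors of each other, which is
  impossible from length 3 on.\<close>

lemma card_cycle_edges:
  assumes "distinct p" "length p \<ge> 3"
  shows "card (cycle_edges p) = length p"
proof -
  let ?n = "length p"
  let ?f = "\<lambda>i. {p ! i, p ! (Suc i mod ?n)}"
  have "inj_on ?f {..<?n}"
  proof (rule inj_onI)
    fix i j assume ij: "i \<in> {..<?n}" "j \<in> {..<?n}" "?f i = ?f j"
    have lt: "Suc i mod ?n < ?n" "Suc j mod ?n < ?n" using assms(2) mod_less_divisor[of ?n] by fastforce+
    show "i = j"
    proof (rule ccontr)
      assume "i \<noteq> j"
      then have "p ! i = p ! (Suc j mod ?n)" "p ! j = p ! (Suc i mod ?n)"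
        using ij assms by (auto simp: doubleton_eq_iff nth_eq_iff_index_eq)
      then have ij': "i = Suc j mod ?n" "j = Suc i mod ?n"
        using ij lt assms by (auto simp: nth_eq_iff_index_eq)
      have m: "Suc k mod ?n = (if Suc k = ?n then 0 else Suc k)" if "k < ?n" for k
        using that by auto
      have "i = 0 \<and> Suc j = ?n \<or> i = Suc j" using ij(2) ij'(1) m[of j] by (metis lessThan_iff)
      moreover have "j = 0 \<and> Suc i = ?n \<or> j = Suc i" using ij(1) ij'(2) m[of i] by (metis lessThan_iff)
      ultimately show False using assms(2) by linarith
    qed
  qed
  moreover have "cycle_edges p = ?f ` {..<?n}" by (auto simp: cycle_edges_def)
  ultimately show ?thesis by (simp add: card_image)
qed

text \<open>In a longest path, every edge of \<open>Z\<close> at the first vertex leads back into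
  the path. There are two such edges, and one of them closes a cycle.\<close>

lemma exists_cycle_min_degree_two:
  assumes fin: "finite Z" "Z \<noteq> {}" and two: "\<And>e. e \<in> Z \<Longrightarrow> card e = 2"
    and deg: "\<And>v. v \<in> \<Union>Z \<Longrightarrow> \<exists>e\<in>Z. \<exists>f\<in>Z. e \<noteq> f \<and> v \<in> e \<and> v \<in> f"
  shows "\<exists>p. length p \<ge> 3 \<and> distinct p \<and> set p \<subseteq> \<Union>Z \<and> cycle_edges p \<subseteq> Z"
proof -
  define P where "P p \<longleftrightarrow> p \<noteq> [] \<and> distinct p \<and> set p \<subseteq> \<Union>Z \<and> (\<forall>i. Suc i < length p \<longrightarrow> {p ! i, p ! Suc i} \<in> Z)" for p
  have finU: "finite (\<Union>Z)" using fin two by (metis card.infinite finite_Union zero_neq_numeral)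
  have bound: "length p \<le> card (\<Union>Z)" if "P p" for p
    using that finU by (metis P_def card_mono distinct_card)
  obtain e where "e \<in> Z" using fin by blast
  then obtain a where "a \<in> \<Union>Z" using two[of e] by (metis Union_iff card.empty ex_in_conv zero_neq_numeral)
  then have "P [a]" by (auto simp: P_def)
  then obtain p where p: "P p" and mx: "\<And>q. P q \<Longrightarrow> length q \<le> length p"
    using ex_has_greatest_nat[of P "[a]" length "Suc (card (\<Union>Z))"] bound by (metis le_imp_less_Suc)
  define x where "x = p ! 0"
  have "x \<in> set p" using p by (auto simp: P_def x_def)
  then have x: "x \<in> set p" "x \<in> \<Union>Z" using p by (auto simp: P_def)
  have other: "\<exists>y. e = {x, y} \<and> y \<noteq> x \<and> y \<in> \<Union>Z" if e: "e \<in> Z" "x \<in> e" for e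
  proof -
    obtain a b where "e = {a, b}" "a \<noteq> b" using two[OF e(1)] by (meson card_2_iff)
    then show ?thesis using e by (metis UnionI doubleton_eq_iff empty_iff insert_iff)
  qed
  have inp: "y \<in> set p" if e: "{x, y} \<in> Z" "y \<noteq> x" for y
  proof (rule ccontr)
    assume "y \<notin> set p"
    then have "P (y # p)" using p e unfolding P_def x_def
      by (auto simp: nth_Cons insert_commute split: nat.splits)
    then show False using mx[of "y # p"] by simp
  qed
  obtain e f where ef: "e \<in> Z" "f \<in> Z" "e \<noteq> f" "x \<in> e" "x \<in> f" using deg[OF x(2)] by blast
  obtain y z where yz: "e = {x, y}" "f = {x, z}" "y \<noteq> x" "z \<noteq> x" using other ef by meson
  then have "y \<noteq> z" using ef by blast
  obtain i where i: "i < length p" "p ! i = y" using inp[of y] ef yz by (metis in_set_conv_nth)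
  obtain j where j: "j < length p" "p ! j = z" using inp[of z] ef yz by (metis in_set_conv_nth)
  have "i \<noteq> 0" "j \<noteq> 0" "i \<noteq> j" using i j yz \<open>y \<noteq> z\<close> by (auto simp: x_def)
  \<comment> \<open>Of two distinct nonzero positions one is at least 2. Its edge to
    \<open>x\<close> is then not the first edge of the path, and the prefix up to it closes to a
    cycle of length at least 3.\<close>
  then obtain k where k: "k < length p" "k \<ge> 2" "{p ! k, x} \<in> Z"
    using i j ef yz by (metis One_nat_def Suc_leI insert_commute le_antisym less_Suc_eq_le not_less numeral_2_eq_2 zero_less_iff_neq_zero)
  define q where "q = take (Suc k) p"
  have lq: "length q = Suc k" using k by (simp add: q_def)
  have "cycle_edges q \<subseteq> Z"
  proof
    fix d assume "d \<in> cycle_edges q"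
    then obtain m where m: "m < Suc k" "d = {q ! m, q ! (Suc m mod Suc k)}"
      by (auto simp: cycle_edges_def lq)
    show "d \<in> Z"
    proof (cases "m = k")
      case True
      then show ?thesis using m k by (simp add: q_def x_def)
    next
      case False
      then show ?thesis using m k p by (simp add: q_def P_def)
    qed
  qed
  moreover have "set q \<subseteq> \<Union>Z" using p set_take_subset[of "Suc k" p] by (auto simp: q_def P_def)
  ultimately show ?thesis using k lq p by (intro exI[of _ q]) (auto simp: q_def P_def)
qed

text \<open>The construction sequences behind Euler's formula. Every new edge touches what is
  already built, so it enters the drawing either as a chord or as a pendant arc, and a new vertex
  only comes in as the far end of a pendant arc.\<close>

inductive grown :: "'a graph \<Rightarrow> 'a set \<Rightarrow> 'a set set \<Rightarrow> bool" for G where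
  single: "v \<in> verts G \<Longrightarrow> grown G {v} {}"
| extend: "grown G U E \<Longrightarrow> e \<in> edges G \<Longrightarrow> e \<notin> E \<Longrightarrow> e \<inter> U \<noteq> {} \<Longrightarrow> grown G (U \<union> e) (insert e E)"

lemma grown_subsets:
  assumes "grown G U E" "simple_graph G"
  shows "U \<subseteq> verts G" "E \<subseteq> edges G" "U \<noteq> {}" "\<forall>e\<in>E. e \<subseteq> U"
  using assms by (induction) (auto dest: simple_graphD(3))

text \<open>In a grown subgraph with the most edges, every edge of \<open>G\<close> touching its
  vertex set is already present. Its vertex set is then closed under adjacency, and connectedness
  gives everything.\<close>

lemma connected_graph_grown:
  assumes "connected_graph G" "simple_graph G"
  shows "grown G (verts G) (edges G)"
proof -
  note s = simple_graphD[OF assms(2)]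
  obtain v where "v \<in> verts G" using assms by (auto simp: connected_graph_def)
  then have "\<exists>U. grown G U {}" by (blast intro: grown.single)
  moreover have "card E < Suc (card (edges G))" if "\<exists>U. grown G U E" for E
    using that grown_subsets(2) s(2) assms(2) by (metis card_mono le_imp_less_Suc)
  ultimately obtain E where E: "\<exists>U. grown G U E" and mx: "\<And>E'. \<exists>U. grown G U E' \<Longrightarrow> card E' \<le> card E"
    using ex_has_greatest_nat[of "\<lambda>E. \<exists>U. grown G U E" "{}" card "Suc (card (edges G))"] by metis
  then obtain U where U: "grown G U E" by blast
  note gs = grown_subsets[OF U assms(2)]
  have no: "e \<in> E" if "e \<in> edges G" "e \<inter> U \<noteq> {}" for e
  proof (rule ccontr)
    assume "e \<notin> E"
    then have "grown G (U \<union> e) (insert e E)" using that \<open>e \<notin> E\<close> by (intro grown.extend[OF U]) auto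
    then have "card (insert e E) \<le> card E" using mx by metis
    moreover have "finite E" using gs(2) s(2) by (rule finite_subset)
    ultimately show False using \<open>e \<notin> E\<close> by simp
  qed
  have "verts G \<subseteq> U"
  proof -
    obtain u where u: "u \<in> U" using gs by blast
    show ?thesis
    proof (rule connected_graph_closed_set[OF assms(1) u])
      show "u \<in> verts G" using u gs by blast
      show "y \<in> U" if "x \<in> U" "{x, y} \<in> edges G" for x y using no[of "{x, y}"] that gs by blast
    qed
  qed
  then have "U = verts G" using gs by blast
  moreover have "e \<in> E" if "e \<in> edges G" for e
  proof (rule no[OF that])
    have "e \<noteq> {}" using s(4)[OF that] by auto
    then show "e \<inter> U \<noteq> {}" using s(3)[OF that] \<open>U = verts G\<close> by blast
  qed
  then have "E = edges G" using gs by blast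
  ultimately show ?thesis using U by simp
qed

section \<open>Plane drawings and their faces\<close>

locale plane_graph =
  fixes G :: "'a graph" and pos :: "'a \<Rightarrow> complex" and crv :: "'a set \<Rightarrow> real \<Rightarrow> complex"
  assumes simple: "simple_graph G" and emb: "embedding G UNIV pos crv"
begin

definition draw :: "'a set \<Rightarrow> 'a set set \<Rightarrow> complex set" where
  "draw U E = pos ` U \<union> (\<Union>e\<in>E. path_image (crv e))"

abbreviation drawing :: "complex set" where
  "drawing \<equiv> draw (verts G) (edges G)"

abbreviation regions :: "complex set set" where
  "regions \<equiv> components (- drawing)"

text \<open>The ends of the arc are removed because a vertex on the frontier would otherwise put all
  its edges into the border, and the bound of two borders per edge would fail.\<close>

definition border :: "complex set \<Rightarrow> 'a set set" where
  "border F = {e \<in> edges G. frontier F \<inter> (path_image (crv e) - pos ` e) \<noteq> {}}"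

lemmas graph_simps = simple_graphD[OF simple]

lemma pos_inj: "inj_on pos (verts G)"
  using emb by (simp add: embedding_def)

lemma crv_arc: "e \<in> edges G \<Longrightarrow> arc (crv e)"
  using emb by (simp add: embedding_def)

lemma crv_ends: "e \<in> edges G \<Longrightarrow> {pathstart (crv e), pathfinish (crv e)} = pos ` e"
  using emb by (simp add: embedding_def)

lemma crv_verts: "e \<in> edges G \<Longrightarrow> path_image (crv e) \<inter> pos ` verts G = pos ` e"
  using emb by (simp add: embedding_def)

lemma crv_crv: "e \<in> edges G \<Longrightarrow> f \<in> edges G \<Longrightarrow> e \<noteq> f \<Longrightarrow> path_image (crv e) \<inter> path_image (crv f) = pos ` (e \<inter> f)"
  using emb by (simp add: embedding_def)

lemma crv_compact: "e \<in> edges G \<Longrightarrow> compact (path_image (crv e))"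
  by (simp add: arc_imp_path compact_path_image crv_arc)

lemma pos_image_Int: "A \<subseteq> verts G \<Longrightarrow> B \<subseteq> verts G \<Longrightarrow> pos ` A \<inter> pos ` B = pos ` (A \<inter> B)"
  using inj_on_image_Int[OF pos_inj] by simp

lemma crv_Int_draw:
  assumes "e \<in> edges G" "U \<subseteq> verts G" "E \<subseteq> edges G" "e \<notin> E" "\<forall>f\<in>E. f \<subseteq> U"
  shows "path_image (crv e) \<inter> draw U E = pos ` (e \<inter> U)"
proof -
  have "path_image (crv e) \<inter> pos ` U = pos ` e \<inter> pos ` U"
    using crv_verts[OF assms(1)] assms(2) by blast
  also have "\<dots> = pos ` (e \<inter> U)" using assms graph_simps(3) by (intro pos_image_Int) auto
  finally have 1: "path_image (crv e) \<inter> pos ` U = pos ` (e \<inter> U)" .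
  have 2: "path_image (crv e) \<inter> path_image (crv f) \<subseteq> pos ` (e \<inter> U)" if "f \<in> E" for f
  proof -
    have "path_image (crv e) \<inter> path_image (crv f) = pos ` (e \<inter> f)"
      using that assms by (intro crv_crv) auto
    then show ?thesis using that assms(5) by blast
  qed
  show ?thesis unfolding draw_def using 1 2 by blast
qed

lemma compact_draw: "finite U \<Longrightarrow> E \<subseteq> edges G \<Longrightarrow> compact (draw U E)"
  unfolding draw_def using finite_subset[OF _ graph_simps(2)] crv_compact
  by (intro compact_Un compact_UN) (auto intro: finite_imp_compact)

lemma compact_drawing: "compact drawing"
  using graph_simps by (intro compact_draw) auto

lemma open_region: "F \<in> regions \<Longrightarrow> open F"
  by (meson compact_drawing compact_imp_closed open_Compl open_components)

lemma region_disjoint: "F \<in> regions \<Longrightarrow> F \<inter> drawing = {}"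
  using in_components_subset by blast

lemma frontier_region: "F \<in> regions \<Longrightarrow> frontier F \<subseteq> drawing"
  by (meson compact_drawing compact_imp_closed frontier_of_components_closed_complement)

text \<open>A chord adds one edge and one region, a pendant edge adds one edge and one vertex.
  Path-connectedness is carried along because the chord case closes the new arc to a Jordan curve
  inside the old drawing.\<close>

lemma grown_draw:
  assumes "grown G U E"
  shows "path_connected (draw U E) \<and> finite (components (- draw U E)) \<and>
     card (components (- draw U E)) + card U = card E + 2"
  using assms
proof induction
  case (single v)
  have d: "draw {v} {} = {pos v}" by (simp add: draw_def)
  have "connected (- {pos v})" by (simp add: connected_punctured_universe)
  moreover have "pos v + 1 \<in> - {pos v}" by simp
  then have "- {pos v} \<noteq> {}" by blast
  ultimately have "components (- {pos v}) = {- {pos v}}" by (rule components_connected)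
  then show ?case by (simp add: d)
next
  case (extend U E e)
  note gs = grown_subsets[OF extend(1) simple]
  let ?K = "draw U E" let ?A = "path_image (crv e)"
  have eq: "draw (U \<union> e) (insert e E) = ?K \<union> ?A"
    using crv_verts[OF extend(2)] by (auto simp: draw_def)
  have int: "?A \<inter> ?K = pos ` (e \<inter> U)"
    using gs extend by (intro crv_Int_draw) auto
  have finU: "finite U" "finite E"
    using gs(1,2) graph_simps(1,2) by (simp_all add: finite_subset)
  have cK: "compact ?K" using finU gs by (intro compact_draw) auto
  have arc: "arc (crv e)" using extend crv_arc by blast
  have pc: "path_connected (?K \<union> ?A)"
    using extend arc int by (intro path_connected_Un) (auto simp: arc_imp_path path_connected_path_image)
  obtain x y where xy: "e = {x, y}" "x \<noteq> y" using simple_graph_edgeE[OF simple extend(2)] by metis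
  then have "x \<in> U \<or> y \<in> U" using extend(4) by blast
  then obtain a b where ab: "e = {a, b}" "a \<noteq> b" "a \<in> U" using xy by (metis insert_commute)
  have ends: "{pathstart (crv e), pathfinish (crv e)} = {pos a, pos b}"
    using crv_ends[OF extend(2)] ab by simp
  show ?case
  proof (cases "b \<in> U")
    case True
    then have "?A \<inter> ?K = {pathstart (crv e), pathfinish (crv e)}"
      using int ab ends by auto
    then have "finite (components (- (?K \<union> ?A)))" "card (components (- (?K \<union> ?A))) = card (components (- ?K)) + 1"
      using card_components_Un_chord[OF cK _ arc] extend by blast+
    moreover have "U \<union> e = U" using True ab by blast
    ultimately show ?thesis using extend pc finU unfolding eq by simp
  next
    case False
    then have "?A \<inter> ?K = {pos a}" using int ab by auto
    then have "?A \<inter> ?K = {pathstart (crv e)} \<or> ?A \<inter> ?K = {pathfinish (crv e)}"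
      using ends by (metis doubleton_eq_iff)
    then have "finite (components (- (?K \<union> ?A)))" "card (components (- (?K \<union> ?A))) = card (components (- ?K))"
      using card_components_Un_pendant_arc[OF cK arc] extend by blast+
    moreover have "U \<union> e = insert b U" using ab by blast
    ultimately show ?thesis using extend pc finU False unfolding eq by simp
  qed
qed

lemma Euler_formula:
  assumes "connected_graph G"
  shows "finite regions" "card regions + card (verts G) = card (edges G) + 2" "path_connected drawing"
  using grown_draw[OF connected_graph_grown[OF assms simple]] by auto

text \<open>Draw \<open>e\<close> last. It is then a chord of the connected rest and splits one
  region in two. Any other region was already a region of the rest, so its frontier lies in the rest
  and misses the open arc of \<open>e\<close>.\<close>

lemma card_regions_bordered_by:
  assumes e: "e \<in> edges G" and conn: "connected_graph (G\<lparr>edges := edges G - {e}\<rparr>)"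
  shows "card {F \<in> regions. e \<in> border F} \<le> 2"
proof -
  let ?G = "G\<lparr>edges := edges G - {e}\<rparr>"
  let ?K = "draw (verts G) (edges G - {e})" let ?A = "path_image (crv e)"
  interpret S: plane_graph ?G pos crv
    using simple emb by unfold_locales (auto simp: simple_graph_def embedding_def)
  have pc: "path_connected ?K"
    using S.Euler_formula(3)[OF conn] by (simp add: draw_def S.draw_def)
  have cK: "compact ?K" using graph_simps by (intro compact_draw) auto
  have int: "?A \<inter> ?K = pos ` e"
    using crv_Int_draw[OF e, of "verts G" "edges G - {e}"] graph_simps(3) e by (auto simp: Int_absorb2)
  have eq: "drawing = ?K \<union> ?A" using e by (auto simp: draw_def)
  obtain F D1 D2 where F: "components (- (?K \<union> ?A)) = (components (- ?K) - {F}) \<union> {D1, D2}"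
    using components_Un_chord[OF cK pc crv_arc[OF e]] crv_ends[OF e] int by metis
  have "{F \<in> regions. e \<in> border F} \<subseteq> {D1, D2}"
  proof
    fix X assume X: "X \<in> {F \<in> regions. e \<in> border F}"
    have "X \<notin> components (- ?K)"
    proof
      assume "X \<in> components (- ?K)"
      then have "frontier X \<subseteq> ?K" using cK
        by (meson compact_imp_closed frontier_of_components_closed_complement)
      then show False using X int by (auto simp: border_def)
    qed
    then show "X \<in> {D1, D2}" using X F eq by auto
  qed
  then have "card {F \<in> regions. e \<in> border F} \<le> card {D1, D2}" by (intro card_mono) auto
  also have "\<dots> \<le> 2" by (simp add: card_insert_if)
  finally show ?thesis .
qed

end

section \<open>Connectivity after deleting an edge, subdrawings, and triangles as vertex
  sets\<close>

lemma connected_graphI: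
  assumes "verts G \<noteq> {}"
    and "\<And>U. U \<subseteq> verts G \<Longrightarrow> U \<noteq> {} \<Longrightarrow> (\<And>x y. x \<in> U \<Longrightarrow> y \<in> verts G \<Longrightarrow> {x, y} \<in> edges G \<Longrightarrow> y \<in> U) \<Longrightarrow> verts G \<subseteq> U"
  shows "connected_graph G"
  unfolding connected_graph_def
proof (intro conjI ballI)
  let ?R = "{(x, y). {x, y} \<in> edges G}\<^sup>*"
  fix u v assume "u \<in> verts G" "v \<in> verts G"
  have "verts G \<subseteq> {x \<in> verts G. (u, x) \<in> ?R}"
  proof (rule assms(2))
    show "{x \<in> verts G. (u, x) \<in> ?R} \<noteq> {}" using \<open>u \<in> verts G\<close> by blast
    fix x y assume "x \<in> {x \<in> verts G. (u, x) \<in> ?R}" "y \<in> verts G" "{x, y} \<in> edges G"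
    then show "y \<in> {x \<in> verts G. (u, x) \<in> ?R}"
      by (auto intro: rtrancl_into_rtrancl)
  qed blast
  then show "(u, v) \<in> ?R" using \<open>v \<in> verts G\<close> by blast
qed (rule assms(1))

lemma vertex_connected_connected:
  assumes "vertex_connected 3 G"
  shows "connected_graph G"
proof -
  have "delete_verts G {} = G" by (cases G) (simp add: delete_verts_def)
  then show ?thesis using assms by (auto simp: vertex_connected_def dest!: spec[of _ "{}"])
qed

text \<open>Deleting an edge at \<open>a\<close> affects the other vertices no more than deleting
  \<open>a\<close>, which leaves a connected graph. The vertex \<open>a\<close> itself remains
  attached through a second neighbour \<open>c\<close>.\<close>

lemma vertex_connected_delete_edge:
  assumes G: "simple_graph G" "vertex_connected 3 G" "regular k G" "k \<ge> 2" and e: "e \<in> edges G"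
  shows "connected_graph (G\<lparr>edges := edges G - {e}\<rparr>)"
proof (rule connected_graphI)
  let ?G = "G\<lparr>edges := edges G - {e}\<rparr>"
  show "verts ?G \<noteq> {}" using G by (auto simp: vertex_connected_def)
  obtain a b where ab: "e = {a, b}" "a \<noteq> b" "a \<in> verts G" "b \<in> verts G"
    using simple_graph_edgeE[OF G(1) e] by metis
  have "card (neighbours G a) \<ge> 2" using G ab by (auto simp: regular_def)
  then obtain c where c: "c \<in> neighbours G a" "c \<noteq> b"
    using card_mono[of "{b}" "neighbours G a"] by (cases "neighbours G a \<subseteq> {b}") auto
  have ca: "{a, c} \<in> edges G" "c \<in> verts G" "{a, c} \<noteq> e" "c \<noteq> a"
    using c ab neighbours_irrefl[OF G(1)] by (auto simp: neighbours_def doubleton_eq_iff)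
  fix U assume "U \<subseteq> verts ?G" "U \<noteq> {}"
    and cl': "\<And>x y. x \<in> U \<Longrightarrow> y \<in> verts ?G \<Longrightarrow> {x, y} \<in> edges ?G \<Longrightarrow> y \<in> U"
  then have U: "U \<subseteq> verts G" "U \<noteq> {}" by simp_all
  have cl: "y \<in> U" if "x \<in> U" "y \<in> verts G" "{x, y} \<in> edges G \<and> {x, y} \<noteq> e" for x y
    using cl'[of x y] that by simp
  have "\<exists>x\<in>U. x \<noteq> a"
  proof (rule ccontr)
    assume n: "\<not> (\<exists>x\<in>U. x \<noteq> a)"
    then have "a \<in> U" using U by auto
    then show False using cl[of a c] ca n by blast
  qed
  then obtain x where x: "x \<in> U" "x \<noteq> a" by blast
  have conn: "connected_graph (delete_verts G {a})"
    using G(2) ab by (auto simp: vertex_connected_def)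
  have "verts (delete_verts G {a}) \<subseteq> U"
  proof (rule connected_graph_closed_set[OF conn x(1)])
    show "x \<in> verts (delete_verts G {a})" using x U by (auto simp: delete_verts_def)
    fix y z assume "y \<in> U" "{y, z} \<in> edges (delete_verts G {a})"
    then show "z \<in> U" using cl[of y z] ab simple_graphD(3)[OF G(1), of "{y, z}"]
      by (auto simp: delete_verts_def)
  qed
  then have all: "verts G - {a} \<subseteq> U" by (auto simp: delete_verts_def)
  then have "c \<in> U" using ca by blast
  then have "a \<in> U" using cl[of c a] ca ab by (auto simp: insert_commute)
  then show "verts ?G \<subseteq> U" using all by auto
qed

lemma embedding_subgraph:
  assumes G: "embedding G S pos crv" and H: "verts H \<subseteq> verts G" "edges H \<subseteq> edges G" "\<And>e. e \<in> edges H \<Longrightarrow> e \<subseteq> verts H"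
  shows "embedding H S pos crv"
proof -
  have 1: "inj_on pos (verts H)" "pos ` verts H \<subseteq> S"
    using G H(1) by (auto simp: embedding_def intro: inj_on_subset)
  have 2: "arc (crv e)" "path_image (crv e) \<subseteq> S" "{pathstart (crv e), pathfinish (crv e)} = pos ` e"
    "path_image (crv e) \<inter> pos ` verts G = pos ` e" if "e \<in> edges H" for e
  proof -
    have "e \<in> edges G" using H(2) that by blast
    then show "arc (crv e)" "path_image (crv e) \<subseteq> S" "{pathstart (crv e), pathfinish (crv e)} = pos ` e"
      "path_image (crv e) \<inter> pos ` verts G = pos ` e"
      using G by (simp_all add: embedding_def)
  qed
  have 3: "path_image (crv e) \<inter> pos ` verts H = pos ` e" if "e \<in> edges H" for e
    using 2(4)[OF that] H(1) H(3)[OF that] by blast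
  have 4: "path_image (crv e) \<inter> path_image (crv f) = pos ` (e \<inter> f)" if "e \<in> edges H" "f \<in> edges H" "e \<noteq> f" for e f
  proof -
    have "e \<in> edges G" "f \<in> edges G" using H(2) that by blast+
    then show ?thesis using G that(3) by (simp add: embedding_def)
  qed
  show ?thesis unfolding embedding_def using 1 2 3 4 by simp
qed

text \<open>Vertex sets instead of lists, so that each triangle is counted once; as a cycle list it
  would appear six times.\<close>

definition triangles :: "'a graph \<Rightarrow> 'a set set" where
  "triangles G = {T. T \<subseteq> verts G \<and> card T = 3 \<and> (\<forall>x\<in>T. \<forall>y\<in>T. x \<noteq> y \<longrightarrow> {x, y} \<in> edges G)}"

lemma triangleE:
  assumes "T \<in> triangles G"
  obtains x y z where "T = {x, y, z}" "x \<noteq> y" "y \<noteq> z" "x \<noteq> z"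
    "{x, y} \<in> edges G" "{y, z} \<in> edges G" "{x, z} \<in> edges G"
proof -
  obtain x y z where "T = {x, y, z}" "x \<noteq> y" "y \<noteq> z" "x \<noteq> z"
    using assms by (auto simp: triangles_def card_3_iff)
  then show ?thesis using that assms by (auto simp: triangles_def)
qed

lemma triangle_edges:
  assumes "simple_graph G" "x \<noteq> y" "y \<noteq> z" "x \<noteq> z"
    "{x, y} \<in> edges G" "{y, z} \<in> edges G" "{x, z} \<in> edges G"
  shows "{e \<in> edges G. e \<subseteq> {x, y, z}} = {{x, y}, {y, z}, {x, z}}"
proof -
  have "e \<in> {{x, y}, {y, z}, {x, z}}" if e: "e \<in> edges G" "e \<subseteq> {x, y, z}" for e
  proof -
    obtain a b where "e = {a, b}" "a \<noteq> b" using simple_graph_edgeE[OF assms(1) e(1)] by metis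
    then show ?thesis using e(2) by auto
  qed
  then show ?thesis using assms by blast
qed

lemma trianglesI:
  assumes "simple_graph G" "{x, y} \<in> edges G" "{y, z} \<in> edges G" "{x, z} \<in> edges G"
  shows "{x, y, z} \<in> triangles G"
proof -
  have "x \<noteq> y" "y \<noteq> z" "x \<noteq> z"
    using assms(2-) simple_graphD(4)[OF assms(1)] by fastforce+
  then show ?thesis using assms(2-) simple_graphD(3)[OF assms(1)]
    by (auto simp: triangles_def insert_commute)
qed

lemma cycle_edges_3: "cycle_edges [x, y, z] = {{x, y}, {y, z}, {x, z}}"
proof -
  have "{i. i < length [x, y, z]} = {0, 1, 2}" by auto
  moreover have "cycle_edges [x, y, z] = (\<lambda>i. {[x, y, z] ! i, [x, y, z] ! (Suc i mod 3)}) ` {i. i < length [x, y, z]}"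
    by (auto simp: cycle_edges_def)
  ultimately show ?thesis by (simp add: numeral_2_eq_2 insert_commute)
qed

text \<open>The bridge from cycle lists to vertex sets. It speaks of edge sets because cycles enter
  borders and triangular faces only through their edges.\<close>

lemma is_cycle_3_iff:
  assumes "simple_graph G"
  shows "(\<exists>p. is_cycle G p \<and> length p = 3 \<and> cycle_edges p = E) \<longleftrightarrow> (\<exists>T\<in>triangles G. E = {e \<in> edges G. e \<subseteq> T})"
proof
  assume "\<exists>p. is_cycle G p \<and> length p = 3 \<and> cycle_edges p = E"
  then obtain p where p: "is_cycle G p" "length p = 3" "cycle_edges p = E" by blast
  then obtain x y z where xyz: "p = [x, y, z]"
    by (auto simp: numeral_3_eq_3 length_Suc_conv)
  then have d: "x \<noteq> y" "y \<noteq> z" "x \<noteq> z" and e: "{x, y} \<in> edges G" "{y, z} \<in> edges G" "{x, z} \<in> edges G"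
    using p by (auto simp: is_cycle_def cycle_edges_3)
  then show "\<exists>T\<in>triangles G. E = {e \<in> edges G. e \<subseteq> T}"
    using trianglesI[OF assms e] triangle_edges[OF assms d e] p xyz cycle_edges_3 by metis
next
  assume "\<exists>T\<in>triangles G. E = {e \<in> edges G. e \<subseteq> T}"
  then obtain T where T: "T \<in> triangles G" "E = {e \<in> edges G. e \<subseteq> T}" by blast
  obtain x y z where xyz: "T = {x, y, z}" and d: "x \<noteq> y" "y \<noteq> z" "x \<noteq> z"
    and e: "{x, y} \<in> edges G" "{y, z} \<in> edges G" "{x, z} \<in> edges G"
    by (rule triangleE[OF T(1)])
  have "E = {{x, y}, {y, z}, {x, z}}" using triangle_edges[OF assms d e] T xyz by simp
  moreover have "is_cycle G [x, y, z]"
    using d e T xyz by (auto simp: is_cycle_def cycle_edges_3 triangles_def)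
  ultimately show "\<exists>p. is_cycle G p \<and> length p = 3 \<and> cycle_edges p = E"
    by (intro exI[of _ "[x, y, z]"]) (simp add: cycle_edges_3)
qed

section \<open>Borders of regions, triangular regions, and short cycles\<close>

context plane_graph
begin

text \<open>Peel off leaf edges. A nonempty edge set without cycles has a vertex on only one of its
  edges; the arc of this edge meets the other arcs in at most one point, so Janiszewski's theorem
  puts it back without separating anything.\<close>

lemma forest_complement_connected:
  assumes "E \<subseteq> edges G" "\<nexists>p. is_cycle G p \<and> cycle_edges p \<subseteq> E"
  shows "connected (- draw {} E)"
proof -
  have "finite E" using assms graph_simps finite_subset by metis
  then show ?thesis using assms
  proof (induction "card E" arbitrary: E)
    case 0
    then show ?case by (simp add: draw_def connected_UNIV)
  next
    case (Suc n)
    have "E \<noteq> {}" using Suc by auto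
    have UE: "\<Union>E \<subseteq> verts G" using Suc graph_simps(3) by blast
    have "\<exists>v\<in>\<Union>E. \<not> (\<exists>e\<in>E. \<exists>f\<in>E. e \<noteq> f \<and> v \<in> e \<and> v \<in> f)"
    proof (rule ccontr)
      assume n: "\<not> ?thesis"
      have deg: "\<exists>e\<in>E. \<exists>f\<in>E. e \<noteq> f \<and> v \<in> e \<and> v \<in> f" if "v \<in> \<Union>E" for v
        using n that by metis
      have "\<exists>p. length p \<ge> 3 \<and> distinct p \<and> set p \<subseteq> \<Union>E \<and> cycle_edges p \<subseteq> E"
        using Suc(4) graph_simps(4) by (intro exists_cycle_min_degree_two[OF Suc(3) \<open>E \<noteq> {}\<close> _ deg]) blast+
      then obtain p where "length p \<ge> 3" "distinct p" "set p \<subseteq> \<Union>E" "cycle_edges p \<subseteq> E" by blast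
      then have "is_cycle G p" unfolding is_cycle_def using UE Suc(4) by blast
      then show False using \<open>cycle_edges p \<subseteq> E\<close> Suc(5) by blast
    qed
    then obtain v e where e: "e \<in> E" "v \<in> e" and uniq: "\<And>f. f \<in> E \<Longrightarrow> v \<in> f \<Longrightarrow> f = e" by blast
    have eG: "e \<in> edges G" using e Suc by blast
    obtain w where w: "e \<subseteq> {v, w}" using simple_graph_edgeE[OF simple eG] e by (metis doubleton_eq_iff insertE insert_iff subset_refl singletonD)
    let ?E = "E - {e}"
    have "connected (- draw {} ?E)"
    proof (rule Suc(1))
      show "n = card ?E" "finite ?E" using Suc(2,3) e by auto
    qed (use Suc in blast)+
    moreover have "connected (- path_image (crv e))"
      using crv_arc[OF eG] by (simp add: connected_arc_complement)
    moreover have "draw {} ?E \<inter> path_image (crv e) \<subseteq> {pos w}"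
    proof -
      have "path_image (crv f) \<inter> path_image (crv e) \<subseteq> {pos w}" if "f \<in> ?E" for f
      proof -
        have "v \<notin> f" using that uniq by blast
        moreover have "path_image (crv f) \<inter> path_image (crv e) = pos ` (f \<inter> e)"
          using that Suc eG by (intro crv_crv) auto
        ultimately show ?thesis using w by blast
      qed
      then show ?thesis by (auto simp: draw_def)
    qed
    then have "connected (draw {} ?E \<inter> path_image (crv e))"
      by (metis connected_empty connected_sing subset_singletonD)
    moreover have "compact (draw {} ?E)" using Suc by (intro compact_draw) auto
    moreover have "closed (path_image (crv e))" using crv_compact[OF eG] by (rule compact_imp_closed)
    ultimately have "connected (- (draw {} ?E \<union> path_image (crv e)))"
      by (intro connected_Compl_Un_Janiszewski)
    moreover have "draw {} ?E \<union> path_image (crv e) = draw {} E" using e by (auto simp: draw_def)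
    ultimately show ?case by simp
  qed
qed

lemma frontier_region_border:
  assumes "F \<in> regions"
  shows "frontier F \<subseteq> draw (verts G) (border F)"
proof
  fix x assume x: "x \<in> frontier F"
  then have "x \<in> drawing" using frontier_region assms by blast
  then consider "x \<in> pos ` verts G" | e where "e \<in> edges G" "x \<in> path_image (crv e)" "x \<notin> pos ` verts G"
    by (auto simp: draw_def)
  then show "x \<in> draw (verts G) (border F)"
  proof cases
    case 2
    then have "x \<notin> pos ` e" using graph_simps(3) by blast
    then have "e \<in> border F" using 2 x by (auto simp: border_def)
    then show ?thesis using 2 by (auto simp: draw_def)
  qed (auto simp: draw_def)
qed

lemma border_subset: "border F \<subseteq> edges G"
  by (auto simp: border_def)

text \<open>Erasing all edges outside the border leaves \<open>F\<close> a face because its frontier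
  is still drawn. The vertices are kept: at this stage a frontier may contain a vertex none of whose
  edges is in the border.\<close>

lemma region_component_border:
  assumes "F \<in> regions"
  shows "F \<in> components (- draw (verts G) (border F))"
proof (rule component_of_frontier_subset)
  show "frontier F \<subseteq> draw (verts G) (border F)" by (rule frontier_region_border[OF assms])
  have "draw (verts G) (border F) \<subseteq> drawing" using border_subset by (auto simp: draw_def)
  then show "F \<inter> draw (verts G) (border F) = {}" using region_disjoint[OF assms] by blast
qed (use assms in_components_nonempty in_components_connected in blast)+

text \<open>
  If the border were a forest, its complement would be connected and thus equal to \<open>F\<close>, which
  leaves no room for a second region.
\<close>

lemma border_contains_cycle:
  assumes F: "F \<in> regions" and two: "card regions \<ge> 2"
  shows "\<exists>p. is_cycle G p \<and> cycle_edges p \<subseteq> border F"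
proof (rule ccontr)
  assume "\<not> ?thesis"
  then have "connected (- draw {} (border F))" using border_subset by (intro forest_complement_connected) auto
  moreover have "open (- draw {} (border F))"
    using compact_draw[of "{}" "border F"] border_subset by (simp add: compact_imp_closed open_Compl)
  ultimately have "connected (- draw {} (border F) - pos ` verts G)"
    using graph_simps(1) by (intro connected_open_diff_countable) (auto simp: countable_finite)
  moreover have "- draw {} (border F) - pos ` verts G = - draw (verts G) (border F)"
    by (auto simp: draw_def)
  ultimately have conn: "connected (- draw (verts G) (border F))" by simp
  have F': "F \<in> components (- draw (verts G) (border F))" by (rule region_component_border[OF F])
  then have "F = - draw (verts G) (border F)"
    using conn by (metis components_connected components_empty empty_iff singletonD)
  then have sub: "- drawing \<subseteq> F" using border_subset by (auto simp: draw_def)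
  have "regions \<subseteq> {F}"
  proof
    fix X assume X: "X \<in> regions"
    then have "X \<subseteq> F" "X \<noteq> {}" using sub in_components_subset in_components_nonempty by blast+
    then show "X \<in> {F}" using components_nonoverlap[OF X F] by blast
  qed
  then have "card regions \<le> card {F}" by (intro card_mono) auto
  then show False using two by simp
qed

lemma sum_card_border_le:
  assumes fin: "finite regions" and conn: "\<And>e. e \<in> edges G \<Longrightarrow> connected_graph (G\<lparr>edges := edges G - {e}\<rparr>)"
  shows "(\<Sum>F\<in>regions. card (border F)) \<le> 2 * card (edges G)"
proof -
  have "(\<Sum>F\<in>regions. card (border F)) = (\<Sum>F\<in>regions. card {e \<in> edges G. e \<in> border F})"
    by (intro sum.cong refl arg_cong[where f = card]) (use border_subset in blast)
  also have "\<dots> = (\<Sum>e\<in>edges G. card {F \<in> regions. e \<in> border F})"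
    using sum_multicount_gen[OF fin graph_simps(2), of "\<lambda>F e. e \<in> border F" "\<lambda>e. card {F \<in> regions. e \<in> border F}"] by simp
  also have "\<dots> \<le> (\<Sum>e\<in>edges G. 2)"
    by (intro sum_mono card_regions_bordered_by conn)
  finally show ?thesis by simp
qed

text \<open>Written with \<open>draw\<close> so that \<open>crv_Int_draw\<close> applies to it; the
  corners are ends of the arcs anyway, as \<open>curve_triangle\<close> shows.\<close>

definition curve :: "'a set \<Rightarrow> complex set" where
  "curve T = draw T {e \<in> edges G. e \<subseteq> T}"

lemma curve_triangle:
  assumes "T \<in> triangles G"
  shows "curve T = (\<Union>e\<in>{e \<in> edges G. e \<subseteq> T}. path_image (crv e))"
proof -
  obtain x y z where xyz: "T = {x, y, z}" "{x, y} \<in> edges G" "{y, z} \<in> edges G"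
    using triangleE[OF assms] by metis
  have "pos ` {x, y} \<subseteq> path_image (crv {x, y})" "pos ` {y, z} \<subseteq> path_image (crv {y, z})"
    using crv_verts xyz by blast+
  then have "pos ` T \<subseteq> path_image (crv {x, y}) \<union> path_image (crv {y, z})"
    unfolding xyz(1) by simp
  moreover have "path_image (crv e) \<subseteq> (\<Union>e\<in>{e \<in> edges G. e \<subseteq> T}. path_image (crv e))"
    if "e \<in> {{x, y}, {y, z}}" for e
    using that xyz by (intro UN_upper) auto
  ultimately have "pos ` T \<subseteq> (\<Union>e\<in>{e \<in> edges G. e \<subseteq> T}. path_image (crv e))"
    by (meson Un_least insertCI order_trans)
  then show ?thesis by (auto simp: curve_def draw_def)
qed

text \<open>An embedding prescribes the two ends of an arc only as a set. Reversing the arc if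
  necessary gives the direction required for joining.\<close>

lemma oriented_arc:
  assumes "{a, b} \<in> edges G"
  obtains g where "arc g" "path_image g = path_image (crv {a, b})" "pathstart g = pos a" "pathfinish g = pos b"
proof -
  have "{pathstart (crv {a, b}), pathfinish (crv {a, b})} = {pos a, pos b}"
    using crv_ends[OF assms] by simp
  then show ?thesis
    using that[of "crv {a, b}"] that[of "reversepath (crv {a, b})"] crv_arc[OF assms]
    by (auto simp: doubleton_eq_iff arc_reversepath)
qed

lemma curve_Jordan:
  assumes T: "T \<in> triangles G"
  obtains I Q where "open I" "open Q" "connected I" "connected Q" "I \<noteq> {}" "Q \<noteq> {}" "I \<inter> Q = {}"
    "I \<union> Q = - curve T" "frontier I = curve T" "frontier Q = curve T"
proof -
  obtain x y z where xyz: "T = {x, y, z}" and d: "x \<noteq> y" "y \<noteq> z" "x \<noteq> z"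
    and e: "{x, y} \<in> edges G" "{y, z} \<in> edges G" "{x, z} \<in> edges G"
    by (rule triangleE[OF T])
  obtain g1 where g1: "arc g1" "path_image g1 = path_image (crv {x, y})" "pathstart g1 = pos x" "pathfinish g1 = pos y"
    by (rule oriented_arc[OF e(1)])
  obtain g2 where g2: "arc g2" "path_image g2 = path_image (crv {y, z})" "pathstart g2 = pos y" "pathfinish g2 = pos z"
    by (rule oriented_arc[OF e(2)])
  obtain g3 where g3: "arc g3" "path_image g3 = path_image (crv {x, z})" "pathstart g3 = pos x" "pathfinish g3 = pos z"
    by (rule oriented_arc[OF e(3)])
  have n: "{x, y} \<noteq> {y, z}" "{x, y} \<noteq> {x, z}" "{y, z} \<noteq> {x, z}" using d by (auto simp: doubleton_eq_iff)
  have i: "{x, y} \<inter> {y, z} = {y}" "{x, y} \<inter> {x, z} = {x}" "{y, z} \<inter> {x, z} = {z}" using d by auto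
  have int: "path_image g1 \<inter> path_image g2 = {pos y}" "path_image g1 \<inter> path_image g3 = {pos x}" "path_image g2 \<inter> path_image g3 = {pos z}"
    using crv_crv[OF e(1,2) n(1)] crv_crv[OF e(1,3) n(2)] crv_crv[OF e(2,3) n(3)] unfolding i g1 g2 g3 by simp_all
  have "arc (g1 +++ g2)" using g1 g2 int by (intro arc_join) auto
  moreover have pi: "path_image (g1 +++ g2) = path_image g1 \<union> path_image g2" using g1 g2 by (simp add: path_image_join)
  moreover have "path_image (g1 +++ g2) \<inter> path_image g3 = {pathstart g3, pathfinish g3}"
    unfolding pi using int g3 by auto
  moreover have "curve T = path_image (g1 +++ g2) \<union> path_image g3"
    unfolding curve_triangle[OF T] using triangle_edges[OF simple d e] xyz pi g1 g2 g3 by (simp add: Un_assoc)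
  ultimately show ?thesis
    using Jordan_two_arcs[of "g1 +++ g2" g3] that g1 g2 g3 by (metis pathfinish_join pathstart_join)
qed

lemma curve_components:
  assumes T: "T \<in> triangles G" and F: "F \<noteq> {}" "connected F" "F \<inter> curve T = {}"
  obtains W where "open W" "connected W" "F \<subseteq> W" "W \<inter> curve T = {}" "frontier W = curve T"
proof -
  obtain I Q where J: "open I" "open Q" "connected I" "connected Q" "I \<noteq> {}" "Q \<noteq> {}" "I \<inter> Q = {}"
    "I \<union> Q = - curve T" "frontier I = curve T" "frontier Q = curve T"
    by (rule curve_Jordan[OF T])
  have "F \<subseteq> I \<union> Q" using J F by blast
  then have "F \<subseteq> I \<or> F \<subseteq> Q" using connectedD[OF F(2) J(1,2)] J by blast
  then show ?thesis
  proof
    assume "F \<subseteq> I" then show ?thesis using J by (intro that[of I]) blast+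
  next
    assume "F \<subseteq> Q" then show ?thesis using J by (intro that[of Q]) blast+
  qed
qed

text \<open>The position of a vertex is a limit point of any arc ending there, and the finitely many
  other vertices can be cut out of the neighbourhood. Hence no vertex of positive degree can hide
  inside a region of a partial drawing.\<close>

lemma drawing_in_neighbourhood:
  assumes "v \<in> verts G" "neighbours G v \<noteq> {}" "open W" "pos v \<in> W"
  shows "\<exists>y\<in>W. y \<in> drawing \<and> y \<notin> pos ` verts G"
proof -
  obtain w where e: "{v, w} \<in> edges G" "v \<noteq> w"
    using assms(2) simple_graphD(4)[OF simple] by (fastforce simp: neighbours_def)
  let ?A = "path_image (crv {v, w})"
  have "connected ?A" using crv_arc[OF e(1)] by (simp add: arc_imp_path connected_path_image)
  moreover have vw: "pos v \<in> ?A" "pos w \<in> ?A" using crv_verts[OF e(1)] by blast+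
  moreover have "pos v \<noteq> pos w" using pos_inj e graph_simps(3)[OF e(1)] by (auto simp: inj_on_eq_iff)
  ultimately have "pos v islimpt ?A"
    by (intro connected_imp_perfect) auto
  moreover have "open (W - (pos ` verts G - {pos v}))"
    using assms(3) graph_simps(1) by (intro open_Diff finite_imp_closed) auto
  moreover have "pos v \<in> W - (pos ` verts G - {pos v})" using assms(4) by blast
  ultimately obtain y where "y \<in> ?A" "y \<in> W - (pos ` verts G - {pos v})" "y \<noteq> pos v"
    using islimptE by metis
  then show ?thesis using e by (intro bexI[of _ y]) (auto simp: draw_def)
qed

text \<open>With the other edges erased, \<open>F\<close> is one side \<open>W\<close> of the
  triangle, up to isolated vertices. A vertex inside \<open>W\<close> would bring drawn points of
  its incident arcs into \<open>F\<close>, so there is none and \<open>F = W\<close>.\<close>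

lemma frontier_of_triangle_border:
  assumes F: "F \<in> regions" and T: "T \<in> triangles G" and b: "border F = {e \<in> edges G. e \<subseteq> T}"
    and iso: "\<And>v. v \<in> verts G \<Longrightarrow> neighbours G v \<noteq> {}"
  shows "frontier F = curve T"
proof -
  let ?K = "draw (verts G) (border F)"
  have K: "?K = curve T \<union> pos ` verts G"
    using T by (auto simp: curve_def draw_def b triangles_def)
  have FK: "F \<in> components (- ?K)" by (rule region_component_border[OF F])
  have F': "F \<noteq> {}" "connected F" "F \<inter> ?K = {}"
    using FK in_components_nonempty in_components_connected in_components_subset by blast+
  then obtain W where W: "open W" "connected W" "F \<subseteq> W" "W \<inter> curve T = {}" "frontier W = curve T"
    using curve_components[OF T F'(1,2)] K by blast
  have "connected (W - pos ` verts G)"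
    using W graph_simps(1) by (intro connected_open_diff_countable) (auto simp: countable_finite)
  moreover have "W - pos ` verts G \<subseteq> - ?K" using W K by blast
  moreover have "F \<inter> (W - pos ` verts G) \<noteq> {}" using F' W K by blast
  ultimately have sub: "W - pos ` verts G \<subseteq> F" using components_maximal[OF FK] by blast
  have "W \<inter> pos ` verts G = {}"
  proof (rule ccontr)
    assume "W \<inter> pos ` verts G \<noteq> {}"
    then obtain v where v: "v \<in> verts G" "pos v \<in> W" by blast
    then obtain y where "y \<in> W" "y \<in> drawing" "y \<notin> pos ` verts G"
      using drawing_in_neighbourhood[OF _ iso W(1)] by blast
    then show False using sub region_disjoint[OF F] by blast
  qed
  then have "F = W" using sub W by blast
  then show ?thesis using W by simp
qed

definition triangular_regions :: "complex set set" where
  "triangular_regions = {F \<in> regions. \<exists>T\<in>triangles G. frontier F = curve T}"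

text \<open>A border has at least as many edges as the cycle it contains. If it has only three, it
  coincides with this cycle and the region is bounded by a triangle.\<close>

lemma card_border_ge:
  assumes F: "F \<in> regions" and two: "card regions \<ge> 2"
    and iso: "\<And>v. v \<in> verts G \<Longrightarrow> neighbours G v \<noteq> {}"
  shows "card (border F) \<ge> (if F \<in> triangular_regions then 3 else 4)"
proof -
  obtain p where p: "is_cycle G p" "cycle_edges p \<subseteq> border F" using border_contains_cycle[OF F two] by blast
  have fin: "finite (border F)" using border_subset graph_simps(2) finite_subset by metis
  have cp: "card (cycle_edges p) = length p" "length p \<ge> 3" using p by (auto simp: is_cycle_def card_cycle_edges)
  have le: "card (cycle_edges p) \<le> card (border F)" using p fin by (simp add: card_mono)
  have "F \<in> triangular_regions" if "card (border F) \<le> 3"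
  proof -
    have "length p = 3" using that le cp by linarith
    moreover have "cycle_edges p = border F"
      by (rule card_seteq[OF fin p(2)]) (use that cp in linarith)
    ultimately have "\<exists>p. is_cycle G p \<and> length p = 3 \<and> cycle_edges p = border F" using p(1) by metis
    then obtain T where "T \<in> triangles G" "border F = {e \<in> edges G. e \<subseteq> T}"
      unfolding is_cycle_3_iff[OF simple] by metis
    then show ?thesis using frontier_of_triangle_border[OF F _ _ iso] F by (auto simp: triangular_regions_def)
  qed
  then show ?thesis using le cp by (cases "card (border F) \<le> 3") simp_all
qed

lemma card_triangular_regions_ge:
  assumes conn: "connected_graph G" and two: "card regions \<ge> 2"
    and conn_e: "\<And>e. e \<in> edges G \<Longrightarrow> connected_graph (G\<lparr>edges := edges G - {e}\<rparr>)"
    and iso: "\<And>v. v \<in> verts G \<Longrightarrow> neighbours G v \<noteq> {}"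
  shows "4 * card regions \<le> 2 * card (edges G) + card triangular_regions"
proof -
  have fin: "finite regions" by (rule Euler_formula(1)[OF conn])
  have sub: "triangular_regions \<subseteq> regions" by (auto simp: triangular_regions_def)
  have "4 * card regions = (\<Sum>F\<in>regions. (if F \<in> triangular_regions then 3 else 4) + (if F \<in> triangular_regions then 1 else 0))"
  proof -
    have "(\<Sum>F\<in>regions. (if F \<in> triangular_regions then 3 else 4) + (if F \<in> triangular_regions then 1 else 0)) = (\<Sum>F\<in>regions. 4 :: nat)"
      by (intro sum.cong) auto
    then show ?thesis by simp
  qed
  also have "\<dots> = (\<Sum>F\<in>regions. (if F \<in> triangular_regions then 3 else 4)) + card triangular_regions"
    using fin sub by (simp add: sum.distrib sum.If_cases Int_absorb1)
  also have "(\<Sum>F\<in>regions. (if F \<in> triangular_regions then 3 else 4)) \<le> (\<Sum>F\<in>regions. card (border F))"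
    using card_border_ge[OF _ two iso] by (intro sum_mono) auto
  also have "\<dots> \<le> 2 * card (edges G)" by (rule sum_card_border_le[OF fin conn_e])
  finally show ?thesis by simp
qed

text \<open>If all cycles had length at least 6, so would all borders, and
  \<open>6 f <= 2 |E|\<close>. But Euler's formula and \<open>3 |V| = 2 |E|\<close> give
  \<open>6 f = 2 |E| + 12\<close>.\<close>

lemma cubic_short_cycle:
  assumes conn: "connected_graph G" and reg: "regular 3 G"
    and conn_e: "\<And>e. e \<in> edges G \<Longrightarrow> connected_graph (G\<lparr>edges := edges G - {e}\<rparr>)"
  shows "\<exists>p. is_cycle G p \<and> length p \<le> 5"
proof (rule ccontr)
  assume no: "\<not> ?thesis"
  note Eu = Euler_formula[OF conn]
  have hs: "3 * card (verts G) = 2 * card (edges G)" by (rule handshake[OF simple reg])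
  then have two: "card regions \<ge> 2" using Eu(2) by linarith
  have "6 \<le> card (border F)" if F: "F \<in> regions" for F
  proof -
    obtain p where p: "is_cycle G p" "cycle_edges p \<subseteq> border F" using border_contains_cycle[OF F two] by blast
    have "card (cycle_edges p) = length p" using p by (auto simp: is_cycle_def card_cycle_edges)
    moreover have "card (cycle_edges p) \<le> card (border F)"
      using p border_subset graph_simps(2) by (meson card_mono finite_subset)
    ultimately show ?thesis using no p by fastforce
  qed
  then have "(\<Sum>F\<in>regions. 6) \<le> (\<Sum>F\<in>regions. card (border F))" by (intro sum_mono)
  also have "\<dots> \<le> 2 * card (edges G)" by (rule sum_card_border_le[OF Eu(1) conn_e])
  finally show False using Eu(2) hs by simp
qed

lemma curve_Int_pos:
  assumes "T \<in> triangles G"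
  shows "curve T \<inter> pos ` verts G = pos ` T"
proof -
  have "path_image (crv e) \<inter> pos ` verts G \<subseteq> pos ` T" if "e \<in> edges G" "e \<subseteq> T" for e
    using crv_verts[OF that(1)] that(2) by blast
  moreover have "pos ` T \<subseteq> pos ` verts G" using assms by (auto simp: triangles_def)
  ultimately show ?thesis by (auto simp: curve_def draw_def)
qed

lemma curve_inj:
  assumes "T \<in> triangles G" "T' \<in> triangles G" "curve T = curve T'"
  shows "T = T'"
proof -
  have "pos ` T = pos ` T'" using assms curve_Int_pos by metis
  moreover have "T \<subseteq> verts G" "T' \<subseteq> verts G" using assms by (auto simp: triangles_def)
  ultimately show ?thesis using inj_on_image_eq_iff[OF pos_inj] by blast
qed

lemma curve_subset_drawing: "T \<in> triangles G \<Longrightarrow> curve T \<subseteq> drawing"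
  by (auto simp: curve_def draw_def triangles_def)

text \<open>If both sides of the triangle were regions, the whole drawing would lie on the triangle,
  with no place for a fourth vertex.\<close>

lemma triangular_region_unique:
  assumes T: "T \<in> triangles G" and F: "F \<in> regions" "F' \<in> regions" "frontier F = curve T" "frontier F' = curve T"
    and big: "card (verts G) > 3"
  shows "F = F'"
proof (rule ccontr)
  assume ne: "F \<noteq> F'"
  have comp: "X \<in> components (- curve T)" if "X \<in> regions" "frontier X = curve T" for X
    using that region_disjoint[OF that(1)] curve_subset_drawing[OF T] in_components_nonempty in_components_connected
    by (intro component_of_frontier_subset) blast+
  obtain I Q where J: "open I" "open Q" "connected I" "connected Q" "I \<noteq> {}" "Q \<noteq> {}" "I \<inter> Q = {}"
    "I \<union> Q = - curve T" "frontier I = curve T" "frontier Q = curve T"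
    by (rule curve_Jordan[OF T])
  have "components (- curve T) = {I, Q}" unfolding J(8)[symmetric] using J by (intro components_Un_separation)
  then have "F \<in> {I, Q}" "F' \<in> {I, Q}" using comp F by simp_all
  then have "F \<union> F' = I \<union> Q" using ne by auto
  then have "F \<union> F' = - curve T" using J(8) by simp
  then have "drawing \<subseteq> curve T" using region_disjoint F by blast
  then have "pos ` verts G \<subseteq> curve T" by (auto simp: draw_def)
  then have "pos ` verts G \<subseteq> pos ` T" using curve_Int_pos[OF T] by blast
  then have "verts G \<subseteq> T" using pos_inj T by (auto simp: triangles_def inj_on_image_subset_iff)
  moreover have "card T = 3" "finite T" using T by (auto simp: triangles_def card_ge_0_finite)
  ultimately have "card (verts G) \<le> 3" by (metis card_mono)
  then show False using big by simp
qed

text \<open>The frontier of a region determines its triangle through the vertices on it, and a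
  triangle bounds at most one region. Counting triangular faces thus becomes counting triangles that
  bound a face.\<close>

lemma card_triangular_regions:
  assumes big: "card (verts G) > 3"
  shows "card triangular_regions = card {T \<in> triangles G. \<exists>F\<in>regions. frontier F = curve T}"
proof -
  define \<phi> where "\<phi> F = (THE T. T \<in> triangles G \<and> curve T = frontier F)" for F
  have \<phi>: "\<phi> F = T" if "T \<in> triangles G" "frontier F = curve T" for F T
    unfolding \<phi>_def using that curve_inj by (intro the_equality) auto
  have "bij_betw \<phi> triangular_regions {T \<in> triangles G. \<exists>F\<in>regions. frontier F = curve T}"
  proof (rule bij_betw_imageI)
    show "inj_on \<phi> triangular_regions"
    proof (rule inj_onI)
      fix F F' assume F: "F \<in> triangular_regions" "F' \<in> triangular_regions" "\<phi> F = \<phi> F'"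
      obtain T T' where T: "T \<in> triangles G" "frontier F = curve T" "T' \<in> triangles G" "frontier F' = curve T'"
        using F by (auto simp: triangular_regions_def)
      then have "T = T'" using \<phi> F(3) by metis
      moreover have "F \<in> regions" "F' \<in> regions" using F by (simp_all add: triangular_regions_def)
      ultimately show "F = F'" using triangular_region_unique[OF T(1) _ _ T(2) _ big] T(4) by metis
    qed
    show "\<phi> ` triangular_regions = {T \<in> triangles G. \<exists>F\<in>regions. frontier F = curve T}"
      using \<phi> by (force simp: triangular_regions_def image_iff)
  qed
  then show ?thesis by (rule bij_betw_same_card)
qed

text \<open>Everything drawn off the triangle forms a connected set: the drawing of the graph
  without \<open>T\<close> is connected, and each edge with one end in \<open>T\<close> hangs on it
  by the other end. It lies on one side of the Jordan curve, and the empty side is the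
  region.\<close>

lemma nonseparating_triangle_region:
  assumes T: "T \<in> triangles G" and conn: "connected_graph (delete_verts G T)"
  shows "\<exists>F\<in>regions. frontier F = curve T"
proof -
  let ?G = "delete_verts G T"
  interpret S: plane_graph ?G pos crv
  proof
    show "simple_graph ?G" using simple by (auto simp: simple_graph_def delete_verts_def)
    show "embedding ?G UNIV pos crv"
      using graph_simps(3) by (intro embedding_subgraph[OF emb]) (auto simp: delete_verts_def)
  qed
  have Sdraw: "S.drawing = draw (verts G - T) {e \<in> edges G. e \<inter> T = {}}"
    by (simp add: draw_def S.draw_def delete_verts_def)
  have TV: "T \<subseteq> verts G" using T by (auto simp: triangles_def)
  define D0 where "D0 = draw (verts G - T) {e \<in> edges G. e \<inter> T = {}}"
  have D0: "connected D0" unfolding D0_def Sdraw[symmetric] by (rule path_connected_imp_connected[OF S.Euler_formula(3)[OF conn]])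
  have cut: "path_image (crv e) \<inter> curve T = pos ` (e \<inter> T)" if "e \<in> edges G" "\<not> e \<subseteq> T" for e
    unfolding curve_def using that TV by (intro crv_Int_draw) auto
  define B where "B = {e \<in> edges G. \<not> e \<subseteq> T \<and> e \<inter> T \<noteq> {}}"
  define M where "M = D0 \<union> (\<Union>e\<in>B. path_image (crv e) - curve T)"
  have D0M: "D0 \<inter> curve T = {}"
  proof -
    have "pos ` (verts G - T) \<inter> curve T = {}"
      using curve_Int_pos[OF T] pos_image_Int[of "verts G - T" T] TV by blast
    moreover have "path_image (crv e) \<inter> curve T = {}" if "e \<in> edges G" "e \<inter> T = {}" for e
    proof -
      have "e \<noteq> {}" using graph_simps(4)[OF that(1)] by auto
      then show ?thesis using cut[OF that(1)] that(2) by auto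
    qed
    ultimately show ?thesis unfolding D0_def draw_def by blast
  qed
  have Mconn: "connected M"
  proof -
    have *: "connected (path_image (crv e) - curve T)" "(path_image (crv e) - curve T) \<inter> D0 \<noteq> {}" if e: "e \<in> B" for e
    proof -
      have eG: "e \<in> edges G" "\<not> e \<subseteq> T" using e by (auto simp: B_def)
      have eq: "path_image (crv e) - curve T = path_image (crv e) - pos ` (e \<inter> T)"
        using cut[OF eG] by blast
      show "connected (path_image (crv e) - curve T)" unfolding eq
        using crv_ends[OF eG(1)] crv_arc[OF eG(1)] by (intro connected_arc_image_minus_endpoints) auto
      obtain a where a: "a \<in> e" "a \<notin> T" using eG by blast
      then have "pos a \<in> D0" using graph_simps(3)[OF eG(1)] by (auto simp: D0_def draw_def)
      moreover have "pos a \<in> path_image (crv e)" using a crv_verts[OF eG(1)] by blast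
      ultimately show "(path_image (crv e) - curve T) \<inter> D0 \<noteq> {}" using D0M by blast
    qed
    have "connected (\<Union>(insert D0 ((\<lambda>e. D0 \<union> (path_image (crv e) - curve T)) ` B)))"
    proof (rule connected_Union)
      fix X assume "X \<in> insert D0 ((\<lambda>e. D0 \<union> (path_image (crv e) - curve T)) ` B)"
      then show "connected X" using * D0 by (auto intro!: connected_Un)
    next
      have "D0 \<noteq> {}" using conn by (auto simp: connected_graph_def delete_verts_def D0_def draw_def)
      then show "\<Inter>(insert D0 ((\<lambda>e. D0 \<union> (path_image (crv e) - curve T)) ` B)) \<noteq> {}" by blast
    qed
    moreover have "\<Union>(insert D0 ((\<lambda>e. D0 \<union> (path_image (crv e) - curve T)) ` B)) = M" by (auto simp: M_def)
    ultimately show ?thesis by simp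
  qed
  have Mdraw: "drawing - curve T \<subseteq> M"
  proof
    fix x assume x: "x \<in> drawing - curve T"
    then consider v where "v \<in> verts G" "x = pos v" | e where "e \<in> edges G" "x \<in> path_image (crv e)"
      by (auto simp: draw_def)
    then show "x \<in> M"
    proof cases
      case 1
      then have "v \<notin> T" using x by (auto simp: curve_def draw_def)
      then show ?thesis using 1 by (auto simp: M_def D0_def draw_def)
    next
      case 2
      then have "\<not> e \<subseteq> T" using x by (auto simp: curve_def draw_def)
      then show ?thesis using 2 x by (auto simp: M_def D0_def draw_def B_def)
    qed
  qed
  have Mc: "M \<inter> curve T = {}" using D0M by (auto simp: M_def)
  obtain I Q where J: "open I" "open Q" "connected I" "connected Q" "I \<noteq> {}" "Q \<noteq> {}" "I \<inter> Q = {}"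
    "I \<union> Q = - curve T" "frontier I = curve T" "frontier Q = curve T"
    by (rule curve_Jordan[OF T])
  have "M \<subseteq> I \<union> Q" using J Mc by blast
  then have "M \<subseteq> I \<or> M \<subseteq> Q" using connectedD[OF Mconn J(1,2)] J by blast
  then obtain W where W: "W \<inter> M = {}" "W \<inter> curve T = {}" "connected W" "W \<noteq> {}" "frontier W = curve T"
  proof
    assume "M \<subseteq> I"
    then show ?thesis using J by (intro that[of Q]) auto
  next
    assume "M \<subseteq> Q"
    then show ?thesis using J by (intro that[of I]) auto
  qed
  then have "W \<in> regions"
    using Mdraw curve_subset_drawing[OF T] by (intro component_of_frontier_subset) blast+
  then show ?thesis using W by blast
qed

end

section \<open>From the sphere to the plane\<close>

lemma punctured_sphere_homeomorphism:
  fixes q :: "real^3"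
  assumes "q \<in> unit_sphere"
  obtains h k where "homeomorphism (unit_sphere - {q}) (UNIV :: complex set) h k"
proof -
  have "(unit_sphere - {q}) homeomorphic (UNIV :: complex set)"
    using assms by (intro homeomorphic_punctured_sphere_affine) auto
  then show ?thesis using that by (auto simp: homeomorphic_def)
qed

lemma interior_UN_closed_empty:
  assumes "finite I" "\<And>i. i \<in> I \<Longrightarrow> closed (X i)" "\<And>i. i \<in> I \<Longrightarrow> interior (X i) = {}"
  shows "interior (\<Union>i\<in>I. X i) = {}"
  using assms
proof (induction I)
  case (insert i I)
  then have "interior (X i \<union> (\<Union>i\<in>I. X i)) = interior (X i)"
    by (intro interior_closed_Un_empty_interior) auto
  then show ?case using insert by simp
qed simp

definition on_sphere :: "'a graph \<Rightarrow> ('a \<Rightarrow> real^3) \<Rightarrow> ('a set \<Rightarrow> real \<Rightarrow> real^3) \<Rightarrow> (real^3) set" where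
  "on_sphere G pos crv = pos ` verts G \<union> (\<Union>e\<in>edges G. path_image (crv e))"

lemma on_sphere_compact:
  assumes "simple_graph G" "embedding G unit_sphere pos crv"
  shows "compact (on_sphere G pos crv)" "on_sphere G pos crv \<subseteq> unit_sphere"
proof -
  have "compact (\<Union>e\<in>edges G. path_image (crv e))"
    using assms simple_graphD(2)[OF assms(1)]
    by (intro compact_UN) (auto simp: embedding_def arc_imp_path compact_path_image)
  then show "compact (on_sphere G pos crv)"
    unfolding on_sphere_def using simple_graphD(1)[OF assms(1)]
    by (intro compact_Un) (auto intro: finite_imp_compact)
  show "on_sphere G pos crv \<subseteq> unit_sphere"
  proof -
    have "pos ` verts G \<subseteq> unit_sphere" "\<And>e. e \<in> edges G \<Longrightarrow> path_image (crv e) \<subseteq> unit_sphere"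
      using assms(2) unfolding embedding_def by (simp_all only: simp_thms Ball_def)
    then show ?thesis unfolding on_sphere_def by (simp add: UN_least)
  qed
qed

text \<open>Provides the centre of projection. If the drawing covered the sphere, the plane obtained
  by puncturing at some point \<open>q\<close> would be a finite union of closed sets with empty
  interior: arcs contain no open planar set, by invariance of dimension.\<close>

lemma on_sphere_not_all:
  assumes G: "simple_graph G" "verts G \<noteq> {}" "embedding G unit_sphere pos crv"
  shows "on_sphere G pos crv \<noteq> unit_sphere"
proof
  assume all: "on_sphere G pos crv = unit_sphere"
  obtain v where "v \<in> verts G" using G by blast
  then have "pos v \<in> on_sphere G pos crv" by (auto simp: on_sphere_def)
  then obtain q where q: "q \<in> unit_sphere" using all by metis
  obtain h k where hk: "homeomorphism (unit_sphere - {q}) (UNIV :: complex set) h k"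
    by (rule punctured_sphere_homeomorphism[OF q])
  have arc: "arc (crv e)" "path_image (crv e) \<subseteq> unit_sphere" if "e \<in> edges G" for e
    using G(3) that by (auto simp: embedding_def)
  have sub: "A \<subseteq> unit_sphere" if "A \<in> (\<lambda>e. path_image (crv e)) ` edges G \<union> (\<lambda>v. {pos v}) ` verts G" for A
    using that arc all by (auto simp: on_sphere_def)
  let ?I = "(\<lambda>e. path_image (crv e)) ` edges G \<union> (\<lambda>v. {pos v}) ` verts G"
  have "interior (\<Union>A\<in>?I. h ` (A - {q})) = {}"
  proof (rule interior_UN_closed_empty)
    show "finite ?I" using simple_graphD[OF G(1)] by simp
    fix A assume A: "A \<in> ?I"
    have "closed A" using A arc by (auto simp: arc_imp_path closed_path_image)
    then have "closedin (top_of_set (unit_sphere - {q})) ((unit_sphere - {q}) \<inter> A)"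
      by (rule closedin_closed_Int)
    moreover have eq: "(unit_sphere - {q}) \<inter> A = A - {q}" using sub[OF A] by blast
    ultimately have "closedin (top_of_set UNIV) (h ` (A - {q}))"
      using homeomorphism_imp_closed_map[OF hk] by simp
    then show "closed (h ` (A - {q}))" by simp
    show "interior (h ` (A - {q})) = {}"
    proof (rule ccontr)
      assume ne: "interior (h ` (A - {q})) \<noteq> {}"
      let ?N = "interior (h ` (A - {q}))"
      have kN: "k ` ?N \<subseteq> A"
      proof -
        have "k ` ?N \<subseteq> k ` h ` (A - {q})" using interior_subset by blast
        also have "\<dots> = A - {q}"
        proof -
          have "k (h x) = x" if "x \<in> A - {q}" for x
            using that eq homeomorphism_apply1[OF hk, of x] by blast
          then show ?thesis by (simp add: image_image)
        qed
        finally show ?thesis by blast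
      qed
      have k: "continuous_on ?N k" "inj_on k ?N"
        using homeomorphism_apply2[OF hk] homeomorphism_cont2[OF hk]
        by (auto intro: continuous_on_subset inj_on_inverseI[of _ h])
      consider e where "e \<in> edges G" "A = path_image (crv e)" | w where "A = {w}" using A by blast
      then show False
      proof cases
        case 1
        obtain m where m: "homeomorphism {0..1} A (crv e) m"
          using 1 arc homeomorphism_arc by blast
        have "continuous_on A m" "inj_on m A"
          using m by (auto simp: homeomorphism_def intro: inj_on_inverseI)
        then have "continuous_on ?N (m \<circ> k)" "inj_on (m \<circ> k) ?N"
          using k kN continuous_on_compose[OF k(1), of m]
          by (auto intro!: comp_inj_on intro: continuous_on_subset inj_on_subset)
        then have "DIM(complex) \<le> DIM(real)"
          using invariance_of_dimension[OF _ open_interior _ ne] by blast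
        then show False by simp
      next
        case 2
        then have "h ` (A - {q}) \<subseteq> {h w}" by blast
        then have "?N \<subseteq> interior {h w}" by (rule interior_mono)
        then show False using ne by simp
      qed
    qed
  qed
  moreover have "(\<Union>A\<in>?I. h ` (A - {q})) = h ` (on_sphere G pos crv - {q})"
    by (auto simp: on_sphere_def)
  moreover have "h ` (on_sphere G pos crv - {q}) = UNIV" using hk all by (simp add: homeomorphism_def)
  ultimately show False by simp
qed

lemma components_homeomorphism:
  assumes "homeomorphism A B h k"
  shows "components B = (`) h ` components A"
proof -
  have B: "B = h ` A" using assms by (simp add: homeomorphism_def)
  have "components B = (\<lambda>x. connected_component_set B (h x)) ` A"
    unfolding components_def by (simp add: B image_image)
  also have "\<dots> = (\<lambda>x. h ` connected_component_set A x) ` A"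
    by (intro image_cong refl connected_component_set_homeomorphism[OF assms])
  finally show ?thesis unfolding components_def by (simp add: image_image)
qed

text \<open>Seen from a point \<open>q\<close> of the drawing, which is not in \<open>F\<close>, the
  face is a connected open subset of the plane, and removing one point from such a set is harmless.
  It is applied to the face that contains the centre of projection.\<close>

lemma sphere_component_punctured:
  fixes D :: "(real^3) set"
  assumes D: "compact D" "D \<subseteq> unit_sphere" "D \<noteq> {}" and F: "F \<in> components (unit_sphere - D)"
  shows "openin (top_of_set unit_sphere) F" "connected (F - {p})" "F - {p} \<noteq> {}"
proof -
  have o: "openin (top_of_set unit_sphere) (unit_sphere - D)"
    using D by (simp add: compact_imp_closed openin_diff closed_subset)
  have "locally connected (unit_sphere - D)"
    by (rule locally_open_subset[OF locally_connected_sphere o])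
  then have "openin (top_of_set (unit_sphere - D)) F"
    using F openin_components_locally_connected by blast
  then show oF: "openin (top_of_set unit_sphere) F" using o openin_trans by blast
  obtain q where q: "q \<in> D" using D by blast
  obtain h k where hk: "homeomorphism (unit_sphere - {q}) (UNIV :: complex set) h k"
    using punctured_sphere_homeomorphism q D by blast
  have Fq: "F \<subseteq> unit_sphere - {q}" using in_components_subset[OF F] q by blast
  then have "openin (top_of_set (unit_sphere - {q})) F" using oF by (meson Diff_subset openin_subset_trans)
  then have "openin (top_of_set UNIV) (h ` F)" by (rule homeomorphism_imp_open_map[OF hk])
  then have op: "open (h ` F)" by simp
  have cont: "continuous_on F h" using hk Fq by (auto simp: homeomorphism_def intro: continuous_on_subset)
  then have con: "connected (h ` F)" using F in_components_connected connected_continuous_image by blast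
  have inj: "inj_on h F" using hk Fq by (auto simp: homeomorphism_def inj_on_def) (metis subsetD DiffD1 DiffD2 insertI1 Diff_iff)
  have kh: "k ` h ` X = X" if "X \<subseteq> F" for X
  proof -
    have "k (h x) = x" if "x \<in> X" for x
      using hk Fq that \<open>X \<subseteq> F\<close> by (auto simp: homeomorphism_def)
    then show ?thesis by (simp add: image_image)
  qed
  show "F - {p} \<noteq> {}"
  proof
    assume "F - {p} = {}"
    then have "F = {p}" using in_components_nonempty[OF F] by blast
    then show False using op not_open_singleton[of "h p"] by simp
  qed
  show "connected (F - {p})"
  proof (cases "p \<in> F")
    case True
    have "connected (h ` F - {h p})" using op con by (intro connected_open_delete) auto
    moreover have "h ` F - {h p} = h ` (F - {p})" using True inj by (auto simp: inj_on_def)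
    ultimately have "connected (h ` (F - {p}))" by simp
    moreover have "continuous_on (h ` (F - {p})) k" using hk by (auto simp: homeomorphism_def intro: continuous_on_subset)
    ultimately have "connected (k ` h ` (F - {p}))" by (rule connected_continuous_image[rotated])
    then show ?thesis using kh by simp
  next
    case False
    then show ?thesis using F in_components_connected by auto
  qed
qed

text \<open>Project from a point \<open>p\<close> off the drawing. The face around \<open>p\<close>
  merely loses this point, and all other faces are carried over unchanged, together with their
  frontiers.\<close>

lemma sphere_to_plane:
  fixes pos :: "'a \<Rightarrow> real^3"
  assumes G: "simple_graph G" "verts G \<noteq> {}" "embedding G unit_sphere pos crv"
  obtains pos' crv' where "plane_graph G pos' crv'"
    "card (faces G pos crv) = card (components (- plane_graph.draw pos' crv' (verts G) (edges G)))"
    "card (triangular_faces G pos crv) = card (plane_graph.triangular_regions G pos' crv')"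
proof -
  define D where "D = on_sphere G pos crv"
  have D: "compact D" "D \<subseteq> unit_sphere" "D \<noteq> unit_sphere" "D \<noteq> {}"
    unfolding D_def using on_sphere_compact[OF G(1,3)] on_sphere_not_all[OF G] G(2) by (auto simp: on_sphere_def)
  then obtain p where p: "p \<in> unit_sphere - D" by blast
  obtain h k where hk: "homeomorphism (unit_sphere - {p}) (UNIV :: complex set) h k"
    using punctured_sphere_homeomorphism p by blast
  have inj: "inj_on h (unit_sphere - {p})" and cont: "continuous_on (unit_sphere - {p}) h"
    using hk by (auto simp: homeomorphism_def intro: inj_on_inverseI)
  have DS: "D \<subseteq> unit_sphere - {p}" using D p by blast
  have e_sub: "path_image (crv e) \<subseteq> D" if "e \<in> edges G" for e using that by (auto simp: D_def on_sphere_def)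
  have v_sub: "pos ` verts G \<subseteq> D" by (auto simp: D_def on_sphere_def)
  have hInt: "h ` A \<inter> h ` B = h ` (A \<inter> B)" if "A \<subseteq> D" "B \<subseteq> D" for A B
    using inj_on_image_Int[OF inj, of A B] that DS by auto
  define pos' where "pos' = h \<circ> pos"
  define crv' where "crv' e = h \<circ> crv e" for e
  have E: "inj_on pos (verts G)" "\<And>e. e \<in> edges G \<Longrightarrow> arc (crv e)"
     "\<And>e. e \<in> edges G \<Longrightarrow> {pathstart (crv e), pathfinish (crv e)} = pos ` e"
     "\<And>e. e \<in> edges G \<Longrightarrow> path_image (crv e) \<inter> pos ` verts G = pos ` e"
     "\<And>e f. e \<in> edges G \<Longrightarrow> f \<in> edges G \<Longrightarrow> e \<noteq> f \<Longrightarrow> path_image (crv e) \<inter> path_image (crv f) = pos ` (e \<inter> f)"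
    using G(3) by (auto simp: embedding_def)
  have pI: "path_image (crv' e) = h ` path_image (crv e)" for e
    by (simp add: crv'_def path_image_compose)
  have emb: "embedding G UNIV pos' crv'"
    unfolding embedding_def
  proof (intro conjI ballI impI subset_UNIV)
    show "inj_on pos' (verts G)" unfolding pos'_def
      using E(1) inj v_sub DS by (intro comp_inj_on) (auto intro: inj_on_subset)
    fix e assume e: "e \<in> edges G"
    have sub: "path_image (crv e) \<subseteq> unit_sphere - {p}" using e_sub[OF e] DS by blast
    have "path (h \<circ> crv e)"
      using E(2)[OF e] continuous_on_subset[OF cont sub] by (intro path_continuous_image) (auto simp: arc_def)
    moreover have "inj_on (h \<circ> crv e) {0..1}"
      using E(2)[OF e] inj_on_subset[OF inj sub] by (intro comp_inj_on) (auto simp: arc_def path_image_def)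
    ultimately show "arc (crv' e)" by (simp add: arc_def crv'_def)
    have "{pathstart (crv' e), pathfinish (crv' e)} = h ` {pathstart (crv e), pathfinish (crv e)}"
      by (simp add: crv'_def pathstart_compose pathfinish_compose)
    then show "{pathstart (crv' e), pathfinish (crv' e)} = pos' ` e"
      unfolding E(3)[OF e] by (simp add: pos'_def image_comp)
    have "path_image (crv' e) \<inter> pos' ` verts G = h ` path_image (crv e) \<inter> h ` (pos ` verts G)"
      by (simp add: pI pos'_def image_comp)
    also have "\<dots> = h ` (pos ` e)" using hInt[OF e_sub[OF e] v_sub] E(4)[OF e] by simp
    finally show "path_image (crv' e) \<inter> pos' ` verts G = pos' ` e" by (simp add: pos'_def image_comp)
    fix f assume f: "f \<in> edges G" "e \<noteq> f"
    have "path_image (crv' e) \<inter> path_image (crv' f) = h ` (pos ` (e \<inter> f))"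
      unfolding pI using hInt[OF e_sub[OF e] e_sub[OF f(1)]] E(5)[OF e f] by simp
    then show "path_image (crv' e) \<inter> path_image (crv' f) = pos' ` (e \<inter> f)" by (simp add: pos'_def image_comp)
  qed
  interpret P: plane_graph G pos' crv' using G(1) emb by unfold_locales
  have draw: "P.drawing = h ` D"
    unfolding P.draw_def D_def on_sphere_def pI by (simp add: pos'_def image_Un image_UN image_comp)
  have faces: "faces G pos crv = components (unit_sphere - D)"
    by (simp add: faces_def D_def on_sphere_def)
  \<comment> \<open>Only the face around \<open>p\<close> is changed by the removal; for the others
    \<open>F - {p}\<close> is \<open>F\<close>.\<close>
  define \<Phi> where "\<Phi> F = h ` (F - {p})" for F
  obtain Fp where Fp: "Fp \<in> components (unit_sphere - D)" "p \<in> Fp"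
    using p by (metis Union_components Union_iff)
  have comps: "components (unit_sphere - D - {p}) = (\<lambda>F. F - {p}) ` components (unit_sphere - D)"
  proof -
    have "components (unit_sphere - D - {p}) = (components (unit_sphere - D) - {Fp}) \<union> components (Fp - {p})"
      using Fp by (intro components_Diff_subset) auto
    also have "components (Fp - {p}) = {Fp - {p}}"
      using sphere_component_punctured(2,3)[OF D(1,2,4) Fp(1)] by (intro components_connected)
    also have "(components (unit_sphere - D) - {Fp}) \<union> {Fp - {p}} = (\<lambda>F. F - {p}) ` components (unit_sphere - D)"
    proof -
      have "F - {p} = F" if "F \<in> components (unit_sphere - D) - {Fp}" for F
        using that Fp components_nonoverlap[OF Fp(1), of F] by blast
      then have "(\<lambda>F. F - {p}) ` (components (unit_sphere - D) - {Fp}) = components (unit_sphere - D) - {Fp}"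
        by simp
      moreover have "(\<lambda>F. F - {p}) ` insert Fp (components (unit_sphere - D) - {Fp})
          = insert (Fp - {p}) ((\<lambda>F. F - {p}) ` (components (unit_sphere - D) - {Fp}))"
        by (rule image_insert)
      ultimately show ?thesis unfolding insert_Diff[OF Fp(1)] by simp
    qed
    finally show ?thesis .
  qed
  have "homeomorphism (unit_sphere - D - {p}) (- h ` D) h k"
  proof (rule homeomorphism_of_subsets[OF hk])
    have "h ` (unit_sphere - D - {p}) = h ` (unit_sphere - {p}) - h ` D"
    proof -
      have "unit_sphere - D - {p} = (unit_sphere - {p}) - D" by blast
      then show ?thesis using inj_on_image_set_diff[OF inj, of "unit_sphere - {p}" D] DS by auto
    qed
    also have "\<dots> = - h ` D" using hk by (auto simp: homeomorphism_def)
    finally show "h ` (unit_sphere - D - {p}) = - h ` D" .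
  qed auto
  then have regions: "P.regions = \<Phi> ` faces G pos crv"
    unfolding draw faces by (simp add: components_homeomorphism comps \<Phi>_def image_image)
  have inj\<Phi>: "inj_on \<Phi> (faces G pos crv)"
  proof (rule inj_onI)
    fix F F' assume F: "F \<in> faces G pos crv" "F' \<in> faces G pos crv" "\<Phi> F = \<Phi> F'"
    have "F \<subseteq> unit_sphere" "F' \<subseteq> unit_sphere" using F in_components_subset unfolding faces by blast+
    then have "F - {p} = F' - {p}"
      using F(3) inj_on_image_eq_iff[OF inj, of "F - {p}" "F' - {p}"] unfolding \<Phi>_def by blast
    moreover have "F - {p} \<noteq> {}" using sphere_component_punctured(3)[OF D(1,2,4)] F unfolding faces by blast
    ultimately have "F \<inter> F' \<noteq> {}" by blast
    then show "F = F'" using F components_nonoverlap unfolding faces by blast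
  qed
  have frontier: "frontier (\<Phi> F) = h ` (top_of_set unit_sphere frontier_of F) \<and> top_of_set unit_sphere frontier_of F \<subseteq> unit_sphere - {p}"
    if F: "F \<in> faces G pos crv" for F
  proof -
    have F': "F \<in> components (unit_sphere - D)" using F faces by simp
    let ?X = "top_of_set unit_sphere" let ?U = "unit_sphere - {p}"
    have oF: "openin ?X F" by (rule sphere_component_punctured(1)[OF D(1,2,4) F'])
    have oFp: "openin ?X Fp" by (rule sphere_component_punctured(1)[OF D(1,2,4) Fp(1)])
    \<comment> \<open>\<open>p\<close> is interior to its own face \<open>Fp\<close>, which is
      disjoint from the other faces. So no frontier loses a point by puncturing.\<close>
    have "p \<notin> ?X frontier_of F"
    proof
      assume "p \<in> ?X frontier_of F"
      then have p': "p \<in> ?X closure_of F" "p \<notin> F" using frontier_of_openin[OF oF] by auto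
      then have "F \<noteq> Fp" using Fp by blast
      then have "Fp \<inter> F = {}" using F' Fp components_nonoverlap by blast
      then show False using p'(1) oFp Fp(2) unfolding in_closure_of by blast
    qed
    then have sub: "?X frontier_of F \<subseteq> ?U" using frontier_of_subset_topspace[of ?X F] by auto
    have oU: "openin ?X ?U" by (simp add: openin_diff openin_delete)
    have "subtopology ?X ?U frontier_of F = ?U \<inter> ?X frontier_of F"
      by (rule frontier_of_subtopology_open[OF oU])
    then have 1: "top_of_set ?U frontier_of F = ?X frontier_of F"
      using sub by (simp add: subtopology_subtopology Int_absorb1 Int_absorb2 inf.absorb2)
    have FS: "F \<subseteq> unit_sphere" using oF openin_imp_subset by blast
    have "top_of_set ?U frontier_of F = top_of_set ?U frontier_of (?U \<inter> F)"
      using frontier_of_restrict[of "top_of_set ?U" F] by simp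
    also have "?U \<inter> F = F - {p}" using FS by blast
    finally have 2: "top_of_set ?U frontier_of (F - {p}) = ?X frontier_of F" using 1 by simp
    have "homeomorphic_maps (top_of_set ?U) euclidean h k"
      using hk by (auto simp: homeomorphic_maps_def homeomorphism_def continuous_map_in_subtopology continuous_map_iff_continuous2)
    then have "homeomorphic_map (top_of_set ?U) euclidean h" by (rule homeomorphic_maps_map[THEN iffD1, THEN conjunct1])
    then have "euclidean frontier_of (h ` (F - {p})) = h ` (top_of_set ?U frontier_of (F - {p}))"
      using FS by (intro homeomorphic_map_frontier_of) auto
    then show ?thesis using sub by (simp add: \<Phi>_def 2)
  qed
  have tri: "\<Phi> F \<in> P.triangular_regions \<longleftrightarrow> F \<in> triangular_faces G pos crv" if F: "F \<in> faces G pos crv" for F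
  proof -
    have "frontier (\<Phi> F) = P.curve T \<longleftrightarrow> top_of_set unit_sphere frontier_of F = (\<Union>e\<in>{e \<in> edges G. e \<subseteq> T}. path_image (crv e))"
      if T: "T \<in> triangles G" for T
    proof -
      have "P.curve T = h ` (\<Union>e\<in>{e \<in> edges G. e \<subseteq> T}. path_image (crv e))"
        unfolding P.curve_triangle[OF T] by (simp add: pI image_UN)
      moreover have "(\<Union>e\<in>{e \<in> edges G. e \<subseteq> T}. path_image (crv e)) \<subseteq> unit_sphere - {p}" using e_sub DS by blast
      ultimately show ?thesis using frontier[OF F] inj_on_image_eq_iff[OF inj] by simp
    qed
    then have "\<Phi> F \<in> P.triangular_regions \<longleftrightarrow>
      (\<exists>T\<in>triangles G. top_of_set unit_sphere frontier_of F = (\<Union>e\<in>{e \<in> edges G. e \<subseteq> T}. path_image (crv e)))"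
      using F regions by (auto simp: P.triangular_regions_def)
    also have "\<dots> \<longleftrightarrow> (\<exists>E. (\<exists>T\<in>triangles G. E = {e \<in> edges G. e \<subseteq> T}) \<and> top_of_set unit_sphere frontier_of F = (\<Union>e\<in>E. path_image (crv e)))"
      by blast
    also have "\<dots> \<longleftrightarrow> F \<in> triangular_faces G pos crv"
      unfolding is_cycle_3_iff[OF G(1), symmetric] using F by (auto simp: triangular_faces_def)
    finally show ?thesis .
  qed
  have "P.triangular_regions \<subseteq> P.regions" by (auto simp: P.triangular_regions_def)
  then have "P.triangular_regions = \<Phi> ` triangular_faces G pos crv"
    using tri regions by (auto simp: triangular_faces_def)
  moreover have "triangular_faces G pos crv \<subseteq> faces G pos crv" by (auto simp: triangular_faces_def)
  ultimately have "card P.triangular_regions = card (triangular_faces G pos crv)"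
    using inj\<Phi> by (simp add: card_image inj_on_subset)
  moreover have "card P.regions = card (faces G pos crv)" unfolding regions using inj\<Phi> by (rule card_image)
  ultimately show ?thesis using that[OF P.plane_graph_axioms] by simp
qed

section \<open>Triangles and common neighbours\<close>

lemma finite_triangles: "simple_graph G \<Longrightarrow> finite (triangles G)"
  by (rule finite_subset[of _ "Pow (verts G)"]) (auto simp: triangles_def simple_graph_def)

text \<open>A triangle on an edge is given by its third vertex. This translates conditions on common
  neighbours into triangle counts.\<close>

lemma triangles_on_edge:
  assumes s: "simple_graph G" and e: "{u, v} \<in> edges G"
  shows "card {T \<in> triangles G. {u, v} \<subseteq> T} = card (neighbours G u \<inter> neighbours G v)"
proof -
  have uv: "u \<noteq> v" using simple_graphD(4)[OF s e] by auto
  have "{T \<in> triangles G. {u, v} \<subseteq> T} = (\<lambda>w. {u, v, w}) ` (neighbours G u \<inter> neighbours G v)"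
  proof (intro equalityI subsetI)
    fix T assume T: "T \<in> {T \<in> triangles G. {u, v} \<subseteq> T}"
    then have "finite T" "card (T - {u, v}) = 1" using uv
      by (auto simp: triangles_def card_ge_0_finite card_Diff_subset)
    then obtain w where "T - {u, v} = {w}" by (meson card_1_singletonE)
    then have w: "T = {u, v, w}" "w \<noteq> u" "w \<noteq> v" using T by auto
    then have "{u, w} \<in> edges G" "{v, w} \<in> edges G" using T by (auto simp: triangles_def)
    then show "T \<in> (\<lambda>w. {u, v, w}) ` (neighbours G u \<inter> neighbours G v)"
      using w s by (auto simp: neighbours_edge)
  next
    fix T assume "T \<in> (\<lambda>w. {u, v, w}) ` (neighbours G u \<inter> neighbours G v)"
    then obtain w where w: "T = {u, v, w}" "{u, w} \<in> edges G" "{v, w} \<in> edges G"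
      using s by (auto simp: neighbours_edge)
    then show "T \<in> {T \<in> triangles G. {u, v} \<subseteq> T}"
      using trianglesI[OF s e w(3,2)] by simp
  qed
  moreover have "inj_on (\<lambda>w. {u, v, w}) (neighbours G u \<inter> neighbours G v)"
  proof (rule inj_onI)
    fix x y assume xy: "x \<in> neighbours G u \<inter> neighbours G v" "{u, v, x} = {u, v, y}"
    then have "x \<noteq> u" "x \<noteq> v" using neighbours_irrefl[OF s] by blast+
    then show "x = y" using xy(2) by blast
  qed
  ultimately show ?thesis by (simp add: card_image)
qed

lemma sum_triangles_on_edges:
  assumes s: "simple_graph G"
  shows "(\<Sum>e\<in>edges G. card {T \<in> triangles G. e \<subseteq> T}) = 3 * card (triangles G)"
proof (rule sum_multicount[OF simple_graphD(2)[OF s] finite_triangles[OF s]], rule ballI)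
  fix T assume T: "T \<in> triangles G"
  obtain x y z where xyz: "T = {x, y, z}" and d: "x \<noteq> y" "y \<noteq> z" "x \<noteq> z"
    and e: "{x, y} \<in> edges G" "{y, z} \<in> edges G" "{x, z} \<in> edges G"
    by (rule triangleE[OF T])
  have "{e \<in> edges G. e \<subseteq> T} = {{x, y}, {y, z}, {x, z}}"
    unfolding xyz by (rule triangle_edges[OF s d e])
  moreover have "{x, y} \<noteq> {y, z}" "{x, y} \<noteq> {x, z}" "{y, z} \<noteq> {x, z}" using d by (auto simp: doubleton_eq_iff)
  ultimately show "card {e \<in> edges G. e \<subseteq> T} = 3" by simp
qed

lemma three_elements_card:
  assumes "finite A" "{p, q, r} \<subseteq> A" "p \<noteq> q" "p \<noteq> r" "q \<noteq> r"
  shows "3 \<le> card A"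
  using card_mono[OF assms(1,2)] assms(3-) by simp

lemma two_elements_card:
  assumes "finite A" "p \<in> A" "q \<in> A" "p \<noteq> q"
  shows "2 \<le> card A"
  using card_mono[OF assms(1), of "{p, q}"] assms(2-) by simp

lemma card_4_setI:
  assumes "card A = 4" "{a, b, c, d} \<subseteq> A" "a \<noteq> b" "a \<noteq> c" "a \<noteq> d" "b \<noteq> c" "b \<noteq> d" "c \<noteq> d"
  shows "A = {a, b, c, d}"
proof -
  have "finite A" using assms(1) by (simp add: card_ge_0_finite)
  then show ?thesis using card_subset_eq[OF _ assms(2)] assms by simp
qed

section \<open>Deza parameters of connected 4-regular graphs\<close>

locale quartic =
  fixes G :: "'a graph"
  assumes simple: "simple_graph G" and conn: "connected_graph G" and reg: "regular 4 G"
begin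

abbreviation N :: "'a \<Rightarrow> 'a set" where "N \<equiv> neighbours G"

definition cn :: "'a \<Rightarrow> 'a \<Rightarrow> nat" where "cn u v = card (N u \<inter> N v)"

lemma N_sym: "u \<in> N v \<Longrightarrow> v \<in> N u"
  using neighbours_sym[OF simple] by metis

lemma N_irrefl: "u \<notin> N u"
  by (rule neighbours_irrefl[OF simple])

lemma N_verts: "u \<in> N v \<Longrightarrow> u \<in> verts G" "u \<in> N v \<Longrightarrow> v \<in> verts G"
  using neighbours_sym[OF simple, of u v] by (auto simp: neighbours_def)

lemma finite_N: "finite (N u)"
  by (rule finite_neighbours[OF simple])

lemma card_N: "u \<in> verts G \<Longrightarrow> card (N u) = 4"
  using reg by (simp add: regular_def)

lemma cn_sym: "cn u v = cn v u"
  by (simp add: cn_def Int_commute)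

lemma cn_pos: "p \<in> N u \<Longrightarrow> p \<in> N v \<Longrightarrow> cn u v \<ge> 1"
  unfolding cn_def using finite_N by (simp add: Suc_le_eq card_gt_0_iff) blast

lemma common_neighbour: "cn u v \<ge> 1 \<Longrightarrow> \<exists>p. p \<in> N u \<and> p \<in> N v"
proof -
  assume "cn u v \<ge> 1"
  then have "N u \<inter> N v \<noteq> {}" by (auto simp: cn_def)
  then show ?thesis by blast
qed

lemma cn_two: "p \<in> N u \<Longrightarrow> p \<in> N v \<Longrightarrow> q \<in> N u \<Longrightarrow> q \<in> N v \<Longrightarrow> p \<noteq> q \<Longrightarrow> cn u v \<ge> 2"
  unfolding cn_def using finite_N by (intro two_elements_card) auto

lemma cn_three: "{p, q, r} \<subseteq> N u \<inter> N v \<Longrightarrow> p \<noteq> q \<Longrightarrow> p \<noteq> r \<Longrightarrow> q \<noteq> r \<Longrightarrow> cn u v \<ge> 3"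
  unfolding cn_def using finite_N by (intro three_elements_card[of _ p q r]) auto

lemma closed_verts:
  assumes "S \<subseteq> verts G" "S \<noteq> {}" "\<And>x. x \<in> S \<Longrightarrow> N x \<subseteq> S"
  shows "verts G = S"
proof -
  obtain u where "u \<in> S" using assms by blast
  then have "verts G \<subseteq> S"
    using assms neighbours_edge[OF simple] by (intro connected_graph_closed_set[OF conn, of u]) blast+
  then show ?thesis using assms by blast
qed

text \<open>Both sides count walks of length two from \<open>u\<close> to another vertex: four
  choices for the middle vertex, then three for the end.\<close>

lemma sum_cn:
  assumes u: "u \<in> verts G"
  shows "(\<Sum>v\<in>verts G - {u}. cn u v) = 12"
proof -
  have "(\<Sum>v\<in>verts G - {u}. cn u v) = (\<Sum>v\<in>verts G - {u}. card {w \<in> N u. w \<in> N v})"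
    by (intro sum.cong refl) (auto simp: cn_def Int_def)
  also have "\<dots> = 3 * card (N u)"
  proof (rule sum_multicount[OF _ finite_N], use simple_graphD(1)[OF simple] in simp, rule ballI)
    fix w assume w: "w \<in> N u"
    have "{v \<in> verts G - {u}. w \<in> N v} = N w - {u}"
      using N_sym N_verts by blast
    then show "card {v \<in> verts G - {u}. w \<in> N v} = 3"
      using w N_sym N_verts card_N[of w] by (simp add: card_Diff_singleton)
  qed
  finally show ?thesis using card_N[OF u] by simp
qed

text \<open>Each neighbour of \<open>u\<close> is adjacent to \<open>u\<close> and to the three
  other neighbours, which exhausts its degree. The closed neighbourhood of \<open>u\<close> is then
  the whole graph, a complete graph on five vertices.\<close>

lemma no_clique_block:
  assumes c: "\<And>x. x \<in> N u \<Longrightarrow> cn u x = 3" and u: "u \<in> verts G"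
  shows "card (verts G) = 5"
proof -
  have eq: "N x = insert u (N u - {x})" if x: "x \<in> N u" for x
  proof -
    have 1: "card (N u - {x}) = 3" using x card_N[OF u] by simp
    have "N u \<inter> N x = N u - {x}"
      by (rule card_subset_eq) (use c[OF x] 1 finite_N N_irrefl in \<open>auto simp: cn_def\<close>)
    then have "insert u (N u - {x}) \<subseteq> N x" using N_sym[OF x] by blast
    moreover have "card (insert u (N u - {x})) = card (N x)"
      using 1 finite_N N_irrefl card_N[of x] N_verts x by simp
    ultimately show ?thesis using finite_N card_subset_eq by metis
  qed
  have "verts G = insert u (N u)"
    using u N_verts eq by (intro closed_verts) auto
  then show ?thesis using card_N[OF u] finite_N N_irrefl by simp
qed

text \<open>Each vertex \<open>x\<close> of the complete graph \<open>K\<close> has exactly one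
  neighbour \<open>g x\<close> outside. The values 0 and 2 force these outer vertices to be distinct
  and pairwise adjacent, so a second complete graph on four vertices closes up
  \<open>G\<close>.\<close>

lemma K4_block:
  assumes K: "card K = 4" "K \<subseteq> verts G" "\<And>x y. x \<in> K \<Longrightarrow> y \<in> K \<Longrightarrow> x \<noteq> y \<Longrightarrow> y \<in> N x"
    and two: "\<And>x y. x \<in> verts G \<Longrightarrow> y \<in> verts G \<Longrightarrow> x \<noteq> y \<Longrightarrow> cn x y = 0 \<or> cn x y = 2"
  shows "card (verts G) \<le> 8"
proof -
  have finK: "finite K" using K by (simp add: card_ge_0_finite)
  have "\<exists>x'. N x = insert x' (K - {x}) \<and> x' \<notin> K" if x: "x \<in> K" for x
  proof -
    have sub: "K - {x} \<subseteq> N x" using K(3)[OF x] by blast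
    have "card (N x - (K - {x})) = 1"
      using sub finK K x card_N[of x] by (subst card_Diff_subset) auto
    then obtain x' where x': "N x - (K - {x}) = {x'}" by (meson card_1_singletonE)
    then have "x' \<noteq> x" using N_irrefl by blast
    then show ?thesis using x' sub by blast
  qed
  then obtain g where g: "\<And>x. x \<in> K \<Longrightarrow> N x = insert (g x) (K - {x})" "\<And>x. x \<in> K \<Longrightarrow> g x \<notin> K"
    by metis
  have other: "\<exists>p q. p \<in> K \<and> q \<in> K \<and> p \<noteq> q \<and> p \<noteq> x \<and> q \<noteq> x \<and> p \<noteq> y \<and> q \<noteq> y" if "x \<in> K" "y \<in> K" "x \<noteq> y" for x y
  proof -
    have "card (K - {x, y}) = 2" using that K finK by (simp add: card_Diff_subset)
    then obtain p q where "K - {x, y} = {p, q}" "p \<noteq> q" by (meson card_2_iff)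
    then show ?thesis by blast
  qed
  \<comment> \<open>Otherwise \<open>x\<close> and \<open>y\<close> would share \<open>g x\<close>
    in addition to the two remaining vertices of \<open>K\<close>.\<close>
  have ge: "g x \<notin> N y" if xy: "x \<in> K" "y \<in> K" "x \<noteq> y" for x y
  proof
    assume a: "g x \<in> N y"
    obtain p q where pq: "p \<in> K" "q \<in> K" "p \<noteq> q" "p \<noteq> x" "q \<noteq> x" "p \<noteq> y" "q \<noteq> y" using other[OF xy] by blast
    have "{p, q, g x} \<subseteq> N x \<inter> N y" using a pq g xy by auto
    moreover have "p \<noteq> g x" "q \<noteq> g x" using pq g xy by auto
    ultimately have "cn x y \<ge> 3" using pq(3) by (intro cn_three[of p q "g x"])
    then show False using two[of x y] xy K(2) by auto
  qed
  \<comment> \<open>\<open>y\<close> and \<open>g x\<close> share \<open>x\<close>, hence a second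
    vertex. By \<open>ge\<close> it is outside \<open>K\<close>, and the only neighbour of
    \<open>y\<close> there is \<open>g y\<close>.\<close>
  have adj: "g y \<in> N (g x)" if xy: "x \<in> K" "y \<in> K" "x \<noteq> y" for x y
  proof -
    have gx: "x \<in> N (g x)" using g(1)[OF xy(1)] N_sym by blast
    have xy': "x \<in> N y" using K(3) xy by metis
    have "y \<noteq> g x" using g(2) xy by metis
    then have "cn y (g x) = 2" using two[of y "g x"] cn_pos[OF xy' gx] N_verts(2)[OF gx] xy K(2) by force
    then obtain q where q: "q \<in> N y \<inter> N (g x)" "q \<noteq> x"
      unfolding cn_def by (metis card_2_iff insertCI)
    then have "g x \<in> N q" using N_sym by blast
    then have "q \<notin> K" using ge[of x q] xy(1) q(2) by blast
    then show ?thesis using q g(1)[OF xy(2)] by auto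
  qed
  have inj: "inj_on g K"
    using ge g(1) by (intro inj_onI) (metis insertI1)
  have Ng: "N (g x) \<subseteq> K \<union> g ` K" if x: "x \<in> K" for x
  proof -
    have gx: "x \<in> N (g x)" using g(1)[OF x] N_sym by blast
    have sub: "insert x (g ` (K - {x})) \<subseteq> N (g x)" using adj[OF x] gx by blast
    have "card (g ` (K - {x})) = 3" using inj x K(1) finK by (subst card_image) (auto intro: inj_on_subset)
    moreover have "x \<notin> g ` (K - {x})" using g(2) x by blast
    ultimately have "card (insert x (g ` (K - {x}))) = 4" using finK by simp
    then have "insert x (g ` (K - {x})) = N (g x)"
      using card_subset_eq[OF finite_N sub] card_N[OF N_verts(2)[OF gx]] by simp
    moreover have "insert x (g ` (K - {x})) \<subseteq> K \<union> g ` K" using x by auto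
    ultimately show ?thesis by simp
  qed
  have "verts G = K \<union> g ` K"
  proof (rule closed_verts)
    show "K \<union> g ` K \<subseteq> verts G" using K(2) g(1) N_verts(1) by blast
    show "K \<union> g ` K \<noteq> {}" using K(1) by auto
    show "N x \<subseteq> K \<union> g ` K" if "x \<in> K \<union> g ` K" for x using that Ng g(1) by auto
  qed
  then have "card (verts G) \<le> card K + card (g ` K)" by (simp add: card_Un_le)
  then show ?thesis using K(1) card_image_le[OF finK, of g] by simp
qed

text \<open>The edges of a triangle have a common neighbour, so their ends have exactly
  \<open>m\<close>, and \<open>m\<close> is at most 3 because adjacent vertices share at most three
  of their four neighbours. The value 3 leads to a complete graph on five vertices, the value 2 to
  \<open>K4_block\<close>.\<close>

lemma deza_zero_many:
  assumes cn: "\<And>x y. x \<in> verts G \<Longrightarrow> y \<in> verts G \<Longrightarrow> x \<noteq> y \<Longrightarrow> cn x y = 0 \<or> cn x y = m"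
    and m: "m \<ge> 2" and T: "T \<in> triangles G"
  shows "card (verts G) \<le> 8"
proof -
  obtain u v w where "T = {u, v, w}" and d: "u \<noteq> v" "v \<noteq> w" "u \<noteq> w"
    and e: "{u, v} \<in> edges G" "{v, w} \<in> edges G" "{u, w} \<in> edges G"
    by (rule triangleE[OF T])
  have a: "v \<in> N u" "w \<in> N u" "w \<in> N v" using e by (simp_all add: neighbours_edge[OF simple])
  have V: "u \<in> verts G" "v \<in> verts G" "w \<in> verts G" using a N_verts by blast+
  have pos: "cn x y = m" if "p \<in> N x" "p \<in> N y" "x \<noteq> y" for p x y
    using cn[of x y] cn_pos[OF that(1,2)] N_verts(2) that by force
  have cuv: "cn u v = m" using pos[of w u v] a d by blast
  have le3: "cn x y \<le> 3" if "y \<in> N x" for x y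
  proof -
    have "N x \<inter> N y \<subseteq> N x - {y}" using N_irrefl by blast
    then have "cn x y \<le> card (N x - {y})" unfolding cn_def using finite_N by (intro card_mono) auto
    then show ?thesis using that card_N[of x] N_verts(2) by simp
  qed
  consider "m = 3" | "m = 2" using m le3[OF a(1)] cuv by linarith
  then show ?thesis
  proof cases
    case 1
    \<comment> \<open>Every other neighbour \<open>x\<close> of \<open>u\<close> is then adjacent to
      \<open>v\<close>; sharing \<open>v\<close> with \<open>u\<close> forces the value 3 for
      \<open>u\<close> and \<open>x\<close> as well.\<close>
    have "N u \<inter> N v = N u - {v}"
      by (rule card_subset_eq) (use cuv 1 a card_N[OF V(1)] finite_N N_irrefl in \<open>auto simp: cn_def\<close>)
    then have "cn u x = 3" if x: "x \<in> N u" for x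
    proof (cases "x = v")
      case False
      then have "x \<in> N v" using x \<open>N u \<inter> N v = N u - {v}\<close> by blast
      then have "v \<in> N x" by (rule N_sym)
      then show ?thesis using pos[of v u x] a(1) x N_irrefl 1 by metis
    qed (use cuv 1 in simp)
    then have "card (verts G) = 5" using V by (intro no_clique_block)
    then show ?thesis by simp
  next
    case 2
    have three: False if "{p, q, r} \<subseteq> N x \<inter> N y" "p \<noteq> q" "p \<noteq> r" "q \<noteq> r" "x \<noteq> y" for p q r x y
      using cn_three[OF that(1-4)] pos[of p x y] that 2 by auto
    have second: "\<exists>q. q \<noteq> p \<and> q \<in> N x \<and> q \<in> N y" if "p \<in> N x" "p \<in> N y" "x \<noteq> y" for p x y
    proof -
      have "card (N x \<inter> N y) = 2" using pos[OF that] 2 by (simp add: cn_def)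
      then obtain a b where ab: "N x \<inter> N y = {a, b}" "a \<noteq> b" by (meson card_2_iff)
      then have "a \<in> N x" "a \<in> N y" "b \<in> N x" "b \<in> N y" by blast+
      then show ?thesis using ab(2) by metis
    qed
    obtain z where z: "z \<noteq> w" "z \<in> N u" "z \<in> N v" using second[of w u v] a d by blast
    have zd: "z \<noteq> u" "z \<noteq> v" using z N_irrefl by blast+
    have "card (N u - {v, w, z}) = 1" using a z zd d card_N[OF V(1)] finite_N by (subst card_Diff_subset) auto
    then obtain t where t: "N u - {v, w, z} = {t}" by (meson card_1_singletonE)
    then have Nu: "N u = {v, w, z, t}" "t \<noteq> v" "t \<noteq> w" "t \<noteq> z" using a z by auto
    \<comment> \<open>If not, the second common neighbour of \<open>u\<close> and \<open>w\<close>,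
      besides \<open>v\<close>, can only be \<open>t\<close>, and likewise for \<open>u\<close> and
      \<open>z\<close>. Then \<open>v\<close> and \<open>t\<close> share \<open>u\<close>,
      \<open>w\<close> and \<open>z\<close>.\<close>
    have "z \<in> N w"
    proof (rule ccontr)
      assume n: "z \<notin> N w"
      obtain q where "q \<noteq> v" "q \<in> N u" "q \<in> N w" using second[of v u w] a d N_sym[OF a(3)] by blast
      then have tw: "t \<in> N w" using Nu N_irrefl n by blast
      obtain q' where "q' \<noteq> v" "q' \<in> N u" "q' \<in> N z" using second[of v u z] a zd N_sym[OF z(3)] by blast
      moreover have "w \<notin> N z" using n N_sym by blast
      ultimately have tz: "t \<in> N z" using Nu N_irrefl by blast
      have "{u, w, z} \<subseteq> N v \<inter> N t"
        using N_sym[OF a(1)] a(3) z(3) N_sym[OF tw] N_sym[OF tz] N_sym[of t u] Nu by auto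
      then show False using three[of u w z v t] d zd z Nu(2) by metis
    qed
    then have K: "y \<in> N x" if "x \<in> {u, v, w, z}" "y \<in> {u, v, w, z}" "x \<noteq> y" for x y
      using that a z N_sym by blast
    have "card {u, v, w, z} = 4" using d z zd by simp
    moreover have "{u, v, w, z} \<subseteq> verts G" using V N_verts(1)[OF z(2)] by blast
    ultimately show ?thesis using K cn 2 by (intro K4_block[of "{u, v, w, z}"]) blast+
  qed
qed

text \<open>
  The situation excluded here: two vertices have one common neighbour, except that each vertex has a
  unique mate with which it shares two. The mates \<open>x, x'\<close> and \<open>y, z\<close> are the diagonals of a 4-cycle,
  and \<open>w, v, t, s\<close> are the apexes of the triangles on its sides \<open>xy, xz, x'y, x'z\<close>.
\<close>

lemma mate_free_square:
  assumes pos: "\<And>p q. p \<in> verts G \<Longrightarrow> q \<in> verts G \<Longrightarrow> p \<noteq> q \<Longrightarrow> cn p q \<ge> 1"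
    and uniq: "\<And>p q r. cn p q \<ge> 2 \<Longrightarrow> cn p r \<ge> 2 \<Longrightarrow> p \<noteq> q \<Longrightarrow> p \<noteq> r \<Longrightarrow> q = r"
    and nadj: "\<And>p q. q \<in> N p \<Longrightarrow> cn p q \<le> 1"
    and Nb: "N x = {y, z, w, v}" "N y = {x, x', w, t}" "N x' = {y, z, t, s}" "N z = {x, x', v, s}"
    and M: "cn x x' \<ge> 2" "cn y z \<ge> 2"
    and d: "distinct [x, x', y, z, w, v, t, s]"
    and r: "r \<in> verts G" "r \<notin> {x, x', y, z, w, v, t, s}" "w \<in> N r"
  shows False
proof -
  have M': "cn x' x \<ge> 2" "cn z y \<ge> 2" using M cn_sym by metis+
  have far: "q \<notin> N x" "q \<notin> N x'" "q \<notin> N y" "q \<notin> N z" if "q \<notin> {x, x', y, z, w, v, t, s}" for q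
    using that unfolding Nb by auto
  have wN: "w \<in> N x" "w \<in> N y" "t \<in> N y" "y \<in> N x'" "s \<in> N x'" "v \<in> N x" unfolding Nb by auto
  \<comment> \<open>If \<open>q\<close> were adjacent to \<open>v\<close>, it would be a second mate
    of \<open>x\<close>; if to \<open>t\<close>, a second mate of \<open>y\<close>. But
    \<open>q\<close> needs a common neighbour with \<open>x'\<close>, and among the neighbours of
    \<open>x'\<close> only \<open>s\<close> is left.\<close>
  have step: "s \<in> N q \<and> v \<notin> N q \<and> t \<notin> N q"
    if q: "q \<in> verts G" "q \<notin> {x, x', y, z, w, v, t, s}" "w \<in> N q" for q
  proof -
    have "v \<notin> N q"
    proof
      assume "v \<in> N q"
      then have "cn x q \<ge> 2" using cn_two[of w x q v] wN q d by auto
      then show False using uniq[of x x' q] M q d by auto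
    qed
    moreover have "t \<notin> N q"
    proof
      assume "t \<in> N q"
      then have "cn y q \<ge> 2" using cn_two[of w y q t] wN q d by auto
      then show False using uniq[of y z q] M q d by auto
    qed
    moreover have "x' \<in> verts G" using wN N_verts by blast
    then have "cn x' q \<ge> 1" using pos[of x' q] q by auto
    then obtain p where "p \<in> N x'" "p \<in> N q" using common_neighbour by blast
    moreover have "y \<notin> N q" "z \<notin> N q" using far[OF q(2)] N_sym by blast+
    ultimately show ?thesis unfolding Nb by auto
  qed
  have rr: "s \<in> N r" "v \<notin> N r" "t \<notin> N r" using step[OF r] by auto
  have "w \<in> verts G" "w \<noteq> r" using wN N_verts r by auto
  then have "cn w r \<ge> 1" using pos[of w r] r by auto
  \<comment> \<open>\<open>q\<close> turns out to be another outer neighbour of \<open>w\<close>, so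
    \<open>step\<close> makes it adjacent to \<open>s\<close>. The adjacent vertices
    \<open>r\<close> and \<open>q\<close> then share both \<open>w\<close> and
    \<open>s\<close>.\<close>
  then obtain q where q: "q \<in> N w" "q \<in> N r" using common_neighbour by blast
  have "q \<notin> {x, x', y, z}" using far[OF r(2)] N_sym[OF q(2)] by blast
  moreover have "q \<notin> {v, t}" using rr q by blast
  moreover have "q \<noteq> w" using q N_irrefl by blast
  moreover have "q \<noteq> s"
  proof
    assume "q = s"
    then have "cn x' w \<ge> 2" using cn_two[of y x' w s] wN N_sym[OF wN(2)] q d by auto
    then show False using uniq[of x' x w] M' d by auto
  qed
  ultimately have q': "q \<notin> {x, x', y, z, w, v, t, s}" by blast
  have "s \<in> N q" using step[of q] q' N_verts[OF q(1)] N_sym[OF q(1)] by blast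
  then have "cn r q \<ge> 2" using cn_two[of w r q s] rr r N_sym[OF q(1)] d by auto
  then show False using nadj[OF q(2)] by simp
qed

text \<open>If \<open>x\<close> and \<open>x'\<close> share \<open>y\<close> and \<open>z\<close>,
  then \<open>y\<close> and \<open>z\<close> share \<open>x\<close> and \<open>x'\<close> and are
  mates too. The forced common neighbours on the sides of this 4-cycle fill up the neighbourhoods of
  its corners, and a ninth vertex leads to \<open>mate_free_square\<close>.\<close>

lemma deza_unique_mate:
  assumes mate: "\<And>u. u \<in> verts G \<Longrightarrow> \<exists>u'\<in>verts G - {u}. cn u u' = 2 \<and> (\<forall>v\<in>verts G - {u, u'}. cn u v = 1)"
  shows "card (verts G) \<le> 8"
proof (rule ccontr)
  assume big: "\<not> ?thesis"
  have pos: "cn p q \<ge> 1" if p: "p \<in> verts G" and q: "q \<in> verts G" "p \<noteq> q" for p q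
  proof -
    obtain u' where "cn p u' = 2" "\<forall>v\<in>verts G - {p, u'}. cn p v = 1" using mate[OF p] by blast
    then show ?thesis using p q by (cases "q = u'") auto
  qed
  have cnV: "p \<in> verts G" "q \<in> verts G" if "cn p q \<ge> 2" for p q
  proof -
    have "cn p q \<ge> 1" using that by linarith
    then obtain r where "r \<in> N p" "r \<in> N q" using common_neighbour by blast
    then show "p \<in> verts G" "q \<in> verts G" using N_verts by blast+
  qed
  have uniq: "q = r" if pqr: "cn p q \<ge> 2" "cn p r \<ge> 2" "p \<noteq> q" "p \<noteq> r" for p q r
  proof -
    obtain u' where u': "\<forall>v\<in>verts G - {p, u'}. cn p v = 1" using mate[OF cnV(1)[OF pqr(1)]] by blast
    have "v = u'" if "cn p v \<ge> 2" "p \<noteq> v" for v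
    proof (rule ccontr)
      assume "v \<noteq> u'"
      then have "cn p v = 1" using u' cnV(2)[OF that(1)] that(2) by simp
      then show False using that(1) by simp
    qed
    then have "q = u'" "r = u'" using pqr by blast+
    then show ?thesis by simp
  qed
  have le2: "cn p q \<le> 2" if "p \<noteq> q" for p q
  proof (rule ccontr)
    assume "\<not> ?thesis"
    then have "cn p q \<ge> 2" "cn p q \<noteq> 1" "cn p q \<noteq> 2" by auto
    then show False using mate[OF cnV(1)[of p q]] cnV(2)[of p q] that by blast
  qed
  \<comment> \<open>Mates are not adjacent. Let \<open>p\<close> and \<open>q\<close> be adjacent
    mates sharing \<open>a\<close> and \<open>b\<close>, and \<open>t\<close> the fourth neighbour
    of \<open>p\<close>. A common neighbour \<open>c\<close> of \<open>p\<close> and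
    \<open>t\<close> must be \<open>a\<close> or \<open>b\<close>; then \<open>p\<close> and
    \<open>c\<close> share \<open>q\<close> and \<open>t\<close>, and \<open>c\<close> is a second
    mate of \<open>p\<close>.\<close>
  have nadj: "cn p q \<le> 1" if "q \<in> N p" for p q
  proof (rule ccontr)
    assume "\<not> ?thesis"
    then have M: "cn p q \<ge> 2" by simp
    have pq: "p \<noteq> q" using that N_irrefl by blast
    have pV: "p \<in> verts G" using that by (rule N_verts(2))
    have "card (N p \<inter> N q) = 2" using M le2[OF pq] by (simp add: cn_def)
    then obtain a b where ab: "N p \<inter> N q = {a, b}" "a \<noteq> b" by (meson card_2_iff)
    have qa: "q \<noteq> a" "q \<noteq> b" using ab N_irrefl by blast+
    have "card (N p - {q, a, b}) = 1"
      using that ab qa card_N[OF N_verts(2)[OF that]] finite_N by (subst card_Diff_subset) auto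
    then obtain t where t: "N p - {q, a, b} = {t}" by (meson card_1_singletonE)
    then have Np: "N p = {q, a, b, t}" "t \<noteq> q" "t \<noteq> a" "t \<noteq> b" using that ab by auto
    have tV: "t \<in> verts G" "t \<noteq> p" using Np N_verts(1)[of t p] N_irrefl[of p] by auto
    obtain c where c: "c \<in> N p" "c \<in> N t"
      using common_neighbour[OF pos[of p t]] tV pV by metis
    have "c \<noteq> t" using c N_irrefl by blast
    have "c \<noteq> q"
    proof
      assume "c = q"
      then have "t \<in> N p \<inter> N q" using c N_sym Np by blast
      then show False using ab Np by blast
    qed
    then have cab: "c \<in> {a, b}" using c Np \<open>c \<noteq> t\<close> by blast
    then have "q \<in> N c" using ab N_sym by blast
    then have "cn p c \<ge> 2" using cn_two[of q p c t] that N_sym[OF c(2)] Np by auto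
    moreover have "p \<noteq> c" using c N_irrefl by blast
    ultimately have "q = c" using uniq[OF M] pq by blast
    then show False using cab qa by blast
  qed
  have "verts G \<noteq> {}" using big by auto
  then obtain x where x: "x \<in> verts G" by blast
  obtain x' where x': "x' \<in> verts G" "x' \<noteq> x" "cn x x' = 2" using mate[OF x] by blast
  obtain y z where yz: "N x \<inter> N x' = {y, z}" "y \<noteq> z" using x'(3) unfolding cn_def by (meson card_2_iff)
  have yN: "y \<in> N x" "y \<in> N x'" "z \<in> N x" "z \<in> N x'" using yz by blast+
  have Myz: "cn y z \<ge> 2" using cn_two[of x y z x'] N_sym yN x'(2) by metis
  then have "card (N y \<inter> N z) = 2" using le2[OF yz(2)] by (simp add: cn_def)
  moreover have "{x, x'} \<subseteq> N y \<inter> N z" using N_sym yN by blast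
  ultimately have Nyz: "N y \<inter> N z = {x, x'}" using finite_N x'(2)
    by (metis card_2_iff card_subset_eq finite_Int)
  have na: "x' \<notin> N x" "x \<notin> N x'" "z \<notin> N y" "y \<notin> N z"
    using nadj[of x' x] nadj[of x x'] nadj[of z y] nadj[of y z] x'(3) Myz cn_sym[of x x'] cn_sym[of y z] by auto
  have V: "y \<in> verts G" "z \<in> verts G" using yN N_verts by blast+
  have ne: "x \<noteq> y" "x \<noteq> z" "x' \<noteq> y" "x' \<noteq> z" using yN N_irrefl by blast+
  obtain w where w: "w \<in> N x" "w \<in> N y" using common_neighbour[OF pos[OF x V(1) ne(1)]] by blast
  obtain v where v: "v \<in> N x" "v \<in> N z" using common_neighbour[OF pos[OF x V(2) ne(2)]] by blast
  obtain t where t: "t \<in> N x'" "t \<in> N y" using common_neighbour[OF pos[OF x'(1) V(1) ne(3)]] by blast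
  obtain s where s: "s \<in> N x'" "s \<in> N z" using common_neighbour[OF pos[OF x'(1) V(2) ne(4)]] by blast
  have nw: "w \<notin> {x, x', y, z}" "v \<notin> {x, x', y, z}" "t \<notin> {x, x', y, z}" "s \<notin> {x, x', y, z}"
    using w v t s na N_irrefl by auto
  have dd: "w \<noteq> v" "w \<noteq> t" "w \<noteq> s" "v \<noteq> t" "v \<noteq> s" "t \<noteq> s"
    using w v t s nw yz Nyz by blast+
  have d: "distinct [x, x', y, z, w, v, t, s]" "distinct [x, x', z, y, v, w, s, t]"
    using nw dd ne yz(2) x'(2) by auto
  have Nx: "N x = {y, z, w, v}" by (rule card_4_setI[OF card_N[OF x]]) (use yN w v d in auto)
  have Ny: "N y = {x, x', w, t}" by (rule card_4_setI[OF card_N[OF V(1)]]) (use N_sym yN w t d in auto)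
  have Nx': "N x' = {y, z, t, s}" by (rule card_4_setI[OF card_N[OF x'(1)]]) (use yN t s d in auto)
  have Nz: "N z = {x, x', v, s}" by (rule card_4_setI[OF card_N[OF V(2)]]) (use N_sym yN v s d in auto)
  \<comment> \<open>A ninth vertex \<open>r\<close> must share a neighbour with \<open>x\<close>.
    This is \<open>w\<close> or \<open>v\<close>, because \<open>y\<close> and \<open>z\<close> have
    no room for \<open>r\<close>; the two cases are exchanged by swapping \<open>y\<close> with
    \<open>z\<close>, \<open>w\<close> with \<open>v\<close> and \<open>t\<close> with
    \<open>s\<close>.\<close>
  have "\<not> verts G \<subseteq> {x, x', y, z, w, v, t, s}"
  proof
    assume "verts G \<subseteq> {x, x', y, z, w, v, t, s}"
    then have "card (verts G) \<le> card {x, x', y, z, w, v, t, s}" by (intro card_mono) auto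
    also have "\<dots> \<le> 8" using card_length[of "[x, x', y, z, w, v, t, s]"] by simp
    finally show False using big by simp
  qed
  then obtain r where r: "r \<in> verts G" "r \<notin> {x, x', y, z, w, v, t, s}" by blast
  obtain p where p: "p \<in> N x" "p \<in> N r" using common_neighbour[OF pos[OF x r(1)]] r by blast
  have "y \<notin> N r" "z \<notin> N r" using r N_sym[of y r] N_sym[of z r] Ny Nz by auto
  moreover have "p \<in> {y, z, w, v}" using p(1) Nx by simp
  ultimately have "p = w \<or> p = v" using p(2) by auto
  then consider "w \<in> N r" | "v \<in> N r" using p(2) by blast
  then show False
  proof cases
    case 1
    show False
      by (rule mate_free_square[OF pos uniq nadj Nx Ny Nx' Nz _ Myz d(1) r 1]) (use x'(3) in auto)
  next
    case 2
    have r': "r \<notin> {x, x', z, y, v, w, s, t}" using r by blast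
    have N': "N x = {z, y, v, w}" "N z = {x, x', v, s}" "N x' = {z, y, s, t}" "N y = {x, x', w, t}"
      unfolding Nx Ny Nx' Nz by blast+
    have Mzy: "cn z y \<ge> 2" using Myz cn_sym by metis
    show False
      by (rule mate_free_square[OF pos uniq nadj N'(1,2,3,4) _ Mzy d(2) r(1) r' 2]) (use x'(3) in auto)
  qed
qed

text \<open>With 12 vertices or more, the at least eleven counts at a vertex are all at least
  \<open>l\<close> and sum to 12. This leaves \<open>l = 1\<close> and at most 13 vertices, hence 12
  by divisibility. Eleven positive counts of sum 12 are ten ones and a single two: every vertex has
  a unique mate.\<close>

lemma deza_positive:
  assumes cn: "\<And>x y. x \<in> verts G \<Longrightarrow> y \<in> verts G \<Longrightarrow> x \<noteq> y \<Longrightarrow> cn x y = l \<or> cn x y = m"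
    and l: "l \<ge> 1" "l \<le> m" and three: "3 dvd card (verts G)"
  shows "card (verts G) < 12"
proof (rule ccontr)
  assume "\<not> ?thesis"
  then have big: "card (verts G) \<ge> 12" by simp
  have fin: "finite (verts G)" by (rule simple_graphD(1)[OF simple])
  have ge: "cn u v \<ge> l" if "u \<in> verts G" "v \<in> verts G - {u}" for u v using cn[of u v] l that by auto
  have sum: "(\<Sum>v\<in>verts G - {u}. cn u v) = 12" if "u \<in> verts G" for u by (rule sum_cn[OF that])
  have c: "card (verts G - {u}) + 1 = card (verts G)" if "u \<in> verts G" for u using that fin
    by (metis Suc_eq_plus1 card_Suc_Diff1)
  have "verts G \<noteq> {}" using big by auto
  then obtain u0 where u0: "u0 \<in> verts G" by blast
  have "(\<Sum>v\<in>verts G - {u0}. l) \<le> (\<Sum>v\<in>verts G - {u0}. cn u0 v)"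
    using ge[OF u0] by (intro sum_mono) auto
  then have le: "card (verts G - {u0}) * l \<le> 12" using sum[OF u0] by simp
  have "l = 1"
  proof (rule ccontr)
    assume "l \<noteq> 1"
    then have "2 \<le> l" using l by linarith
    then have "card (verts G - {u0}) * 2 \<le> 12" using le mult_le_mono2 le_trans by blast
    then show False using c[OF u0] big by simp
  qed
  then have "card (verts G) = 12" using le c[OF u0] big three by (auto elim!: dvdE)
  have "\<exists>u'\<in>verts G - {u}. cn u u' = 2 \<and> (\<forall>v\<in>verts G - {u, u'}. cn u v = 1)" if u: "u \<in> verts G" for u
  proof -
    have "(\<Sum>v\<in>verts G - {u}. cn u v) = (\<Sum>v\<in>verts G - {u}. (cn u v - 1) + 1)"
      using ge[OF u] \<open>l = 1\<close> by (intro sum.cong) fastforce+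
    also have "\<dots> = (\<Sum>v\<in>verts G - {u}. cn u v - 1) + card (verts G - {u})"
      by (simp only: sum.distrib sum_constant) simp
    finally have "(\<Sum>v\<in>verts G - {u}. cn u v - 1) = 1" using sum[OF u] c[OF u] \<open>card (verts G) = 12\<close> by simp
    then obtain u' where u': "u' \<in> verts G - {u}" "cn u u' - 1 = 1" "\<forall>v\<in>verts G - {u}. u' \<noteq> v \<longrightarrow> cn u v - 1 = 0"
      using fin by (subst (asm) sum_eq_1_iff) auto
    have "cn u v = 1" if "v \<in> verts G - {u, u'}" for v
      using u'(3) that ge[OF u, of v] \<open>l = 1\<close> by force
    then show ?thesis using u' by (intro bexI[of _ u']) auto
  qed
  then have "card (verts G) \<le> 8" by (rule deza_unique_mate)
  then show False using big by simp
qed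

end

section \<open>Reconstructing the root of a line graph\<close>

text \<open>The triangles are numbered by \<open>t\<close> so that the root graph gets natural
  numbers as vertices.\<close>

locale triangle_decomposed = quartic +
  assumes cn_le: "u \<noteq> v \<Longrightarrow> cn u v \<le> 1" and cn_adjacent: "v \<in> N u \<Longrightarrow> cn u v = 1"
  fixes n :: nat and t :: "nat \<Rightarrow> 'a set"
  assumes t: "bij_betw t {..<n} (triangles G)"
begin

text \<open>For a vertex \<open>x\<close> these are the two triangles through it, that is, the root
  edge represented by \<open>x\<close>.\<close>

definition \<tau> :: "'a \<Rightarrow> nat set" where
  "\<tau> x = {i \<in> {..<n}. x \<in> t i}"

definition root :: "nat graph" where
  "root = \<lparr>verts = {..<n}, edges = \<tau> ` verts G\<rparr>"

lemma t_triangle: "i < n \<Longrightarrow> t i \<in> triangles G"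
  using t by (auto simp: bij_betw_def)

lemma t_inj: "i < n \<Longrightarrow> j < n \<Longrightarrow> t i = t j \<Longrightarrow> i = j"
  using t by (auto simp: bij_betw_def inj_on_def)

lemma t_surj: "T \<in> triangles G \<Longrightarrow> \<exists>i<n. T = t i"
  using t by (auto simp: bij_betw_def image_iff)

lemma card_t: "i < n \<Longrightarrow> card (t i) = 3" "i < n \<Longrightarrow> t i \<subseteq> verts G"
  using t_triangle by (auto simp: triangles_def)

lemma finite_t: "i < n \<Longrightarrow> finite (t i)"
  using card_t(1) by (simp add: card_ge_0_finite)

lemma triangle_adjacent: "T \<in> triangles G \<Longrightarrow> x \<in> T \<Longrightarrow> y \<in> T \<Longrightarrow> x \<noteq> y \<Longrightarrow> y \<in> N x"
  using neighbours_edge[OF simple] by (auto simp: triangles_def)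

lemma card_triangles_adjacent: "y \<in> N x \<Longrightarrow> card {T \<in> triangles G. {x, y} \<subseteq> T} = 1"
  using triangles_on_edge[OF simple] neighbours_edge[OF simple] cn_adjacent by (metis cn_def)

lemma triangle_eqI:
  assumes "T \<in> triangles G" "T' \<in> triangles G" "{x, y} \<subseteq> T" "{x, y} \<subseteq> T'" "x \<noteq> y"
  shows "T = T'"
proof -
  have "card {T \<in> triangles G. {x, y} \<subseteq> T} = 1"
    using assms triangle_adjacent by (intro card_triangles_adjacent) auto
  then obtain S where "{T \<in> triangles G. {x, y} \<subseteq> T} = {S}" by (meson card_1_singletonE)
  then have "T = S" "T' = S" using assms by blast+
  then show ?thesis by simp
qed

lemma adjacent_common_triangle: "y \<in> N x \<Longrightarrow> \<exists>i<n. {x, y} \<subseteq> t i"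
proof -
  assume "y \<in> N x"
  then obtain S where "{T \<in> triangles G. {x, y} \<subseteq> T} = {S}"
    using card_triangles_adjacent by (meson card_1_singletonE)
  then show ?thesis using t_surj[of S] by blast
qed

text \<open>Each of the four edges at \<open>x\<close> lies in one triangle, and each triangle at
  \<open>x\<close> uses two of them.\<close>

lemma card_triangles_at:
  assumes x: "x \<in> verts G"
  shows "card {T \<in> triangles G. x \<in> T} = 2"
proof -
  have "(\<Sum>y\<in>N x. card {T \<in> {T \<in> triangles G. x \<in> T}. y \<in> T}) = 2 * card {T \<in> triangles G. x \<in> T}"
  proof (rule sum_multicount[OF finite_N], use finite_triangles[OF simple] in simp, rule ballI)
    fix T assume T: "T \<in> {T \<in> triangles G. x \<in> T}"
    then have "{y \<in> N x. y \<in> T} = T - {x}"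
      using triangle_adjacent[of T x] N_irrefl by blast
    then show "card {y \<in> N x. y \<in> T} = 2" using T by (simp add: triangles_def)
  qed
  moreover have "card {T \<in> {T \<in> triangles G. x \<in> T}. y \<in> T} = 1" if "y \<in> N x" for y
  proof -
    have "{T \<in> {T \<in> triangles G. x \<in> T}. y \<in> T} = {T \<in> triangles G. {x, y} \<subseteq> T}" by auto
    then show ?thesis using card_triangles_adjacent[OF that] by simp
  qed
  ultimately show ?thesis using card_N[OF x] by simp
qed

lemma card_\<tau>: "x \<in> verts G \<Longrightarrow> card (\<tau> x) = 2"
proof -
  assume x: "x \<in> verts G"
  have "t ` \<tau> x = {T \<in> triangles G. x \<in> T}"
    using t_triangle t_surj by (auto simp: \<tau>_def)
  moreover have "inj_on t (\<tau> x)" using t_inj by (auto simp: inj_on_def \<tau>_def)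
  ultimately show ?thesis using card_triangles_at[OF x] by (metis card_image)
qed

lemma mem_\<tau>: "i \<in> \<tau> x \<longleftrightarrow> i < n \<and> x \<in> t i"
  by (simp add: \<tau>_def)

lemma \<tau>_other:
  assumes "x \<in> verts G" "i \<in> \<tau> x"
  obtains j where "\<tau> x = {i, j}" "i \<noteq> j"
proof -
  obtain a b where "\<tau> x = {a, b}" "a \<noteq> b" using card_\<tau>[OF assms(1)] by (meson card_2_iff)
  then show ?thesis using assms(2) that by (metis insertE insert_commute singletonD)
qed

lemma \<tau>_common_unique: "i \<in> \<tau> x \<Longrightarrow> i \<in> \<tau> y \<Longrightarrow> j \<in> \<tau> x \<Longrightarrow> j \<in> \<tau> y \<Longrightarrow> x \<noteq> y \<Longrightarrow> i = j"
  using triangle_eqI[of "t i" "t j" x y] t_triangle t_inj by (simp add: mem_\<tau>)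

lemma \<tau>_inj: "inj_on \<tau> (verts G)"
proof (rule inj_onI, rule ccontr)
  fix x y assume xy: "x \<in> verts G" "y \<in> verts G" "\<tau> x = \<tau> y" "x \<noteq> y"
  obtain i j where ij: "\<tau> x = {i, j}" "i \<noteq> j" using card_\<tau>[OF xy(1)] by (meson card_2_iff)
  then have "i \<in> \<tau> x" "j \<in> \<tau> x" by auto
  moreover from this have "i \<in> \<tau> y" "j \<in> \<tau> y" using xy(3) by simp_all
  ultimately have "i = j" by (intro \<tau>_common_unique[of i x y j] xy(4))
  then show False using ij(2) by simp
qed

lemma \<tau>_Int:
  assumes "x \<noteq> y"
  shows "\<tau> x \<inter> \<tau> y \<noteq> {} \<longleftrightarrow> y \<in> N x"
proof
  assume "\<tau> x \<inter> \<tau> y \<noteq> {}"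
  then obtain i where "i < n" "x \<in> t i" "y \<in> t i" by (auto simp: mem_\<tau>)
  then show "y \<in> N x" using triangle_adjacent[OF t_triangle _ _ assms] by blast
next
  assume "y \<in> N x"
  then obtain i where "i < n" "{x, y} \<subseteq> t i" using adjacent_common_triangle by blast
  then have "i \<in> \<tau> x \<inter> \<tau> y" by (auto simp: mem_\<tau>)
  then show "\<tau> x \<inter> \<tau> y \<noteq> {}" by blast
qed

lemma root_simple: "simple_graph root"
  using card_\<tau> by (auto simp: simple_graph_def root_def mem_\<tau>)

lemma root_incident: "i < n \<Longrightarrow> {e \<in> edges root. i \<in> e} = \<tau> ` t i"
  using card_t(2) by (auto simp: root_def mem_\<tau>)

lemma root_regular: "regular 3 root"
  unfolding regular_def
proof
  fix i assume "i \<in> verts root"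
  then have i: "i < n" by (simp add: root_def)
  have "inj_on \<tau> (t i)" using \<tau>_inj card_t(2)[OF i] by (rule inj_on_subset)
  then have "card {e \<in> edges root. i \<in> e} = 3"
    unfolding root_incident[OF i] using card_t(1)[OF i] by (simp add: card_image)
  then show "card (neighbours root i) = 3" using card_incident_edges[OF root_simple] by simp
qed

lemma iso_line_graph_root: "graph_iso G (line_graph root)"
  unfolding graph_iso_def
proof (intro exI[of _ \<tau>] conjI ballI)
  show "bij_betw \<tau> (verts G) (verts (line_graph root))"
    using \<tau>_inj by (simp add: line_graph_def root_def bij_betw_def)
  fix u v assume uv: "u \<in> verts G" "v \<in> verts G"
  show "{u, v} \<in> edges G \<longleftrightarrow> {\<tau> u, \<tau> v} \<in> edges (line_graph root)"
  proof (cases "u = v")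
    case True
    then show ?thesis using simple_graphD(4)[OF simple, of "{u, v}"]
      by (auto simp: line_graph_def doubleton_eq_iff)
  next
    case False
    then have "\<tau> u \<noteq> \<tau> v" using \<tau>_inj uv by (auto simp: inj_on_def)
    then have "{\<tau> u, \<tau> v} \<in> edges (line_graph root) \<longleftrightarrow> \<tau> u \<inter> \<tau> v \<noteq> {}"
      using uv by (auto simp: line_graph_def doubleton_eq_iff root_def)
    then show ?thesis using \<tau>_Int[OF False] neighbours_edge[OF simple] by simp
  qed
qed

lemma root_edgeE:
  assumes "{i, j} \<in> edges root"
  obtains x where "x \<in> verts G" "\<tau> x = {i, j}" "i < n" "j < n" "x \<in> t i" "x \<in> t j"
proof -
  obtain x where x: "x \<in> verts G" "\<tau> x = {i, j}" using assms by (auto simp: root_def)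
  then have "i \<in> \<tau> x" "j \<in> \<tau> x" by auto
  then have "i < n" "x \<in> t i" "j < n" "x \<in> t j" using mem_\<tau> by blast+
  then show ?thesis using x that by blast
qed

text \<open>A 3-cycle of the root gives three pairwise adjacent vertices of \<open>G\<close>; their
  triangle shares an edge with two distinct triangles of the cycle, so it would equal both. A
  4-cycle gives two vertices of \<open>G\<close> with two common neighbours.\<close>

lemma root_cycle_length:
  assumes p: "is_cycle root p"
  shows "length p \<ge> 5"
proof (rule ccontr)
  assume "\<not> ?thesis"
  then consider "length p = 3" | "length p = 4" using p unfolding is_cycle_def by linarith
  then show False
  proof cases
    case 1
    then obtain i j k where ijk: "p = [i, j, k]" by (auto simp: numeral_3_eq_3 length_Suc_conv)
    then have d: "i \<noteq> j" "j \<noteq> k" "i \<noteq> k" and e: "{i, j} \<in> edges root" "{j, k} \<in> edges root" "{i, k} \<in> edges root"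
      using p by (auto simp: is_cycle_def cycle_edges_3)
    obtain x where x: "x \<in> verts G" "\<tau> x = {i, j}" "i < n" "j < n" "x \<in> t i" "x \<in> t j" using root_edgeE[OF e(1)] by metis
    obtain y where y: "y \<in> verts G" "\<tau> y = {j, k}" "k < n" "y \<in> t j" "y \<in> t k" using root_edgeE[OF e(2)] by metis
    obtain z where z: "z \<in> verts G" "\<tau> z = {i, k}" "z \<in> t i" "z \<in> t k" using root_edgeE[OF e(3)] by metis
    have n: "x \<noteq> y" "y \<noteq> z" "x \<noteq> z" using x y z d by (auto simp: doubleton_eq_iff)
    have "{x, y} \<in> edges G" "{y, z} \<in> edges G" "{x, z} \<in> edges G"
      using n x y z t_triangle by (auto simp: triangles_def)
    then have T: "{x, y, z} \<in> triangles G" by (rule trianglesI[OF simple])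
    have "{x, y, z} = t j" using triangle_eqI[OF T t_triangle[OF x(4)], of x y] x y n by auto
    moreover have "{x, y, z} = t k" using triangle_eqI[OF T t_triangle[OF y(3)], of y z] y z n by auto
    ultimately show False using t_inj x y d by metis
  next
    case 2
    then obtain i j k l where ijkl: "p = [i, j, k, l]"
      by (auto simp: numeral_eq_Suc length_Suc_conv)
    have in_p: "{p ! m, p ! (Suc m mod 4)} \<in> edges root" if "m < 4" for m
      using p that 2 by (auto simp: is_cycle_def cycle_edges_def)
    have d: "i \<noteq> j" "j \<noteq> k" "i \<noteq> k" "l \<noteq> i" "l \<noteq> j" "l \<noteq> k" using p ijkl by (auto simp: is_cycle_def)
    have e: "{i, j} \<in> edges root" "{j, k} \<in> edges root" "{k, l} \<in> edges root" "{l, i} \<in> edges root"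
      using in_p[of 0] in_p[of 1] in_p[of 2] in_p[of 3] unfolding ijkl by simp_all
    obtain x where x: "x \<in> verts G" "\<tau> x = {i, j}" using root_edgeE[OF e(1)] by metis
    obtain y where y: "y \<in> verts G" "\<tau> y = {j, k}" using root_edgeE[OF e(2)] by metis
    obtain z where z: "z \<in> verts G" "\<tau> z = {k, l}" using root_edgeE[OF e(3)] by metis
    obtain w where w: "w \<in> verts G" "\<tau> w = {l, i}" using root_edgeE[OF e(4)] by metis
    have n: "x \<noteq> y" "y \<noteq> z" "x \<noteq> z" "x \<noteq> w" "z \<noteq> w" "y \<noteq> w" using x y z w d by (auto simp: doubleton_eq_iff)
    have "y \<in> N x" "w \<in> N x" "y \<in> N z" "w \<in> N z"
      using n x y z w \<tau>_Int[of x y] \<tau>_Int[of x w] \<tau>_Int[of z y] \<tau>_Int[of z w] by auto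
    then have "cn x z \<ge> 2" using n by (intro cn_two[of y x z w])
    then show False using cn_le[OF n(3)] by simp
  qed
qed

lemma girth_root:
  assumes "\<exists>p. is_cycle root p \<and> length p \<le> 5"
  shows "girth root = 5"
proof (rule antisym)
  obtain p where p: "is_cycle root p" "length p \<le> 5" using assms by blast
  have "girth root \<le> enat (length p)" unfolding girth_def using p by (intro INF_lower) auto
  also have "\<dots> \<le> 5" using p by (metis enat_ord_simps(1) numeral_eq_enat)
  finally show "girth root \<le> 5" .
  show "5 \<le> girth root" unfolding girth_def
    using root_cycle_length by (intro INF_greatest) (metis enat_ord_simps(1) mem_Collect_eq numeral_eq_enat)
qed

text \<open>An edge cut of the root graph is a vertex cut of \<open>G\<close>.\<close>

lemma no_small_root_cut:
  assumes vc: "vertex_connected 3 G"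
    and AB: "A \<union> B = {..<n}" "A \<inter> B = {}" "A \<noteq> {}" "B \<noteq> {}"
  shows "card {x \<in> verts G. \<tau> x \<inter> A \<noteq> {} \<and> \<tau> x \<inter> B \<noteq> {}} \<ge> 3"
proof (rule ccontr)
  define S where "S = {x \<in> verts G. \<tau> x \<inter> A \<noteq> {} \<and> \<tau> x \<inter> B \<noteq> {}}"
  assume "\<not> ?thesis"
  then have small: "card S < 3" by (simp add: S_def)
  have "S \<subseteq> verts G" by (auto simp: S_def)
  then have finS: "finite S" using simple_graphD(1)[OF simple] finite_subset by blast
  have conn: "connected_graph (delete_verts G S)"
    using vc small \<open>S \<subseteq> verts G\<close> by (simp add: vertex_connected_def)
  \<comment> \<open>A triangle has three vertices and \<open>S\<close> at most two, so a vertex of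
    \<open>G\<close> survives in every triangle, hence on both sides of the cut.\<close>
  have free: "\<exists>x\<in>t i. x \<in> verts G \<and> x \<notin> S" if "i < n" for i
  proof -
    have "\<not> t i \<subseteq> S" using card_mono[OF finS, of "t i"] card_t(1)[OF that] small by linarith
    then show ?thesis using card_t(2)[OF that] by blast
  qed
  have side: "\<tau> x \<subseteq> A" if "x \<in> verts G" "x \<notin> S" "i \<in> A" "i \<in> \<tau> x" for x i
  proof -
    have "\<tau> x \<inter> B = {}" using that by (auto simp: S_def)
    moreover have "\<tau> x \<subseteq> A \<union> B" unfolding AB(1) by (auto simp: \<tau>_def)
    ultimately show ?thesis by blast
  qed
  obtain i where i: "i \<in> A" "i < n" using AB by blast
  obtain x where x: "x \<in> t i" "x \<in> verts G" "x \<notin> S" using free[OF i(2)] by blast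
  have "verts (delete_verts G S) \<subseteq> {x \<in> verts G. x \<notin> S \<and> \<tau> x \<subseteq> A}"
  proof (rule connected_graph_closed_set[OF conn, of x])
    show "x \<in> {x \<in> verts G. x \<notin> S \<and> \<tau> x \<subseteq> A}" using x i side by (simp add: mem_\<tau>)
    show "x \<in> verts (delete_verts G S)" using x by (simp add: delete_verts_def)
    fix y z assume y: "y \<in> {x \<in> verts G. x \<notin> S \<and> \<tau> x \<subseteq> A}" and e: "{y, z} \<in> edges (delete_verts G S)"
    have e': "{y, z} \<in> edges G" "z \<notin> S" using e by (auto simp: delete_verts_def)
    have zN: "z \<in> N y" using e' neighbours_edge[OF simple] by blast
    then obtain j where "j < n" "{y, z} \<subseteq> t j" using adjacent_common_triangle by blast
    then have "j \<in> \<tau> y" "j \<in> \<tau> z" by (auto simp: mem_\<tau>)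
    then have "\<tau> z \<subseteq> A" using side[of z j] y e'(2) N_verts(1)[OF zN] by blast
    then show "z \<in> {x \<in> verts G. x \<notin> S \<and> \<tau> x \<subseteq> A}" using e'(2) N_verts(1)[OF zN] by blast
  qed
  then have all: "\<tau> y \<subseteq> A" if "y \<in> verts G" "y \<notin> S" for y
    using that by (auto simp: delete_verts_def)
  obtain k where k: "k \<in> B" "k < n" using AB by blast
  obtain y where y: "y \<in> t k" "y \<in> verts G" "y \<notin> S" using free[OF k(2)] by blast
  then have "k \<in> \<tau> y" using k by (simp add: mem_\<tau>)
  then show False using all[OF y(2,3)] k AB by blast
qed

text \<open>Suppose at most two root vertices \<open>X\<close> separate \<open>A\<close> from
  \<open>B\<close>. Distributing \<open>X\<close> over the two sides turns this into edge cuts,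
  which have at least three edges by \<open>no_small_root_cut\<close>. Since only three edges meet
  at a vertex of \<open>X\<close>, some distribution cuts too few.\<close>

lemma root_vertex_connected:
  assumes vc: "vertex_connected 3 G" and n: "n > 3"
  shows "vertex_connected 3 root"
  unfolding vertex_connected_def
proof (intro conjI allI impI)
  show "3 < card (verts root)" using n by (simp add: root_def)
  fix X assume X: "X \<subseteq> verts root" "card X < 3"
  then have Xn: "X \<subseteq> {..<n}" by (simp add: root_def)
  then have finX: "finite X" using finite_subset by blast
  have vX: "verts (delete_verts root X) = {..<n} - X" by (simp add: delete_verts_def root_def)
  show "connected_graph (delete_verts root X)"
  proof (rule connected_graphI)
    have "\<not> {..<n} \<subseteq> X" using card_mono[OF finX, of "{..<n}"] X n by auto
    then show "verts (delete_verts root X) \<noteq> {}" unfolding vX by blast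
    fix A assume "A \<subseteq> verts (delete_verts root X)" and A0: "A \<noteq> {}"
      and cl: "\<And>i j. i \<in> A \<Longrightarrow> j \<in> verts (delete_verts root X) \<Longrightarrow> {i, j} \<in> edges (delete_verts root X) \<Longrightarrow> j \<in> A"
    then have An: "A \<subseteq> {..<n} - X" unfolding vX by blast
    show "verts (delete_verts root X) \<subseteq> A"
    proof (rule ccontr)
      define B where "B = {..<n} - X - A"
      assume "\<not> ?thesis"
      then have B0: "B \<noteq> {}" unfolding vX B_def by blast
      have sep: False if "x \<in> verts G" "i \<in> A" "j \<in> B" "i \<in> \<tau> x" "j \<in> \<tau> x" for x i j
      proof -
        have "i \<noteq> j" using that by (auto simp: B_def)
        then have "\<tau> x = {i, j}" using \<tau>_other[OF that(1,4)] that(5) by (metis insertE singletonD)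
        then have "{i, j} \<in> edges root" using that(1) by (auto simp: root_def)
        moreover have "{i, j} \<inter> X = {}" using that An by (auto simp: B_def)
        ultimately have "j \<in> A"
          using cl[of i j] that by (auto simp: delete_verts_def root_def B_def)
        then show False using that by (auto simp: B_def)
      qed
      \<comment> \<open>The vertices of \<open>t i\<close> that represent root edges from
        \<open>i\<close> into \<open>A\<close>; \<open>b\<close> does the same for
        \<open>B\<close>.\<close>
      define a where "a i = {x \<in> t i. \<tau> x \<inter> A \<noteq> {}}" for i
      define b where "b i = {x \<in> t i. \<tau> x \<inter> B \<noteq> {}}" for i
      have fin: "finite (a i)" "finite (b i)" if "i \<in> X" for i
        using finite_t[of i] that Xn by (auto simp: a_def b_def)
      have ab: "a i \<inter> b i = {}" "a i \<union> b i \<subseteq> t i" if "i \<in> X" for i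
      proof -
        have "i < n" using that Xn by blast
        then show "a i \<inter> b i = {}" using sep card_t(2)[of i] by (fastforce simp: a_def b_def)
      qed (auto simp: a_def b_def)
      \<comment> \<open>The part \<open>Y\<close> of \<open>X\<close> joins the side of
        \<open>A\<close>, the rest joins that of \<open>B\<close>.\<close>
      have cut: "card {x \<in> verts G. \<tau> x \<inter> (A \<union> Y) \<noteq> {} \<and> \<tau> x \<inter> (B \<union> (X - Y)) \<noteq> {}} \<ge> 3" if "Y \<subseteq> X" for Y
        using that An B_def A0 B0 Xn by (intro no_small_root_cut[OF vc]) auto
      \<comment> \<open>When no root edge runs between \<open>Y\<close> and \<open>X - Y\<close>,
        the crossing edges run from \<open>Y\<close> to \<open>B\<close> or from
        \<open>X - Y\<close> to \<open>A\<close>.\<close>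
      have cut_sub: "{x \<in> verts G. \<tau> x \<inter> (A \<union> Y) \<noteq> {} \<and> \<tau> x \<inter> (B \<union> (X - Y)) \<noteq> {}} \<subseteq> (\<Union>i\<in>X. if i \<in> Y then b i else a i)"
        if "Y \<subseteq> X" and nox: "\<And>x. x \<in> verts G \<Longrightarrow> \<tau> x \<subseteq> X \<Longrightarrow> \<tau> x \<subseteq> Y \<or> \<tau> x \<inter> Y = {}" for Y
      proof
        fix x assume "x \<in> {x \<in> verts G. \<tau> x \<inter> (A \<union> Y) \<noteq> {} \<and> \<tau> x \<inter> (B \<union> (X - Y)) \<noteq> {}}"
        then obtain i j where x: "x \<in> verts G" and i: "i \<in> \<tau> x" "i \<in> A \<union> Y" and j: "j \<in> \<tau> x" "j \<in> B \<union> (X - Y)" by blast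
        have disj: "A \<inter> B = {}" "A \<inter> X = {}" "B \<inter> X = {}" using An by (auto simp: B_def)
        have "i \<noteq> j" using i j disj that(1) by blast
        then have tx: "\<tau> x = {i, j}" using \<tau>_other[OF x i(1)] j by (metis insertE singletonD)
        have ti: "x \<in> t i" "x \<in> t j" using i j by (auto simp: mem_\<tau>)
        consider "i \<in> A" "j \<in> B" | "i \<in> A" "j \<in> X - Y" | "i \<in> Y" "j \<in> B" | "i \<in> Y" "j \<in> X - Y" using i j by blast
        then show "x \<in> (\<Union>i\<in>X. if i \<in> Y then b i else a i)"
        proof cases
          case 1
          then show ?thesis using sep x i j by blast
        next
          case 2
          then have "x \<in> a j" using tx ti by (auto simp: a_def)
          then show ?thesis using 2 by (intro UN_I[of j]) auto
        next
          case 3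
          then have "x \<in> b i" using tx ti by (auto simp: b_def)
          then show ?thesis using 3 that(1) by (intro UN_I[of i]) auto
        next
          case 4
          then show ?thesis using nox[OF x] tx that(1) by auto
        qed
      qed
      have bound: "3 \<le> (\<Sum>i\<in>X. card (if i \<in> Y then b i else a i))"
        if Y: "Y \<subseteq> X" and nox: "\<And>x. x \<in> verts G \<Longrightarrow> \<tau> x \<subseteq> X \<Longrightarrow> \<tau> x \<subseteq> Y \<or> \<tau> x \<inter> Y = {}" for Y
      proof -
        have "finite (\<Union>i\<in>X. if i \<in> Y then b i else a i)" using finX fin by auto
        then have "3 \<le> card (\<Union>i\<in>X. if i \<in> Y then b i else a i)"
          using cut[OF Y] card_mono cut_sub[OF Y nox] le_trans by meson
        also have "\<dots> \<le> (\<Sum>i\<in>X. card (if i \<in> Y then b i else a i))" by (rule card_UN_le[OF finX])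
        finally show ?thesis .
      qed
      have sum3: "card (a i) + card (b i) \<le> card (t i - {x. \<tau> x \<subseteq> X})" if "i \<in> X" for i
      proof -
        have "a i \<union> b i \<subseteq> t i - {x. \<tau> x \<subseteq> X}"
          using ab(2)[OF that] An by (auto simp: a_def b_def B_def)
        moreover have "finite (t i)" using finite_t that Xn by blast
        ultimately have "card (a i \<union> b i) \<le> card (t i - {x. \<tau> x \<subseteq> X})" by (intro card_mono) auto
        then show ?thesis using card_Un_disjoint[OF fin[OF that] ab(1)[OF that]] by simp
      qed
      show False
      proof (cases "\<exists>x\<in>verts G. \<tau> x \<subseteq> X")
        case False
        \<comment> \<open>No edge lies inside \<open>X\<close>, so every vertex of \<open>X\<close>
          can be put on the side that leaves at most one of its three edges crossing. The cut then
          has at most two edges.\<close>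
        define Y where "Y = {i \<in> X. card (b i) \<le> 1}"
        have "card (if i \<in> Y then b i else a i) \<le> 1" if "i \<in> X" for i
        proof -
          have "card (t i - {x. \<tau> x \<subseteq> X}) \<le> 3"
            using card_mono[of "t i" "t i - {x. \<tau> x \<subseteq> X}"] finite_t[of i] card_t(1)[of i] that Xn by auto
          then show ?thesis using sum3[OF that] that by (auto simp: Y_def)
        qed
        then have "(\<Sum>i\<in>X. card (if i \<in> Y then b i else a i)) \<le> (\<Sum>i\<in>X. 1)" by (intro sum_mono)
        moreover have "3 \<le> (\<Sum>i\<in>X. card (if i \<in> Y then b i else a i))"
          using False by (intro bound) (auto simp: Y_def)
        ultimately show False using X by simp
      next
        case True
        then obtain x where x: "x \<in> verts G" "\<tau> x \<subseteq> X" by blast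
        \<comment> \<open>Now \<open>X\<close> consists of the ends of one edge, so at most four
          edges leave it. But moving \<open>X\<close> entirely to one side or to the other requires
          three edges into \<open>A\<close> and three into \<open>B\<close>.\<close>
        have "card (a i) + card (b i) \<le> 2" if "i \<in> X" for i
        proof -
          have "\<tau> x = X" using card_seteq[OF finX x(2)] card_\<tau>[OF x(1)] X(2) by simp
          then have "i \<in> \<tau> x" using that by simp
          then have "x \<in> t i" using mem_\<tau> by blast
          then have "card (t i - {x}) = 2" using card_t(1)[of i] that Xn by auto
          moreover have "card (t i - {x. \<tau> x \<subseteq> X}) \<le> card (t i - {x})"
            using x finite_t[of i] that Xn by (intro card_mono) auto
          ultimately show ?thesis using sum3[OF that] by simp
        qed
        then have "(\<Sum>i\<in>X. card (a i) + card (b i)) \<le> (\<Sum>i\<in>X. 2)" by (intro sum_mono)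
        then have "(\<Sum>i\<in>X. card (a i)) + (\<Sum>i\<in>X. card (b i)) \<le> 4" using X by (simp add: sum.distrib)
        moreover have "3 \<le> (\<Sum>i\<in>X. card (a i))" using bound[of "{}"] by simp
        moreover have "3 \<le> (\<Sum>i\<in>X. card (b i))" using bound[of X] by simp
        ultimately show False by simp
      qed
    qed
  qed
qed

end

section \<open>Tripods inside triangular regions\<close>

text \<open>Accessible frontier points are dense, so an arc \<open>\<gamma>\<close> crosses
  \<open>F\<close> from \<open>U1\<close> to \<open>U2\<close>, and an arc \<open>\<beta>\<close>
  runs from its middle to \<open>U3\<close>. The last point of \<open>\<beta>\<close> on
  \<open>\<gamma>\<close> is the centre; the two parts of \<open>\<gamma>\<close> and the tail of
  \<open>\<beta>\<close> are the legs.\<close>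

lemma tripod_in_open_set:
  fixes F :: "complex set"
  assumes F: "open F" "connected F"
    and U: "openin (top_of_set (frontier F)) U1" "openin (top_of_set (frontier F)) U2" "openin (top_of_set (frontier F)) U3"
    and ne: "U1 \<noteq> {}" "U2 \<noteq> {}" "U3 \<noteq> {}" and disj: "U1 \<inter> U2 = {}" "U1 \<inter> U3 = {}" "U2 \<inter> U3 = {}"
  obtains c a1 a2 a3 where "c \<in> F" "arc a1" "arc a2" "arc a3"
    "pathstart a1 = c" "pathstart a2 = c" "pathstart a3 = c"
    "pathfinish a1 \<in> U1" "pathfinish a2 \<in> U2" "pathfinish a3 \<in> U3"
    "path_image a1 - {pathfinish a1} \<subseteq> F" "path_image a2 - {pathfinish a2} \<subseteq> F" "path_image a3 - {pathfinish a3} \<subseteq> F"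
    "path_image a1 \<inter> path_image a2 = {c}" "path_image a1 \<inter> path_image a3 = {c}" "path_image a2 \<inter> path_image a3 = {c}"
proof -
  have "U1 \<noteq> U2" using disj ne by blast
  then obtain \<gamma> where \<gamma>: "arc \<gamma>" "pathstart \<gamma> \<in> U1" "pathfinish \<gamma> \<in> U2" "\<gamma> ` {0<..<1} \<subseteq> F"
    using dense_accessible_frontier_point_pairs[OF F U(1,2) ne(1,2)] by metis
  have "\<gamma> (1/2) \<in> F" using \<gamma>(4) by auto
  then obtain \<beta> where \<beta>: "arc \<beta>" "\<beta> ` {0..<1} \<subseteq> F" "pathstart \<beta> = \<gamma> (1/2)" "pathfinish \<beta> \<in> U3"
    using dense_accessible_frontier_points_connected[OF F _ ne(3) U(3)] by metis
  have Ufr: "U1 \<subseteq> frontier F" "U2 \<subseteq> frontier F" "U3 \<subseteq> frontier F"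
    using U openin_imp_subset by blast+
  have FF: "F \<inter> frontier F = {}" using F(1) by (simp add: frontier_def interior_open)
  have \<gamma>inj: "inj_on \<gamma> {0..1}" and \<beta>inj: "inj_on \<beta> {0..1}" using \<gamma> \<beta> by (auto simp: arc_def)
  have \<beta>cont: "continuous_on {0..1} \<beta>" using \<beta> by (auto simp: arc_def path_def)
  define C where "C = {s \<in> {0..1}. \<beta> s \<in> path_image \<gamma>}"
  have "C = {0..1} \<inter> \<beta> -` path_image \<gamma>" by (auto simp: C_def)
  moreover have "closed (path_image \<gamma>)" using \<gamma>(1) by (simp add: arc_imp_path closed_path_image)
  ultimately have "compact C" using \<beta>cont
    by (metis closed_atLeastAtMost compact_Icc compact_Int_closed continuous_closed_preimage inf.absorb_iff2 inf_le1)
  moreover have "0 \<in> C" using \<beta>(3) by (auto simp: C_def pathstart_def path_image_def)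
  ultimately obtain s where s: "s \<in> C" "\<And>u. u \<in> C \<Longrightarrow> u \<le> s"
    using compact_attains_sup[of C] by blast
  have \<gamma>F: "\<gamma> u \<in> F \<or> u = 0 \<or> u = 1" if "u \<in> {0..1}" for u
    using \<gamma>(4) that by (cases "u = 0 \<or> u = 1") (auto simp: image_subset_iff)
  \<comment> \<open>\<open>\<beta>\<close> ends in \<open>U3\<close>, while \<open>\<gamma>\<close>
    touches the frontier only at its ends in \<open>U1\<close> and \<open>U2\<close>.\<close>
  have "s \<noteq> 1"
  proof
    assume "s = 1"
    then have "pathfinish \<beta> \<in> path_image \<gamma>" using s(1) by (simp add: C_def pathfinish_def)
    then obtain u where "u \<in> {0..1}" "\<gamma> u \<in> U3" using \<beta>(4) by (auto simp: path_image_def)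
    then have "u = 0 \<or> u = 1" using \<gamma>F Ufr(3) FF by blast
    then show False using \<open>\<gamma> u \<in> U3\<close> \<gamma>(2,3) disj by (auto simp: pathstart_def pathfinish_def)
  qed
  then have s1: "s \<in> {0..<1}" using s(1) by (auto simp: C_def)
  define c where "c = \<beta> s"
  have cF: "c \<in> F" using \<beta>(2) s1 by (auto simp: c_def)
  obtain r where r: "r \<in> {0..1}" "c = \<gamma> r" using s(1) by (auto simp: C_def path_image_def c_def)
  have "r \<noteq> 0" "r \<noteq> 1" using r cF \<gamma>(2,3) Ufr FF by (auto simp: pathstart_def pathfinish_def)
  then have r01: "0 < r" "r < 1" using r(1) by auto
  define a1 where "a1 = subpath r 0 \<gamma>"
  define a2 where "a2 = subpath r 1 \<gamma>"
  define a3 where "a3 = subpath s 1 \<beta>"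
  have im: "path_image a1 = \<gamma> ` {0..r}" "path_image a2 = \<gamma> ` {r..1}" "path_image a3 = \<beta> ` {s..1}"
    using r01 s1 by (auto simp: a1_def a2_def a3_def path_image_subpath)
  have st: "pathstart a1 = c" "pathstart a2 = c" "pathstart a3 = c"
    using r(2) by (simp_all add: a1_def a2_def a3_def) (simp add: c_def)
  have fin: "pathfinish a1 = \<gamma> 0" "pathfinish a2 = \<gamma> 1" "pathfinish a3 = \<beta> 1" by (auto simp: a1_def a2_def a3_def)
  have c_in: "c \<in> path_image a1" "c \<in> path_image a2" "c \<in> path_image a3" using st by (metis pathstart_in_path_image)+
  have meet: "\<gamma> u = \<beta> v \<Longrightarrow> u \<in> {0..1} \<Longrightarrow> v \<in> {s..1} \<Longrightarrow> \<beta> v = c" for u v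
  proof -
    assume a: "\<gamma> u = \<beta> v" "u \<in> {0..1}" "v \<in> {s..1}"
    have "\<gamma> u \<in> path_image \<gamma>" using a(2) by (auto simp: path_image_def)
    then have "v \<in> C" using a s1 by (auto simp: C_def)
    then have "v = s" using s(2)[of v] a(3) by auto
    then show ?thesis by (simp add: c_def)
  qed
  have i12: "path_image a1 \<inter> path_image a2 \<subseteq> {c}"
  proof
    fix x assume "x \<in> path_image a1 \<inter> path_image a2"
    then have "x \<in> \<gamma> ` {0..r}" "x \<in> \<gamma> ` {r..1}" unfolding im by blast+
    then obtain u v where "x = \<gamma> u" "x = \<gamma> v" "u \<in> {0..r}" "v \<in> {r..1}" by (elim imageE) metis
    moreover from this have "u = v" using \<gamma>inj r01 by (intro inj_onD[OF \<gamma>inj]) auto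
    ultimately show "x \<in> {c}" using r by auto
  qed
  have i3: "(path_image a1 \<union> path_image a2) \<inter> path_image a3 \<subseteq> {c}"
  proof
    fix x assume x: "x \<in> (path_image a1 \<union> path_image a2) \<inter> path_image a3"
    have "path_image a1 \<union> path_image a2 \<subseteq> \<gamma> ` {0..1}"
      unfolding im using r01 by (intro Un_least image_mono) auto
    then obtain u where u: "u \<in> {0..1}" "x = \<gamma> u" using x by blast
    obtain v where "v \<in> {s..1}" "x = \<beta> v" using x by (auto simp: im)
    then show "x \<in> {c}" using meet[of u v] u by auto
  qed
  show ?thesis
  proof (rule that[of c a1 a2 a3])
    show "arc a1" "arc a2" "arc a3" unfolding a1_def a2_def a3_def
      using \<gamma>(1) \<beta>(1) r01 s1 by (auto intro!: arc_subpath_arc)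
    show "pathfinish a1 \<in> U1" "pathfinish a2 \<in> U2" "pathfinish a3 \<in> U3"
      unfolding fin using \<gamma>(2,3) \<beta>(4) by (simp_all add: pathstart_def pathfinish_def)
    show "path_image a1 - {pathfinish a1} \<subseteq> F"
    proof
      fix x assume "x \<in> path_image a1 - {pathfinish a1}"
      then obtain u where "u \<in> {0..r}" "x = \<gamma> u" "u \<noteq> 0" unfolding im fin by blast
      then show "x \<in> F" using \<gamma>F[of u] r01 by auto
    qed
    show "path_image a2 - {pathfinish a2} \<subseteq> F"
    proof
      fix x assume "x \<in> path_image a2 - {pathfinish a2}"
      then obtain u where "u \<in> {r..1}" "x = \<gamma> u" "u \<noteq> 1" unfolding im fin by blast
      then show "x \<in> F" using \<gamma>F[of u] r01 by auto
    qed
    show "path_image a3 - {pathfinish a3} \<subseteq> F"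
    proof
      fix x assume "x \<in> path_image a3 - {pathfinish a3}"
      then obtain u where "u \<in> {s..1}" "x = \<beta> u" "u \<noteq> 1" unfolding im fin by blast
      then show "x \<in> F" using \<beta>(2) s1 by (auto simp: image_subset_iff)
    qed
  qed (use cF st i12 i3 c_in in blast)+
qed

context plane_graph
begin

text \<open>Prolongs a leg along the side it has hit, from the inner point to the corner
  \<open>v\<close>. The other corner \<open>w\<close> is avoided because the leg of a neighbouring
  side will arrive there.\<close>

lemma tripod_leg:
  assumes e: "{v, w} \<in> edges G" and a: "arc a" "pathfinish a \<in> path_image (crv {v, w}) - pos ` {v, w}"
    "path_image a - {pathfinish a} \<subseteq> F" and F: "F \<inter> drawing = {}"
  obtains g where "arc g" "pathstart g = pathstart a" "pathfinish g = pos v"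
    "path_image g \<subseteq> path_image a \<union> (path_image (crv {v, w}) - {pos w})"
proof -
  have e': "{w, v} \<in> edges G" using e by (simp add: insert_commute)
  obtain h where h: "arc h" "path_image h = path_image (crv {w, v})" "pathstart h = pos w" "pathfinish h = pos v"
    by (rule oriented_arc[OF e'])
  have him: "path_image h = path_image (crv {v, w})" using h(2) by (simp add: insert_commute)
  then have "pathfinish a \<in> path_image h" using a(2) by simp
  then obtain s where s: "s \<in> {0..1}" "pathfinish a = h s" by (auto simp: path_image_def)
  have "s \<noteq> 0" "s \<noteq> 1" using s a(2) h(3,4) by (auto simp: pathstart_def pathfinish_def)
  then have s01: "0 < s" "s < 1" using s by auto
  define b where "b = subpath s 1 h"
  have b: "arc b" "pathstart b = pathfinish a" "pathfinish b = pos v" "path_image b = h ` {s..1}"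
  proof -
    show "arc b" unfolding b_def using h(1) s s01 by (intro arc_subpath_arc) auto
    show "pathstart b = pathfinish a" "path_image b = h ` {s..1}"
      using s s01 by (simp_all add: b_def path_image_subpath)
    have "h 1 = pos v" using h(4) by (simp add: pathfinish_def)
    then show "pathfinish b = pos v" by (simp add: b_def)
  qed
  have bsub: "path_image b \<subseteq> path_image (crv {v, w}) - {pos w}"
  proof -
    have "h u \<noteq> h 0" if "u \<in> {s..1}" for u
      using h(1) that s01 inj_onD[of h "{0..1}" u 0] by (auto simp: arc_def)
    moreover have "pos w = h 0" using h(3) by (simp add: pathstart_def)
    ultimately have "pos w \<notin> path_image b" unfolding b(4) by (metis imageE)
    moreover have "path_image b \<subseteq> path_image h" using b(4) s01 by (auto simp: path_image_def)
    ultimately show ?thesis using him by blast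
  qed
  have "path_image (crv {v, w}) \<subseteq> drawing" using e by (auto simp: draw_def)
  then have "path_image a \<inter> path_image b \<subseteq> {pathstart b}"
    using a(3) F bsub b(2) by auto
  then have "arc (a +++ b)" using a b by (intro arc_join) auto
  moreover have "path_image (a +++ b) = path_image a \<union> path_image b" using b by (simp add: path_image_join)
  ultimately show ?thesis using that[of "a +++ b"] b bsub by auto
qed

text \<open>
  The corners of the triangle need not be known to be accessible from \<open>F\<close>. Each leg therefore hits a
  side in an accessible inner point and follows that side to a corner; turning the same way at all
  three sides keeps the legs disjoint.
\<close>

lemma triangle_tripod:
  assumes T: "T \<in> triangles G" and F: "F \<in> regions" "frontier F = curve T"
  shows "\<exists>c g. c \<in> F \<and> (\<forall>x\<in>T. arc (g x) \<and> pathstart (g x) = c \<and> pathfinish (g x) = pos x \<and>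
      path_image (g x) \<subseteq> F \<union> curve T \<and> path_image (g x) \<inter> pos ` verts G = {pos x}) \<and>
    (\<forall>x\<in>T. \<forall>y\<in>T. x \<noteq> y \<longrightarrow> path_image (g x) \<inter> path_image (g y) = {c})"
proof -
  obtain x y z where xyz: "T = {x, y, z}" and d: "x \<noteq> y" "y \<noteq> z" "x \<noteq> z"
    and e: "{x, y} \<in> edges G" "{y, z} \<in> edges G" "{x, z} \<in> edges G"
    by (rule triangleE[OF T])
  have e3: "{z, x} \<in> edges G" using e(3) by (simp add: insert_commute)
  define P where "P u v = path_image (crv {u, v})" for u v
  have C: "curve T = P x y \<union> P y z \<union> P z x"
  proof -
    have "curve T = P x y \<union> P y z \<union> P x z"
      using curve_triangle[OF T] triangle_edges[OF simple d e] unfolding xyz P_def by (simp add: Un_assoc)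
    moreover have "P x z = P z x" by (simp add: P_def insert_commute)
    ultimately show ?thesis by simp
  qed
  have n: "{x, y} \<noteq> {y, z}" "{x, y} \<noteq> {z, x}" "{y, z} \<noteq> {z, x}" using d by (auto simp: doubleton_eq_iff)
  have i: "{x, y} \<inter> {y, z} = {y}" "{x, y} \<inter> {z, x} = {x}" "{y, z} \<inter> {z, x} = {z}" using d by auto
  have int: "P x y \<inter> P y z = {pos y}" "P x y \<inter> P z x = {pos x}" "P y z \<inter> P z x = {pos z}"
    using crv_crv[OF e(1,2) n(1)] crv_crv[OF e(1) e3 n(2)] crv_crv[OF e(2) e3 n(3)] unfolding i P_def by simp_all
  have cl: "closed (P x y)" "closed (P y z)" "closed (P z x)"
    unfolding P_def using crv_compact e e3 compact_imp_closed by blast+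
  have ends: "pos x \<in> P x y" "pos y \<in> P x y" "pos y \<in> P y z" "pos z \<in> P y z" "pos z \<in> P z x" "pos x \<in> P z x"
    using crv_verts[OF e(1)] crv_verts[OF e(2)] crv_verts[OF e3] unfolding P_def by blast+
  have FD: "F \<inter> drawing = {}" by (rule region_disjoint[OF F(1)])
  have CD: "curve T \<subseteq> drawing" by (rule curve_subset_drawing[OF T])
  have rel_open: "openin (top_of_set (curve T)) (curve T - K)" if "closed K" for K
    using openin_open_Int[of "- K" "curve T"] that by (simp add: open_Compl Diff_eq)
  define U1 where "U1 = P x y - pos ` {x, y}"
  define U2 where "U2 = P y z - pos ` {y, z}"
  define U3 where "U3 = P z x - pos ` {z, x}"
  have Ueq: "U1 = curve T - (P y z \<union> P z x)" "U2 = curve T - (P x y \<union> P z x)" "U3 = curve T - (P x y \<union> P y z)"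
    unfolding U1_def U2_def U3_def C using int ends by auto
  have Uo: "openin (top_of_set (frontier F)) U1" "openin (top_of_set (frontier F)) U2" "openin (top_of_set (frontier F)) U3"
    unfolding F(2) Ueq using cl by (intro rel_open closed_Un; simp)+
  have Une: "U1 \<noteq> {}" "U2 \<noteq> {}" "U3 \<noteq> {}"
    unfolding U1_def U2_def U3_def P_def
    using arc_image_minus_endpoints_nonempty[OF crv_arc[OF e(1)]] arc_image_minus_endpoints_nonempty[OF crv_arc[OF e(2)]]
      arc_image_minus_endpoints_nonempty[OF crv_arc[OF e3]] crv_ends[OF e(1)] crv_ends[OF e(2)] crv_ends[OF e3] by metis+
  have Ud: "U1 \<inter> U2 = {}" "U1 \<inter> U3 = {}" "U2 \<inter> U3 = {}" unfolding Ueq unfolding C by blast+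
  have "connected F" using F(1) in_components_connected by blast
  from tripod_in_open_set[OF open_region[OF F(1)] this Uo Une Ud]
  obtain c a1 a2 a3 where cF: "c \<in> F" and a: "arc a1" "arc a2" "arc a3"
    and st: "pathstart a1 = c" "pathstart a2 = c" "pathstart a3 = c"
    and fin: "pathfinish a1 \<in> U1" "pathfinish a2 \<in> U2" "pathfinish a3 \<in> U3"
    and aF: "path_image a1 - {pathfinish a1} \<subseteq> F" "path_image a2 - {pathfinish a2} \<subseteq> F" "path_image a3 - {pathfinish a3} \<subseteq> F"
    and ai: "path_image a1 \<inter> path_image a2 = {c}" "path_image a1 \<inter> path_image a3 = {c}" "path_image a2 \<inter> path_image a3 = {c}"
    by metis
  obtain g1 where g1: "arc g1" "pathstart g1 = c" "pathfinish g1 = pos x" "path_image g1 \<subseteq> path_image a1 \<union> (P x y - {pos y})"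
    using tripod_leg[OF e(1) a(1) _ aF(1) FD] fin(1) st(1) unfolding U1_def P_def by metis
  obtain g2 where g2: "arc g2" "pathstart g2 = c" "pathfinish g2 = pos y" "path_image g2 \<subseteq> path_image a2 \<union> (P y z - {pos z})"
    using tripod_leg[OF e(2) a(2) _ aF(2) FD] fin(2) st(2) unfolding U2_def P_def by metis
  obtain g3 where g3: "arc g3" "pathstart g3 = c" "pathfinish g3 = pos z" "path_image g3 \<subseteq> path_image a3 \<union> (P z x - {pos x})"
    using tripod_leg[OF e3 a(3) _ aF(3) FD] fin(3) st(3) unfolding U3_def P_def by metis
  have asub: "path_image a1 \<subseteq> F \<union> U1" "path_image a2 \<subseteq> F \<union> U2" "path_image a3 \<subseteq> F \<union> U3"
    using aF fin by blast+
  have UC: "U1 \<subseteq> curve T" "U2 \<subseteq> curve T" "U3 \<subseteq> curve T" unfolding Ueq by blast+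
  have PC: "P x y \<subseteq> curve T" "P y z \<subseteq> curve T" "P z x \<subseteq> curve T" unfolding C by blast+
  have FC: "F \<inter> curve T = {}" using FD CD by blast
  have leg: "path_image a \<inter> (Q - {q}) = {}" if "path_image a \<subseteq> F \<union> U" "U \<inter> Q = {}" "Q \<subseteq> curve T"
    for a :: "real \<Rightarrow> complex" and Q U q using that FC by blast
  have UP: "U1 \<inter> P y z = {}" "U1 \<inter> P z x = {}" "U2 \<inter> P x y = {}" "U2 \<inter> P z x = {}" "U3 \<inter> P x y = {}" "U3 \<inter> P y z = {}"
    unfolding Ueq by blast+
  \<comment> \<open>Each intersection splits into four pieces: two inner legs meet only in
    \<open>c\<close>, an inner leg misses a foreign side (twice), and two sides share one corner,
    which has been removed from one of them.\<close>
  have cross: "path_image g1 \<inter> path_image g2 \<subseteq> {c}" "path_image g1 \<inter> path_image g3 \<subseteq> {c}" "path_image g2 \<inter> path_image g3 \<subseteq> {c}"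
  proof -
    have "path_image g1 \<inter> path_image g2 \<subseteq> (path_image a1 \<inter> path_image a2) \<union> (path_image a1 \<inter> (P y z - {pos z}))
       \<union> (path_image a2 \<inter> (P x y - {pos y})) \<union> (P x y \<inter> P y z - {pos y})" using g1(4) g2(4) by blast
    then show "path_image g1 \<inter> path_image g2 \<subseteq> {c}"
      unfolding ai leg[OF asub(1) UP(1) PC(2)] leg[OF asub(2) UP(3) PC(1)] int by blast
    have "path_image g1 \<inter> path_image g3 \<subseteq> (path_image a1 \<inter> path_image a3) \<union> (path_image a1 \<inter> (P z x - {pos x}))
       \<union> (path_image a3 \<inter> (P x y - {pos y})) \<union> (P x y \<inter> P z x - {pos x})" using g1(4) g3(4) by blast
    then show "path_image g1 \<inter> path_image g3 \<subseteq> {c}"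
      unfolding ai leg[OF asub(1) UP(2) PC(3)] leg[OF asub(3) UP(5) PC(1)] int by blast
    have "path_image g2 \<inter> path_image g3 \<subseteq> (path_image a2 \<inter> path_image a3) \<union> (path_image a2 \<inter> (P z x - {pos x}))
       \<union> (path_image a3 \<inter> (P y z - {pos z})) \<union> (P y z \<inter> P z x - {pos z})" using g2(4) g3(4) by blast
    then show "path_image g2 \<inter> path_image g3 \<subseteq> {c}"
      unfolding ai leg[OF asub(2) UP(4) PC(3)] leg[OF asub(3) UP(6) PC(2)] int by blast
  qed
  have cin: "c \<in> path_image g1" "c \<in> path_image g2" "c \<in> path_image g3"
    using g1(2) g2(2) g3(2) by (metis pathstart_in_path_image)+
  have vend: "path_image g \<inter> pos ` verts G = {pos v}"
    if "{v, w} \<in> edges G" "pathfinish g = pos v" "path_image g \<subseteq> path_image a \<union> (P v w - {pos w})"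
      "path_image a \<subseteq> F \<union> (P v w - pos ` {v, w})" for g a v w
  proof -
    have Pv: "P v w \<inter> pos ` verts G = {pos v, pos w}" using crv_verts[OF that(1)] by (simp add: P_def)
    have "F \<inter> pos ` verts G = {}" using FD by (auto simp: draw_def)
    moreover have "path_image g \<subseteq> F \<union> (P v w - {pos w})" using that(3,4) by blast
    ultimately have "path_image g \<inter> pos ` verts G \<subseteq> {pos v}" using Pv by blast
    moreover have "pos v \<in> path_image g" using that(2) by (metis pathfinish_in_path_image)
    moreover have "v \<in> verts G" using graph_simps(3)[OF that(1)] by blast
    ultimately show ?thesis by blast
  qed
  define g where "g u = (if u = x then g1 else if u = y then g2 else g3)" for u
  have gs: "g x = g1" "g y = g2" "g z = g3" using d by (auto simp: g_def)
  have sub: "path_image g1 \<subseteq> F \<union> curve T" "path_image g2 \<subseteq> F \<union> curve T" "path_image g3 \<subseteq> F \<union> curve T"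
    using g1(4) g2(4) g3(4) asub UC PC by blast+
  have v: "path_image g1 \<inter> pos ` verts G = {pos x}" "path_image g2 \<inter> pos ` verts G = {pos y}" "path_image g3 \<inter> pos ` verts G = {pos z}"
    using vend[OF e(1) g1(3,4)] vend[OF e(2) g2(3,4)] vend[OF e3 g3(3,4)] asub unfolding U1_def U2_def U3_def by blast+
  have c12: "path_image g1 \<inter> path_image g2 = {c}" "path_image g1 \<inter> path_image g3 = {c}" "path_image g2 \<inter> path_image g3 = {c}"
    using cross cin by blast+
  show ?thesis
  proof (intro exI[of _ c] exI[of _ g] conjI)
    show "\<forall>x\<in>T. arc (g x) \<and> pathstart (g x) = c \<and> pathfinish (g x) = pos x \<and>
      path_image (g x) \<subseteq> F \<union> curve T \<and> path_image (g x) \<inter> pos ` verts G = {pos x}"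
      unfolding xyz using gs g1 g2 g3 sub[unfolded xyz] v by simp
    show "\<forall>x\<in>T. \<forall>y\<in>T. x \<noteq> y \<longrightarrow> path_image (g x) \<inter> path_image (g y) = {c}"
      unfolding xyz using gs c12 by (simp add: Int_commute)
  qed (rule cF)
qed

end

context triangle_decomposed
begin

text \<open>The root edge of a vertex \<open>x\<close> is drawn by joining the two tripod legs that
  end at \<open>pos x\<close>. Legs of different triangles run in disjoint faces and on curves
  without a common edge, so they meet at most in a common end.\<close>

lemma root_planar:
  assumes "plane_graph G pos crv"
    and facial: "\<And>T. T \<in> triangles G \<Longrightarrow> \<exists>F\<in>components (- plane_graph.draw pos crv (verts G) (edges G)). frontier F = plane_graph.curve G pos crv T"
  shows "planar root"
proof -
  interpret P: plane_graph G pos crv by fact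
  have "\<forall>i\<in>{..<n}. \<exists>F. F \<in> P.regions \<and> frontier F = P.curve (t i)" using facial t_triangle by blast
  then obtain F where F: "\<And>i. i < n \<Longrightarrow> F i \<in> P.regions" "\<And>i. i < n \<Longrightarrow> frontier (F i) = P.curve (t i)"
    unfolding bchoice_iff by auto
  define Q where "Q i c g \<longleftrightarrow> c \<in> F i \<and> (\<forall>x\<in>t i. arc (g x) \<and> pathstart (g x) = c \<and> pathfinish (g x) = pos x \<and>
      path_image (g x) \<subseteq> F i \<union> P.curve (t i) \<and> path_image (g x) \<inter> pos ` verts G = {pos x}) \<and>
    (\<forall>x\<in>t i. \<forall>y\<in>t i. x \<noteq> y \<longrightarrow> path_image (g x) \<inter> path_image (g y) = {c})" for i c and g :: "'a \<Rightarrow> real \<Rightarrow> complex"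
  have "\<exists>c g. Q i c g" if "i < n" for i
    unfolding Q_def by (rule P.triangle_tripod[OF t_triangle F]) (use that in simp_all)
  then have "\<forall>i. \<exists>c g. i < n \<longrightarrow> Q i c g" by blast
  then obtain c where "\<forall>i. \<exists>g. i < n \<longrightarrow> Q i (c i) g" by metis
  then obtain g where Q: "\<And>i. i < n \<Longrightarrow> Q i (c i) (g i)" by metis
  have c: "\<And>i. i < n \<Longrightarrow> c i \<in> F i"
    using Q by (simp_all add: Q_def)
  have g: "\<And>i x. i < n \<Longrightarrow> x \<in> t i \<Longrightarrow> arc (g i x)" "\<And>i x. i < n \<Longrightarrow> x \<in> t i \<Longrightarrow> pathstart (g i x) = c i"
      "\<And>i x. i < n \<Longrightarrow> x \<in> t i \<Longrightarrow> pathfinish (g i x) = pos x"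
      "\<And>i x. i < n \<Longrightarrow> x \<in> t i \<Longrightarrow> path_image (g i x) \<subseteq> F i \<union> P.curve (t i)"
      "\<And>i x. i < n \<Longrightarrow> x \<in> t i \<Longrightarrow> path_image (g i x) \<inter> pos ` verts G = {pos x}"
    using Q by (simp_all add: Q_def)
  have gg: "\<And>i x y. i < n \<Longrightarrow> x \<in> t i \<Longrightarrow> y \<in> t i \<Longrightarrow> x \<noteq> y \<Longrightarrow> path_image (g i x) \<inter> path_image (g i y) = {c i}"
    using Q by (simp_all add: Q_def)
  have Fd: "F i \<inter> P.drawing = {}" if "i < n" for i using P.region_disjoint F(1)[OF that] .
  have FF: "F i \<inter> F j = {}" if "i < n" "j < n" "i \<noteq> j" for i j
  proof -
    have "t i \<noteq> t j" using t_inj that by blast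
    then have "F i \<noteq> F j" using P.curve_inj[OF t_triangle t_triangle] F(2) that by metis
    then show ?thesis using components_nonoverlap F(1) that by blast
  qed
  have Cd: "P.curve (t i) \<subseteq> P.drawing" if "i < n" for i by (rule P.curve_subset_drawing[OF t_triangle[OF that]])
  \<comment> \<open>Two different triangles have no common edge, so their curves meet only where
    arcs of distinct edges do.\<close>
  have CC: "P.curve (t i) \<inter> P.curve (t j) \<subseteq> pos ` verts G" if ij: "i < n" "j < n" "i \<noteq> j" for i j
  proof
    fix p assume "p \<in> P.curve (t i) \<inter> P.curve (t j)"
    then obtain e f where ef: "e \<in> edges G" "e \<subseteq> t i" "p \<in> path_image (crv e)" "f \<in> edges G" "f \<subseteq> t j" "p \<in> path_image (crv f)"
      unfolding P.curve_triangle[OF t_triangle[OF ij(1)]] P.curve_triangle[OF t_triangle[OF ij(2)]] by blast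
    have "e \<noteq> f"
    proof
      assume "e = f"
      obtain a b where "e = {a, b}" "a \<noteq> b" using simple_graph_edgeE[OF simple ef(1)] by metis
      then have "t i = t j" using triangle_eqI[OF t_triangle[OF ij(1)] t_triangle[OF ij(2)], of a b] ef \<open>e = f\<close> by blast
      then show False using t_inj ij by blast
    qed
    then have "p \<in> pos ` (e \<inter> f)" using P.crv_crv[OF ef(1,4)] ef(3,6) by blast
    then show "p \<in> pos ` verts G" using simple_graphD(3)[OF simple ef(1)] by blast
  qed
  \<comment> \<open>A common point would lie on both triangle curves, hence be a vertex position,
    and a leg passes through no vertex except its end.\<close>
  have gcross: "path_image (g i x) \<inter> path_image (g j y) = {}"
    if ij: "i < n" "j < n" "i \<noteq> j" "x \<in> t i" "y \<in> t j" "x \<noteq> y" for i j x y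
  proof (rule ccontr)
    assume "\<not> ?thesis"
    then obtain p where p: "p \<in> path_image (g i x)" "p \<in> path_image (g j y)" by blast
    then have "p \<in> F i \<union> P.curve (t i)" "p \<in> F j \<union> P.curve (t j)" using g(4) ij by blast+
    then have "p \<in> pos ` verts G" using FF[OF ij(1-3)] Fd Cd CC[OF ij(1-3)] ij(1,2) by blast
    then have "p = pos x" "p = pos y" using p g(5) ij by blast+
    moreover have "x \<in> verts G" "y \<in> verts G" using card_t(2) ij by blast+
    ultimately show False using P.pos_inj ij(6) by (auto simp: inj_on_def)
  qed
  have gsame: "path_image (g i x) \<inter> path_image (g j x) = {pos x}"
    if ij: "i < n" "j < n" "i \<noteq> j" "x \<in> t i" "x \<in> t j" for i j x
  proof -
    have "path_image (g i x) \<inter> path_image (g j x) \<subseteq> pos ` verts G"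
      using g(4)[OF ij(1,4)] g(4)[OF ij(2,5)] FF[OF ij(1-3)] Fd[OF ij(1)] Fd[OF ij(2)] Cd[OF ij(1)] Cd[OF ij(2)] CC[OF ij(1-3)] by blast
    then show ?thesis using g(5)[OF ij(1,4)] g(5)[OF ij(2,5)] by blast
  qed
  have "\<forall>x\<in>verts G. \<exists>h. arc h \<and> {pathstart h, pathfinish h} = c ` \<tau> x \<and> path_image h = (\<Union>i\<in>\<tau> x. path_image (g i x))"
  proof
    fix x assume x: "x \<in> verts G"
    obtain i j where ij: "\<tau> x = {i, j}" "i \<noteq> j" using card_\<tau>[OF x] by (meson card_2_iff)
    then have "i \<in> \<tau> x" "j \<in> \<tau> x" by auto
    then have m: "i < n" "j < n" "x \<in> t i" "x \<in> t j" by (auto simp: mem_\<tau>)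
    let ?h = "g i x +++ reversepath (g j x)"
    have "arc ?h" using m ij g(1-3) gsame[OF m(1,2) ij(2) m(3,4)] by (intro arc_join) (auto simp: arc_reversepath)
    moreover have "path_image ?h = path_image (g i x) \<union> path_image (g j x)" using m g(3) by (simp add: path_image_join)
    ultimately show "\<exists>h. arc h \<and> {pathstart h, pathfinish h} = c ` \<tau> x \<and> path_image h = (\<Union>i\<in>\<tau> x. path_image (g i x))"
      using ij m g(2) by (intro exI[of _ ?h]) auto
  qed
  then obtain h where h: "\<And>x. x \<in> verts G \<Longrightarrow> arc (h x)" "\<And>x. x \<in> verts G \<Longrightarrow> {pathstart (h x), pathfinish (h x)} = c ` \<tau> x"
    "\<And>x. x \<in> verts G \<Longrightarrow> path_image (h x) = (\<Union>i\<in>\<tau> x. path_image (g i x))"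
    unfolding bchoice_iff by metis
  \<comment> \<open>The arcs are constructed per vertex of \<open>G\<close>, whereas an embedding
    indexes them by root edges; \<open>\<tau>\<close> is injective, so it can be inverted.\<close>
  define crvH where "crvH e = h (inv_into (verts G) \<tau> e)" for e
  have crvH: "crvH (\<tau> x) = h x" if "x \<in> verts G" for x
    using that \<tau>_inj by (simp add: crvH_def)
  have cg: "c i \<in> path_image (g i x)" if "i \<in> \<tau> x" for i x
    using g(2)[of i x] that by (metis mem_\<tau> pathstart_in_path_image)
  have hc: "path_image (h x) \<inter> c ` {..<n} = c ` \<tau> x" if x: "x \<in> verts G" for x
  proof -
    have "k \<in> \<tau> x" if k: "k < n" "c k \<in> path_image (g i x)" "i \<in> \<tau> x" for k i
    proof -
      have i: "i < n" "x \<in> t i" using k by (auto simp: mem_\<tau>)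
      have "c k \<in> F i \<union> P.curve (t i)" using g(4)[OF i] k by blast
      then have "k = i" using FF[of k i] c[OF k(1)] Fd[OF k(1)] Cd[OF i(1)] k i by blast
      then show ?thesis using k by simp
    qed
    then have "path_image (h x) \<inter> c ` {..<n} \<subseteq> c ` \<tau> x" unfolding h(3)[OF x] by blast
    moreover have "c ` \<tau> x \<subseteq> path_image (h x) \<inter> c ` {..<n}" unfolding h(3)[OF x] using cg by (auto simp: mem_\<tau>)
    ultimately show ?thesis by blast
  qed
  have hh: "path_image (h x) \<inter> path_image (h y) = c ` (\<tau> x \<inter> \<tau> y)" if xy: "x \<in> verts G" "y \<in> verts G" "x \<noteq> y" for x y
  proof
    show "c ` (\<tau> x \<inter> \<tau> y) \<subseteq> path_image (h x) \<inter> path_image (h y)"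
      unfolding h(3)[OF xy(1)] h(3)[OF xy(2)] using cg by blast
    show "path_image (h x) \<inter> path_image (h y) \<subseteq> c ` (\<tau> x \<inter> \<tau> y)"
    proof
      fix p assume "p \<in> path_image (h x) \<inter> path_image (h y)"
      then obtain i j where ij: "i \<in> \<tau> x" "p \<in> path_image (g i x)" "j \<in> \<tau> y" "p \<in> path_image (g j y)"
        unfolding h(3)[OF xy(1)] h(3)[OF xy(2)] by blast
      then have m: "i < n" "x \<in> t i" "j < n" "y \<in> t j" by (auto simp: mem_\<tau>)
      then have "i = j" using gcross[OF m(1,3) _ m(2,4) xy(3)] ij by blast
      then have "p = c i" using gg[OF m(1,2) _ xy(3)] m ij by blast
      then show "p \<in> c ` (\<tau> x \<inter> \<tau> y)" using ij \<open>i = j\<close> by blast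
    qed
  qed
  have "embedding root UNIV c crvH"
    unfolding embedding_def
  proof (intro conjI ballI impI subset_UNIV)
    show "inj_on c (verts root)"
      using c FF by (auto simp: inj_on_def root_def) (metis disjoint_iff)
    fix e assume "e \<in> edges root"
    then obtain x where x: "x \<in> verts G" "e = \<tau> x" by (auto simp: root_def)
    show "arc (crvH e)" "{pathstart (crvH e), pathfinish (crvH e)} = c ` e" using x h by (simp_all add: crvH)
    show "path_image (crvH e) \<inter> c ` verts root = c ` e" using x hc by (simp add: crvH root_def)
    fix f assume "f \<in> edges root" "e \<noteq> f"
    then obtain y where "y \<in> verts G" "f = \<tau> y" "x \<noteq> y" using x by (auto simp: root_def)
    then show "path_image (crvH e) \<inter> path_image (crvH f) = c ` (e \<inter> f)" using x hh by (simp add: crvH)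
  qed
  then show ?thesis unfolding planar_def by blast
qed

end

section \<open>Line graphs of cubic graphs of girth five\<close>

locale cubic_line_graph = quartic +
  fixes H :: "'b graph" and f :: "'a \<Rightarrow> 'b set"
  assumes H: "simple_graph H" "vertex_connected 3 H" "regular 3 H" "girth H = 5"
    and bij: "bij_betw f (verts G) (edges H)"
    and iso: "u \<in> verts G \<Longrightarrow> v \<in> verts G \<Longrightarrow> {u, v} \<in> edges G \<longleftrightarrow> {f u, f v} \<in> edges (line_graph H)"
begin

lemma f_inj: "u \<in> verts G \<Longrightarrow> v \<in> verts G \<Longrightarrow> f u = f v \<Longrightarrow> u = v"
  using bij by (auto simp: bij_betw_def inj_on_def)

lemma f_edge: "u \<in> verts G \<Longrightarrow> f u \<in> edges H"
  using bij by (auto simp: bij_betw_def)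

lemma f_surj: "e \<in> edges H \<Longrightarrow> \<exists>u\<in>verts G. e = f u"
  using bij by (auto simp: bij_betw_def image_iff)

lemma adjacent_iff: "u \<in> verts G \<Longrightarrow> v \<in> verts G \<Longrightarrow> v \<in> N u \<longleftrightarrow> u \<noteq> v \<and> f u \<inter> f v \<noteq> {}"
proof -
  assume uv: "u \<in> verts G" "v \<in> verts G"
  have "v \<in> N u \<longleftrightarrow> {f u, f v} \<in> edges (line_graph H)"
    using neighbours_edge[OF simple] iso[OF uv] by metis
  also have "\<dots> \<longleftrightarrow> f u \<noteq> f v \<and> f u \<inter> f v \<noteq> {}"
    using f_edge uv by (auto simp: line_graph_def doubleton_eq_iff)
  finally show ?thesis using f_inj uv by blast
qed

lemma cycle_length: "is_cycle H p \<Longrightarrow> length p \<ge> 5"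
proof -
  assume "is_cycle H p"
  then have "girth H \<le> enat (length p)" unfolding girth_def by (intro INF_lower) auto
  then show ?thesis using H(4) by (metis enat_ord_simps(1) numeral_eq_enat)
qed

lemma no_triangle:
  assumes "{a, b} \<in> edges H" "{b, c} \<in> edges H" "{a, c} \<in> edges H"
  shows False
proof -
  have "{a, b, c} \<in> triangles H" by (rule trianglesI[OF H(1) assms])
  then have "\<exists>p. is_cycle H p \<and> length p = 3 \<and> cycle_edges p = {e \<in> edges H. e \<subseteq> {a, b, c}}"
    unfolding is_cycle_3_iff[OF H(1)] by blast
  then show False using cycle_length by fastforce
qed

lemma no_square:
  assumes e: "{a, b} \<in> edges H" "{b, c} \<in> edges H" "{c, d} \<in> edges H" "{d, a} \<in> edges H" and d: "a \<noteq> c" "b \<noteq> d"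
  shows False
proof -
  have ne: "u \<noteq> v" if "{u, v} \<in> edges H" for u v
    using simple_graphD(4)[OF H(1) that] by auto
  have "cycle_edges [a, b, c, d] = {{a, b}, {b, c}, {c, d}, {d, a}}"
  proof -
    have "{i. i < length [a, b, c, d]} = {0, 1, 2, 3}" by auto
    moreover have "cycle_edges [a, b, c, d] = (\<lambda>i. {[a, b, c, d] ! i, [a, b, c, d] ! (Suc i mod 4)}) ` {i. i < length [a, b, c, d]}"
      by (auto simp: cycle_edges_def)
    ultimately show ?thesis by simp
  qed
  moreover have "{a, b, c, d} \<subseteq> verts H" using simple_graphD(3)[OF H(1)] e by blast
  ultimately have "is_cycle H [a, b, c, d]"
    using e d ne[OF e(1)] ne[OF e(2)] ne[OF e(3)] ne[OF e(4)] by (auto simp: is_cycle_def)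
  then show False using cycle_length by fastforce
qed

text \<open>Three pairwise meeting edges of \<open>H\<close> without a common end would form a
  triangle, which girth 5 forbids.\<close>

lemma common_at_vertex:
  assumes V: "u \<in> verts G" "v \<in> verts G" "u \<noteq> v" and a: "a \<in> f u" "a \<in> f v" and w: "w \<in> N u" "w \<in> N v"
  shows "a \<in> f w"
proof (rule ccontr)
  assume n: "a \<notin> f w"
  have wV: "w \<in> verts G" using w N_verts by blast
  obtain b where b: "f u = {a, b}" "a \<noteq> b"
    using a(1) simple_graph_edgeE[OF H(1) f_edge[OF V(1)]] by (metis insertE insert_commute singletonD)
  obtain c where c: "f v = {a, c}" "a \<noteq> c"
    using a(2) simple_graph_edgeE[OF H(1) f_edge[OF V(2)]] by (metis insertE insert_commute singletonD)
  have "b \<noteq> c" using f_inj V b c by metis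
  have "b \<in> f w" using adjacent_iff[OF V(1) wV] w(1) b n by auto
  moreover have "c \<in> f w" using adjacent_iff[OF V(2) wV] w(2) c n by auto
  moreover obtain p q where "f w = {p, q}" using simple_graph_edgeE[OF H(1) f_edge[OF wV]] by metis
  ultimately have "f w = {b, c}" using \<open>b \<noteq> c\<close> by auto
  then show False using no_triangle[of a b c] b c f_edge V wV by metis
qed

lemma card_star: "a \<in> verts H \<Longrightarrow> card {e \<in> edges H. a \<in> e} = 3"
  using card_incident_edges[OF H(1)] H(3) by (simp add: regular_def)

lemma edge_verts: "u \<in> verts G \<Longrightarrow> a \<in> f u \<Longrightarrow> a \<in> verts H"
  using simple_graphD(3)[OF H(1)] f_edge by blast

text \<open>By \<open>common_at_vertex\<close> a common neighbour of two edges at \<open>a\<close>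
  is again an edge at \<open>a\<close>, and a cubic graph leaves exactly one.\<close>

lemma cn_adjacent: "v \<in> N u \<Longrightarrow> cn u v = 1"
proof -
  assume uv: "v \<in> N u"
  have V: "u \<in> verts G" "v \<in> verts G" using uv N_verts by blast+
  then obtain a where a: "a \<in> f u" "a \<in> f v" and ne: "u \<noteq> v" using adjacent_iff uv by blast
  have "f ` (N u \<inter> N v) = {e \<in> edges H. a \<in> e} - {f u, f v}"
  proof (intro equalityI subsetI)
    fix e assume "e \<in> f ` (N u \<inter> N v)"
    then obtain w where w: "e = f w" "w \<in> N u" "w \<in> N v" by blast
    then have "w \<in> verts G" "w \<noteq> u" "w \<noteq> v" using N_verts N_irrefl by blast+
    then show "e \<in> {e \<in> edges H. a \<in> e} - {f u, f v}"
      using w common_at_vertex[OF V ne a w(2,3)] f_edge f_inj V by blast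
  next
    fix e assume e: "e \<in> {e \<in> edges H. a \<in> e} - {f u, f v}"
    then obtain w where w: "w \<in> verts G" "e = f w" using f_surj by blast
    then have "w \<in> N u" "w \<in> N v" using e a adjacent_iff[OF V(1) w(1)] adjacent_iff[OF V(2) w(1)] by blast+
    then show "e \<in> f ` (N u \<inter> N v)" using w by blast
  qed
  moreover have "f u \<noteq> f v" using f_inj V ne by blast
  then have "card ({e \<in> edges H. a \<in> e} - {f u, f v}) = 1"
    using card_star[OF edge_verts[OF V(1) a(1)]] a f_edge V f_inj ne simple_graphD(2)[OF H(1)]
    by (subst card_Diff_subset) auto
  moreover have "inj_on f (N u \<inter> N v)" using f_inj N_verts by (intro inj_onI) blast
  ultimately show ?thesis unfolding cn_def by (metis card_image)
qed

text \<open>Two edges of \<open>H\<close> that both join the disjoint edges \<open>f u\<close> and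
  \<open>f v\<close> close a triangle with one of these if they share an end, and a square with both
  otherwise.\<close>

lemma cn_le_one:
  assumes V: "u \<in> verts G" "v \<in> verts G" "u \<noteq> v"
  shows "cn u v \<le> 1"
proof (cases "v \<in> N u")
  case False
  then have disj: "f u \<inter> f v = {}" using adjacent_iff V by blast
  show ?thesis
  proof (rule ccontr)
    assume "\<not> ?thesis"
    then have "\<not> card (N u \<inter> N v) \<le> Suc 0" by (simp add: cn_def)
    moreover have "finite (N u \<inter> N v)" using finite_N by blast
    ultimately have "\<exists>w\<in>N u \<inter> N v. \<exists>w'\<in>N u \<inter> N v. w \<noteq> w'" by (simp add: card_le_Suc0_iff_eq)
    then obtain w w' where w: "w \<in> N u" "w \<in> N v" "w' \<in> N u" "w' \<in> N v" "w \<noteq> w'" by blast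
    have wV: "w \<in> verts G" "w' \<in> verts G" using w N_verts by blast+
    have split: "\<exists>p q. p \<in> f u \<and> q \<in> f v \<and> f x = {p, q}" if x: "x \<in> verts G" "x \<in> N u" "x \<in> N v" for x
    proof -
      obtain p q where pq: "p \<in> f u" "p \<in> f x" "q \<in> f v" "q \<in> f x"
        using adjacent_iff[OF V(1) x(1)] adjacent_iff[OF V(2) x(1)] x by blast
      obtain r s where "f x = {r, s}" using simple_graph_edgeE[OF H(1) f_edge[OF x(1)]] by metis
      moreover have "p \<noteq> q" using pq disj by blast
      ultimately show ?thesis using pq by (intro exI[of _ p] exI[of _ q]) auto
    qed
    obtain p q where pq: "p \<in> f u" "q \<in> f v" "f w = {p, q}" using split[OF wV(1) w(1,2)] by blast
    obtain p' q' where pq': "p' \<in> f u" "q' \<in> f v" "f w' = {p', q'}" using split[OF wV(2) w(3,4)] by blast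
    have "f w \<noteq> f w'" using f_inj wV w(5) by blast
    then have "p \<noteq> p' \<or> q \<noteq> q'" using pq pq' by auto
    have fu: "f u = {p, p'}" if "p \<noteq> p'"
      using that pq pq' simple_graph_edgeE[OF H(1) f_edge[OF V(1)]] by (metis insertE insert_commute singletonD)
    have fv: "f v = {q, q'}" if "q \<noteq> q'"
      using that pq pq' simple_graph_edgeE[OF H(1) f_edge[OF V(2)]] by (metis insertE insert_commute singletonD)
    note E = f_edge[OF V(1)] f_edge[OF V(2)] f_edge[OF wV(1)] f_edge[OF wV(2)]
    consider "p = p'" "q \<noteq> q'" | "p \<noteq> p'" "q = q'" | "p \<noteq> p'" "q \<noteq> q'" using \<open>p \<noteq> p' \<or> q \<noteq> q'\<close> by blast
    then show False
    proof cases
      case 1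
      then show False using no_triangle[of p q q'] E fv pq pq' by simp
    next
      case 2
      then show False using no_triangle[of p p' q] E fu pq pq' by simp
    next
      case 3
      have "p \<noteq> q'" "q \<noteq> p'" using disj pq pq' by blast+
      then show False using no_square[of p q q' p'] E fu[OF 3(1)] fv[OF 3(2)] pq pq' by (simp add: insert_commute)
    qed
  qed
qed (use cn_adjacent in simp)

lemma triangle_star:
  assumes T: "T \<in> triangles G"
  shows "\<exists>a\<in>verts H. f ` T = {e \<in> edges H. a \<in> e}"
proof -
  obtain x y z where xyz: "T = {x, y, z}" and d: "x \<noteq> y" "y \<noteq> z" "x \<noteq> z"
    and e: "{x, y} \<in> edges G" "{y, z} \<in> edges G" "{x, z} \<in> edges G"
    by (rule triangleE[OF T])
  have adj: "y \<in> N x" "z \<in> N x" "z \<in> N y" using e neighbours_edge[OF simple] by blast+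
  then have V: "x \<in> verts G" "y \<in> verts G" "z \<in> verts G" using N_verts by blast+
  obtain a where a: "a \<in> f x" "a \<in> f y" using adjacent_iff[OF V(1,2)] adj by blast
  have "a \<in> f z" by (rule common_at_vertex[OF V(1,2) d(1) a adj(2,3)])
  then have sub: "f ` T \<subseteq> {e \<in> edges H. a \<in> e}" using a f_edge V xyz by auto
  have aH: "a \<in> verts H" by (rule edge_verts[OF V(1) a(1)])
  have "f x \<noteq> f y" "f y \<noteq> f z" "f x \<noteq> f z" using f_inj V d by blast+
  then have "card (f ` T) = 3" using xyz by simp
  then have "f ` T = {e \<in> edges H. a \<in> e}"
    using sub card_star[OF aH] simple_graphD(2)[OF H(1)] by (intro card_subset_eq) auto
  then show ?thesis using aH by blast
qed

text \<open>The triangle is the star of a vertex \<open>a\<close>, and deleting a star in the line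
  graph corresponds to deleting \<open>a\<close> in \<open>H\<close>, which leaves \<open>H\<close>
  connected.\<close>

lemma triangle_nonseparating:
  assumes T: "T \<in> triangles G"
  shows "connected_graph (delete_verts G T)"
proof -
  obtain a where a: "a \<in> verts H" "f ` T = {e \<in> edges H. a \<in> e}" using triangle_star[OF T] by blast
  have TV: "T \<subseteq> verts G" "card T = 3" using T by (auto simp: triangles_def)
  have aT: "u \<in> T \<longleftrightarrow> a \<in> f u" if "u \<in> verts G" for u
    using that a(2) f_edge[OF that] f_inj[OF that] TV(1) by blast
  have conn: "connected_graph (delete_verts H {a})"
    using H(2) a(1) by (simp add: vertex_connected_def)
  have vT: "verts (delete_verts G T) = verts G - T" by (simp add: delete_verts_def)
  show ?thesis
  proof (rule connected_graphI)
    \<comment> \<open>\<open>H\<close> has more than three vertices and hence at least six edges, so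
      some vertex of \<open>G\<close> lies outside \<open>T\<close>.\<close>
    have "card (verts G) = card (edges H)" using bij by (rule bij_betw_same_card)
    moreover have "3 * card (verts H) = 2 * card (edges H)" by (rule handshake[OF H(1,3)])
    moreover have "card (verts H) > 3" using H(2) by (simp add: vertex_connected_def)
    ultimately have "card (verts G) \<noteq> card T" using TV by linarith
    then show "verts (delete_verts G T) \<noteq> {}" using TV(1) vT by auto
    fix U assume U: "U \<subseteq> verts (delete_verts G T)" "U \<noteq> {}"
      and cl: "\<And>x y. x \<in> U \<Longrightarrow> y \<in> verts (delete_verts G T) \<Longrightarrow> {x, y} \<in> edges (delete_verts G T) \<Longrightarrow> y \<in> U"
    have UV: "U \<subseteq> verts G - T" using U vT by simp
    have step: "v \<in> U" if "u \<in> U" "v \<in> verts G" "v \<notin> T" "x \<in> f u" "x \<in> f v" for u v x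
    proof (cases "u = v")
      case False
      have u: "u \<in> verts G" "u \<notin> T" using that(1) UV by blast+
      then have "v \<in> N u" using adjacent_iff[OF u(1) that(2)] that False by blast
      then have "{u, v} \<in> edges G" using neighbours_edge[OF simple] by blast
      then have "{u, v} \<in> edges (delete_verts G T)" using u that(3) by (simp add: delete_verts_def)
      then show ?thesis using cl[of u v] that vT by blast
    qed (use that in simp)
    obtain u0 where u0: "u0 \<in> U" using U by blast
    obtain x0 y0 where x0: "f u0 = {x0, y0}" "x0 \<in> verts H"
    proof -
      have "u0 \<in> verts G" using u0 UV by blast
      then show ?thesis using simple_graph_edgeE[OF H(1) f_edge[of u0]] that by metis
    qed
    \<comment> \<open>Edges of \<open>H\<close> that share an end are adjacent in \<open>G\<close>,
      so the ends of the edges in \<open>U\<close> spread over all of \<open>H\<close> without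
      \<open>a\<close>.\<close>
    have Wcl: "verts (delete_verts H {a}) \<subseteq> \<Union> (f ` U)"
    proof (rule connected_graph_closed_set[OF conn, of x0])
      show "x0 \<in> \<Union> (f ` U)" using u0 x0 by blast
      have "a \<notin> f u0" using aT[of u0] u0 UV by blast
      then show "x0 \<in> verts (delete_verts H {a})" using x0 by (auto simp: delete_verts_def)
      fix x y assume x: "x \<in> \<Union> (f ` U)" and e: "{x, y} \<in> edges (delete_verts H {a})"
      then obtain u where u: "u \<in> U" "x \<in> f u" by blast
      have e': "{x, y} \<in> edges H" "a \<notin> {x, y}" using e by (auto simp: delete_verts_def)
      then obtain v where v: "v \<in> verts G" "{x, y} = f v" using f_surj by blast
      then have "v \<notin> T" using aT e'(2) by blast
      then have "v \<in> U" using step[OF u(1) v(1) _ u(2)] v(2) by blast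
      then show "y \<in> \<Union> (f ` U)" using v(2) by blast
    qed
    show "verts (delete_verts G T) \<subseteq> U"
    proof
      fix v assume "v \<in> verts (delete_verts G T)"
      then have v: "v \<in> verts G" "v \<notin> T" by (simp_all add: vT)
      obtain x y where x: "f v = {x, y}" "x \<in> verts H" using simple_graph_edgeE[OF H(1) f_edge[OF v(1)]] by metis
      have "x \<noteq> a" using aT[OF v(1)] v(2) x by blast
      then have "x \<in> \<Union> (f ` U)" using Wcl x(2) by (auto simp: delete_verts_def)
      then obtain u where "u \<in> U" "x \<in> f u" by blast
      then show "v \<in> U" using step[of u v x] v x(1) by blast
    qed
  qed
qed

lemma deza: "deza_graph G"
proof -
  have "card (N u \<inter> N v) = 0 \<or> card (N u \<inter> N v) = 1" if "u \<in> verts G" "v \<in> verts G" "u \<noteq> v" for u v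
    using cn_le_one[OF that] by (simp add: cn_def) linarith
  then show ?thesis using reg unfolding deza_graph_def by (metis zero_le_one)
qed

lemma card_triangles: "3 * card (triangles G) = 2 * card (verts G)"
proof -
  have "card {T \<in> triangles G. e \<subseteq> T} = 1" if e: "e \<in> edges G" for e
  proof -
    obtain u v where uv: "e = {u, v}" using simple_graph_edgeE[OF simple e] by metis
    then have "v \<in> N u" using e neighbours_edge[OF simple] by blast
    then show ?thesis using triangles_on_edge[OF simple] cn_adjacent uv e unfolding cn_def by metis
  qed
  then have "3 * card (triangles G) = card (edges G)"
    using sum_triangles_on_edges[OF simple] by simp
  then show ?thesis using handshake[OF simple reg] by simp
qed

end

section \<open>The two implications for a plane drawing, and the theorem\<close>

lemma graph_iso_line_graphE:
  assumes "graph_iso G (line_graph H)"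
  obtains f where "bij_betw f (verts G) (edges H)"
    "\<And>u v. u \<in> verts G \<Longrightarrow> v \<in> verts G \<Longrightarrow> {u, v} \<in> edges G \<longleftrightarrow> {f u, f v} \<in> edges (line_graph H)"
proof -
  have "verts (line_graph H) = edges H" by (simp add: line_graph_def)
  then show ?thesis using assms that unfolding graph_iso_def by metis
qed

locale quartic_plane = quartic G + plane_graph G pos crv for G :: "'a graph" and pos crv +
  assumes three_connected: "vertex_connected 3 G"
begin

lemma big: "card (verts G) > 3"
  using three_connected by (simp add: vertex_connected_def)

lemma edges_verts: "card (edges G) = 2 * card (verts G)"
  using handshake[OF simple reg] by simp

lemma card_regions: "card regions = card (verts G) + 2"
  using Euler_formula(2)[OF conn] edges_verts by simp

text \<open>With \<open>|E| = 2 |V|\<close> and \<open>f = |V| + 2\<close>, the bound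
  \<open>4 f <= 2 |E| + f3\<close> reads \<open>4 |V| + 8 <= 4 |V| + f3\<close>.\<close>

lemma eight_triangular_regions: "card triangular_regions \<ge> 8"
proof -
  have "4 * card regions \<le> 2 * card (edges G) + card triangular_regions"
  proof (rule card_triangular_regions_ge[OF conn])
    show "2 \<le> card regions" by (simp add: card_regions)
    show "connected_graph (G\<lparr>edges := edges G - {e}\<rparr>)" if "e \<in> edges G" for e
      by (rule vertex_connected_delete_edge[OF simple three_connected reg _ that]) simp
    show "neighbours G v \<noteq> {}" if "v \<in> verts G" for v using card_N[OF that] by auto
  qed
  then show ?thesis using card_regions edges_verts by simp
qed

lemma triangular_regions_le: "card triangular_regions \<le> card (triangles G)"
  unfolding card_triangular_regions[OF big]
  using finite_triangles[OF simple] by (intro card_mono) auto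

lemma line_graph_of_cubic:
  assumes deza: "deza_graph G" and eq: "3 * card triangular_regions = 2 * card (verts G)"
  shows "\<exists>H :: nat graph. polyhedral_graph H \<and> regular 3 H \<and> girth H = 5 \<and> graph_iso G (line_graph H)"
proof -
  have V12: "card (verts G) \<ge> 12" using eight_triangular_regions eq by linarith
  have three: "3 dvd card (verts G)"
    using eq by presburger
  have "card (triangles G) > 0" using eight_triangular_regions triangular_regions_le by linarith
  then obtain T where T: "T \<in> triangles G" by fastforce
  obtain l m where lm: "l \<le> m" "\<And>u v. u \<in> verts G \<Longrightarrow> v \<in> verts G \<Longrightarrow> u \<noteq> v \<Longrightarrow> cn u v = l \<or> cn u v = m"
    using deza unfolding deza_graph_def cn_def by metis
  have "l = 0"
    using deza_positive[OF lm(2)] lm(1) three V12 by fastforce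
  moreover have "m \<le> 1"
  proof (rule ccontr)
    assume "\<not> m \<le> 1"
    then have "card (verts G) \<le> 8" using lm \<open>l = 0\<close> T by (intro deza_zero_many[of m T]) auto
    then show False using V12 by simp
  qed
  ultimately have cn_le: "cn u v \<le> 1" if "u \<noteq> v" for u v
  \<comment> \<open>The bound is required for arbitrary arguments; outside the vertex set
    neighbourhoods are empty.\<close>
  proof (cases "u \<in> verts G \<and> v \<in> verts G")
    case True
    then show ?thesis using lm(2)[of u v] that \<open>l = 0\<close> \<open>m \<le> 1\<close> by auto
  next
    case False
    then have "N u \<inter> N v = {}" using N_verts(2) by blast
    then show ?thesis by (simp add: cn_def)
  qed
  have on_edge: "card {T \<in> triangles G. e \<subseteq> T} \<le> 1" if e: "e \<in> edges G" for e
  proof -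
    obtain u v where "e = {u, v}" "u \<noteq> v" using simple_graph_edgeE[OF simple e] by metis
    then show ?thesis using triangles_on_edge[OF simple] cn_le e unfolding cn_def by metis
  qed
  have sum: "(\<Sum>e\<in>edges G. card {T \<in> triangles G. e \<subseteq> T}) = 3 * card (triangles G)"
    by (rule sum_triangles_on_edges[OF simple])
  have "(\<Sum>e\<in>edges G. card {T \<in> triangles G. e \<subseteq> T}) \<le> (\<Sum>e\<in>edges G. 1)"
    using on_edge by (intro sum_mono)
  then have "3 * card (triangles G) \<le> 2 * card (verts G)" using sum edges_verts by simp
  \<comment> \<open>The number of triangles is squeezed between \<open>f3\<close>, which is two
    thirds of \<open>|V|\<close>, and the upper bound just obtained, which is the same
    number.\<close>
  then have all: "card triangular_regions = card (triangles G)" and tot: "3 * card (triangles G) = card (edges G)"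
    using triangular_regions_le eq edges_verts by linarith+
  have exact: "card {T \<in> triangles G. e \<subseteq> T} = 1" if e: "e \<in> edges G" for e
  proof (rule ccontr)
    assume "\<not> ?thesis"
    then have "card {T \<in> triangles G. e \<subseteq> T} < 1" using on_edge[OF e] by simp
    then have "(\<Sum>e\<in>edges G. card {T \<in> triangles G. e \<subseteq> T}) < (\<Sum>e\<in>edges G. 1)"
      using on_edge e simple_graphD(2)[OF simple] by (intro sum_strict_mono_ex1) auto
    then show False using sum tot by simp
  qed
  have cn_adjacent: "cn u v = 1" if "v \<in> N u" for u v
    using triangles_on_edge[OF simple, of u v] exact[of "{u, v}"] that neighbours_edge[OF simple] unfolding cn_def by metis
  have "{T \<in> triangles G. \<exists>F\<in>regions. frontier F = curve T} = triangles G"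
    using all card_triangular_regions[OF big] finite_triangles[OF simple] by (intro card_subset_eq) auto
  then have facial: "\<exists>F\<in>regions. frontier F = curve T" if "T \<in> triangles G" for T
    using that by blast
  obtain t where t: "bij_betw t {..<card (triangles G)} (triangles G)"
    using ex_bij_betw_nat_finite[OF finite_triangles[OF simple]] by (auto simp: atLeast0LessThan)
  interpret R: triangle_decomposed G "card (triangles G)" t
    using cn_le cn_adjacent t by unfold_locales
  have vc: "vertex_connected 3 R.root"
    using eight_triangular_regions all by (intro R.root_vertex_connected[OF three_connected]) simp
  have planar: "planar R.root"
    by (rule R.root_planar[OF plane_graph_axioms facial])
  then obtain pos' crv' where "embedding R.root (UNIV :: complex set) pos' crv'" unfolding planar_def by auto
  then interpret H: plane_graph R.root pos' crv'
    using R.root_simple by unfold_locales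
  have "\<exists>p. is_cycle R.root p \<and> length p \<le> 5"
  proof (rule H.cubic_short_cycle[OF vertex_connected_connected[OF vc] R.root_regular])
    show "connected_graph (R.root\<lparr>edges := edges R.root - {e}\<rparr>)" if "e \<in> edges R.root" for e
      by (rule vertex_connected_delete_edge[OF R.root_simple vc R.root_regular _ that]) simp
  qed
  then have "girth R.root = 5" by (rule R.girth_root)
  then show ?thesis
    using R.root_simple planar vc R.root_regular R.iso_line_graph_root unfolding polyhedral_graph_def by blast
qed

lemma deza_of_line_graph:
  assumes H: "polyhedral_graph H" "regular 3 H" "girth H = 5" "graph_iso G (line_graph H)"
  shows "deza_graph G" "3 * card triangular_regions = 2 * card (verts G)"
proof -
  obtain f where f: "bij_betw f (verts G) (edges H)"
    "\<And>u v. u \<in> verts G \<Longrightarrow> v \<in> verts G \<Longrightarrow> {u, v} \<in> edges G \<longleftrightarrow> {f u, f v} \<in> edges (line_graph H)"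
    using graph_iso_line_graphE[OF H(4)] by metis
  interpret L: cubic_line_graph G H f
    using H f by unfold_locales (auto simp: polyhedral_graph_def)
  show "deza_graph G" by (rule L.deza)
  have "{T \<in> triangles G. \<exists>F\<in>regions. frontier F = curve T} = triangles G"
    using nonseparating_triangle_region L.triangle_nonseparating by blast
  then show "3 * card triangular_regions = 2 * card (verts G)"
    using card_triangular_regions[OF big] L.card_triangles by simp
qed

end

theorem theorem1p4:
  fixes G :: "'a graph"
    and pos :: "'a \<Rightarrow> real^3" and crv :: "'a set \<Rightarrow> real \<Rightarrow> real^3"
  assumes "polyhedral_graph G" and "regular 4 G"
    and "\<not> graph_iso G octahedron"
    and "\<not> graph_iso G square_antiprism"
    and "\<not> graph_iso G (line_graph triangular_prism)"
    and "embedding G unit_sphere pos crv"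
  shows "deza_graph G \<and>
           real (card (triangular_faces G pos crv)) = 2 * real (card (faces G pos crv)) / 3 - 4 / 3
         \<longleftrightarrow>
         (\<exists>H :: nat graph. polyhedral_graph H \<and> regular 3 H \<and> girth H = 5 \<and> graph_iso G (line_graph H))"
proof -
  have G: "simple_graph G" "vertex_connected 3 G" using assms(1) by (simp_all add: polyhedral_graph_def)
  have conn: "connected_graph G" by (rule vertex_connected_connected[OF G(2)])
  then have "verts G \<noteq> {}" by (simp add: connected_graph_def)
  then obtain pos' crv' where P: "plane_graph G pos' crv'"
    and card: "card (faces G pos crv) = card (components (- plane_graph.draw pos' crv' (verts G) (edges G)))"
    "card (triangular_faces G pos crv) = card (plane_graph.triangular_regions G pos' crv')"
    using sphere_to_plane[OF G(1) _ assms(6)] by metis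
  interpret quartic_plane G pos' crv'
    using G conn assms(2) P by (simp add: quartic_plane_def quartic_plane_axioms_def quartic_def)
  \<comment> \<open>Substituting \<open>f = |V| + 2\<close> turns \<open>2 f / 3 - 4 / 3\<close>
    into \<open>2 |V| / 3\<close>.\<close>
  have "real (card (triangular_faces G pos crv)) = 2 * real (card (faces G pos crv)) / 3 - 4 / 3
     \<longleftrightarrow> 3 * card triangular_regions = 2 * card (verts G)"
    unfolding card card_regions by (simp add: field_simps flip: of_nat_eq_iff[where 'a = real])
  then show ?thesis using line_graph_of_cubic deza_of_line_graph by blast
qed

end
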